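(* Let $\eta=(\eta_1,\dots,\eta_t)$ be a sequence of positive integers with sum $n$, let $\gamma\in\mathbb{Z}^n$ be such that every $R_i$ in the associated sequence $R=(R_1,\dots,R_t)$ is a partition (with $\eta_i$ parts, some possibly zero), and let $\lambda$ be a partition with $n$ parts (some possibly zero) with $|\lambda|=\sum_i|R_i|$. If $t=1$, then $K_{\lambda;(R_1)}(q)=\delta_{\lambda,R_1}$. If $t>1$, write $m=\eta_1$ and $\widehat R=(R_2,\dots,R_t)$. Then $$K_{\lambda;R}(q)=\sum_{w}(-1)^w q^{|\alpha(w)|-|R_1|}\sum_\sigma \mathrm{LR}^{\sigma}_{\alpha(w)/R_1,\beta(w)}\,K_{\sigma;\widehat R}(q),$$ where $w$ runs over the minimal length coset representatives of $S_n/(S_m\times S_{n-m})$, $\alpha(w)$ and $\beta(w)$ are the first $m$ and the last $n-m$ parts of the weight $w^{-1}(\lambda+\rho)-\rho$, $\sigma$ runs over partitions with $n-m$ parts (some possibly zero), and the $w$-th summand is understood to be zero unless all parts of $\alpha(w)$ are nonnegative and $\alpha(w)\supseteq R_1$.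
   Context: Let $\eta=(\eta_1,\dots,\eta_t)$ be a sequence of positive integers with sum $n$ and $\gamma\in\mathbb{Z}^n$. Let $\mathrm{Roots}_\eta=\{(i,j):1\le i\le\eta_1+\dots+\eta_r<j\le n\text{ for some }r\}$, $\rho=(n-1,\dots,1,0)$. $S_n$ acts on $\mathbb{Z}^n$ by $(w^{-1}\alpha)_i=\alpha_{w(i)}$ and on Laurent polynomials in $x_1,\dots,x_n$ by $w\,x^\alpha=x^{w\alpha}$. Put $J(f)=\sum_{w\in S_n}(-1)^w\,wf$, $\pi(f)=J(x^\rho)^{-1}J(x^\rho f)$, and $s_\lambda(x)=\pi(x^\lambda)$ for a dominant weight $\lambda$ ($\lambda_1\ge\dots\ge\lambda_n$). Let $B_\eta(x;q)=\prod_{(i,j)\in\mathrm{Roots}_\eta}(1-q\,x_i/x_j)^{-1}$, $H_{\eta,\gamma}(x;q)=\pi(x^\gamma B_\eta(x;q))$ (formal power series in $q$ with Laurent polynomial coefficients), and define $K_{\lambda,\gamma,\eta}(q)$ by $H_{\eta,\gamma}(x;q)=\sum_\lambda K_{\lambda,\gamma,\eta}(q)s_\lambda(x)$, $\lambda$ running over dominant weights. $R_1$ is the sequence of the first $\eta_1$ entries of $\gamma$, $R_2$ the next $\eta_2$ entries, etc.; when all $R_i$ are partitions, $K_{\lambda;R}(q):=K_{\lambda,\gamma,\eta}(q)$. In particular $K_{\sigma;\widehat R}(q)$ is the analogous coefficient for $n-m$ variables, $\widehat\eta=(\eta_2,\dots,\eta_t)$ and $\widehat\gamma=(\gamma_{m+1},\dots,\gamma_n)$.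 Minimal length representatives are the $w\in S_n$ with $w(1)<\dots<w(m)$ and $w(m+1)<\dots<w(n)$. For these $w$, $\alpha(w)$ is weakly decreasing and $\beta(w)$ is a partition. $\mathrm{LR}^{\sigma}_{\alpha/R_1,\beta}$ denotes the coefficient of the Schur polynomial $s_\sigma(z)$ in $s_{\alpha/R_1}(z)\,s_\beta(z)$, where $z=(z_1,\dots,z_{n-m})$ and $s_{\alpha/R_1}$ is the skew Schur polynomial. *)

theory Defs
  imports
    "HOL-Library.Poly_Mapping"
    "HOL-Library.FuncSet"
    "HOL-Combinatorics.Permutations"
    "HOL-Computational_Algebra.Formal_Power_Series"
begin

text \<open>
  All positions are 0-based: weights in \<open>\<int>\<^sup>n\<close> are integer lists of length \<open>n\<close> with entries
  \<open>0, \<dots>, n - 1\<close>, and \<open>S\<^sub>n\<close> consists of the \<open>w\<close> with \<open>w permutes {..<n}\<close>.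
\<close>

definition dominant :: "nat \<Rightarrow> int list \<Rightarrow> bool" where
  "dominant n \<alpha> \<longleftrightarrow> length \<alpha> = n \<and> sorted_wrt (\<ge>) \<alpha>"

definition is_partition :: "nat \<Rightarrow> int list \<Rightarrow> bool" where
  "is_partition n \<alpha> \<longleftrightarrow> dominant n \<alpha> \<and> (\<forall>a\<in>set \<alpha>. 0 \<le> a)"

definition rho :: "nat \<Rightarrow> int list" where
  "rho n = map (\<lambda>i. int (n - 1 - i)) [0..<n]"

fun blocks :: "nat list \<Rightarrow> 'a list \<Rightarrow> 'a list list" where
  "blocks [] xs = []"
| "blocks (k # ks) xs = take k xs # blocks ks (drop k xs)"

text \<open>
  Laurent polynomials with integer coefficients in \<open>x\<^sub>0, x\<^sub>1, \<dots>\<close>; only \<open>x\<^sub>0, \<dots>, x\<^bsub>n-1\<^esub>\<close> will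
  occur when there are \<open>n\<close> variables.
\<close>

type_synonym laurent = "(nat \<Rightarrow>\<^sub>0 int) \<Rightarrow>\<^sub>0 int"

definition monomial :: "int list \<Rightarrow> laurent" where
  "monomial \<alpha> = Poly_Mapping.single (Poly_Mapping.nth \<alpha>) 1"

definition X :: "nat \<Rightarrow> laurent" where
  "X i = Poly_Mapping.single (Poly_Mapping.single i 1) 1"

definition X_quot :: "nat \<Rightarrow> nat \<Rightarrow> laurent" where
  "X_quot i j = Poly_Mapping.single (Poly_Mapping.single i 1 - Poly_Mapping.single j 1) 1"

lemma X_quot_mult_X: "X_quot i j * X j = X i"
  by (simp add: X_quot_def X_def mult_single)

text \<open>
  \<open>Poly_Mapping.map_key (inv w) \<alpha>\<close> is \<open>w\<alpha>\<close>, since \<open>(w\<alpha>)\<^sub>i = \<alpha>\<^bsub>w\<^sup>-\<^sup>1(i)\<^esub>\<close>.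
\<close>

definition perm_act :: "(nat \<Rightarrow> nat) \<Rightarrow> laurent \<Rightarrow> laurent" where
  "perm_act w f = (\<Sum>\<alpha>\<in>Poly_Mapping.keys f.
     Poly_Mapping.single (Poly_Mapping.map_key (inv w) \<alpha>) (Poly_Mapping.lookup f \<alpha>))"

definition J :: "nat \<Rightarrow> laurent \<Rightarrow> laurent" where
  "J n f = (\<Sum>w | w permutes {..<n}. of_int (sign w) * perm_act w f)"

text \<open>
  \<open>J(x\<^sup>\<rho>)\<close> is not invertible among Laurent polynomials, but it divides \<open>J(x\<^sup>\<rho> f)\<close> for every Laurent
  polynomial \<open>f\<close> in \<open>x\<^sub>0, \<dots>, x\<^bsub>n-1\<^esub>\<close>. The quotient is unique because the type \<open>laurent\<close> is an
  integral domain.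
\<close>

definition weyl_pi :: "nat \<Rightarrow> laurent \<Rightarrow> laurent" where
  "weyl_pi n f = (THE g. J n (monomial (rho n)) * g = J n (monomial (rho n) * f))"

definition schur :: "nat \<Rightarrow> int list \<Rightarrow> laurent" where
  "schur n \<alpha> = weyl_pi n (monomial \<alpha>)"

text \<open>
  The coefficient of \<open>s\<^sub>\<lambda>\<close> in a symmetric Laurent polynomial, i.e. in its unique expansion as a
  finite integer combination of the \<open>s\<^sub>\<mu>\<close> with \<open>\<mu>\<close> dominant.
\<close>

definition schur_expansion :: "nat \<Rightarrow> laurent \<Rightarrow> (int list \<Rightarrow>\<^sub>0 int)" where
  "schur_expansion n f = (THE c. Poly_Mapping.keys c \<subseteq> {\<mu>. dominant n \<mu>} \<and>
     f = (\<Sum>\<mu>\<in>Poly_Mapping.keys c. of_int (Poly_Mapping.lookup c \<mu>) * schur n \<mu>))"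

definition schur_coeff :: "nat \<Rightarrow> laurent \<Rightarrow> int list \<Rightarrow> int" where
  "schur_coeff n f \<mu> = Poly_Mapping.lookup (schur_expansion n f) \<mu>"

definition Roots :: "nat list \<Rightarrow> (nat \<times> nat) set" where
  "Roots \<eta> = {(i, j). \<exists>r\<in>{1..length \<eta>}.
     i < sum_list (take r \<eta>) \<and> sum_list (take r \<eta>) \<le> j \<and> j < sum_list \<eta>}"

text \<open>
  Formal power series in \<open>q\<close> (\<open>= fps_X\<close>) with Laurent polynomial coefficients.
  The inverse with constant coefficient \<open>1\<close> is taken with the library's \<open>fps_right_inverse\<close>, as
  \<open>inverse\<close> on \<open>fps\<close> needs coefficients with a division operation.
\<close>

definition root_factor :: "nat \<times> nat \<Rightarrow> laurent fps" where
  "root_factor = (\<lambda>(i, j). fps_right_inverse (1 - fps_const (X_quot i j) * fps_X) 1)"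

lemma root_factor_inverse:
  "(1 - fps_const (X_quot i j) * fps_X) * root_factor (i, j) = 1"
  unfolding root_factor_def prod.case by (rule fps_right_inverse) simp

definition B :: "nat list \<Rightarrow> laurent fps" where
  "B \<eta> = (\<Prod>p\<in>Roots \<eta>. root_factor p)"

definition H :: "nat list \<Rightarrow> int list \<Rightarrow> laurent fps" where
  "H \<eta> \<gamma> = Abs_fps (\<lambda>d. weyl_pi (sum_list \<eta>) (fps_nth (fps_const (monomial \<gamma>) * B \<eta>) d))"

text \<open>
  For each power of \<open>q\<close> only finitely many \<open>\<lambda>\<close> contribute, so the expansion
  \<open>H = \<Sum>\<^sub>\<lambda> K\<^sub>\<lambda>(q) s\<^sub>\<lambda>\<close> is read off degree by degree.
\<close>

definition K :: "int list \<Rightarrow> int list \<Rightarrow> nat list \<Rightarrow> int fps" where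
  "K \<mu> \<gamma> \<eta> = Abs_fps (\<lambda>d. schur_coeff (sum_list \<eta>) (fps_nth (H \<eta> \<gamma>) d) \<mu>)"

definition contains :: "int list \<Rightarrow> int list \<Rightarrow> bool" where
  "contains \<alpha> \<mu> \<longleftrightarrow> list_all2 (\<le>) \<mu> \<alpha>"

definition skew_cells :: "int list \<Rightarrow> int list \<Rightarrow> (nat \<times> nat) set" where
  "skew_cells \<alpha> \<mu> = {(r, c). r < length \<alpha> \<and> \<mu> ! r \<le> int c \<and> int c < \<alpha> ! r}"

definition skew_ssyt :: "nat \<Rightarrow> int list \<Rightarrow> int list \<Rightarrow> (nat \<times> nat \<Rightarrow> nat) set" where
  "skew_ssyt N \<alpha> \<mu> = {T \<in> skew_cells \<alpha> \<mu> \<rightarrow>\<^sub>E {..<N}.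
     (\<forall>r c c'. (r, c) \<in> skew_cells \<alpha> \<mu> \<and> (r, c') \<in> skew_cells \<alpha> \<mu> \<and> c < c' \<longrightarrow> T (r, c) \<le> T (r, c')) \<and>
     (\<forall>r r' c. (r, c) \<in> skew_cells \<alpha> \<mu> \<and> (r', c) \<in> skew_cells \<alpha> \<mu> \<and> r < r' \<longrightarrow> T (r, c) < T (r', c))}"

definition skew_schur :: "nat \<Rightarrow> int list \<Rightarrow> int list \<Rightarrow> laurent" where
  "skew_schur N \<alpha> \<mu> = (\<Sum>T\<in>skew_ssyt N \<alpha> \<mu>. \<Prod>p\<in>skew_cells \<alpha> \<mu>. X (T p))"

text \<open>\<open>LR\<^sup>\<sigma>\<^bsub>\<alpha>/\<mu>,\<beta>\<^esub>\<close> with \<open>N\<close> variables.\<close>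

definition LR :: "nat \<Rightarrow> int list \<Rightarrow> int list \<Rightarrow> int list \<Rightarrow> int list \<Rightarrow> int" where
  "LR N \<sigma> \<alpha> \<mu> \<beta> = schur_coeff N (skew_schur N \<alpha> \<mu> * schur N \<beta>) \<sigma>"

lemma finite_LR: "finite {\<sigma>. P \<sigma> \<and> LR N \<sigma> \<alpha> \<mu> \<beta> \<noteq> 0}"
  by (rule finite_subset[OF _ finite_lookup[of
        "schur_expansion N (skew_schur N \<alpha> \<mu> * schur N \<beta>)"]])
     (auto simp: LR_def schur_coeff_def)

definition min_coset_reps :: "nat \<Rightarrow> nat \<Rightarrow> (nat \<Rightarrow> nat) set" where
  "min_coset_reps n m = {w. w permutes {..<n} \<and>
     strict_mono_on {..<m} w \<and> strict_mono_on {m..<n} w}"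

text \<open>\<open>w\<^sup>-\<^sup>1(\<lambda> + \<rho>) - \<rho>\<close>; note that \<open>permute_list w \<alpha>\<close> is \<open>w\<^sup>-\<^sup>1\<alpha>\<close>.\<close>

definition dot_inv :: "(nat \<Rightarrow> nat) \<Rightarrow> int list \<Rightarrow> int list" where
  "dot_inv w \<alpha> = (let \<rho> = rho (length \<alpha>) in
     map2 (-) (permute_list w (map2 (+) \<alpha> \<rho>)) \<rho>)"

end

theory Submission
  imports Defs
begin

text \<open>
  Applying \<open>\<pi>\<close> and reading off the coefficient of \<open>s\<^sub>\<lambda>\<close> amounts to the formula
  \<open>K\<^sub>\<lambda> = \<Sum>\<^sub>p (-1)\<^sup>p [x\<^bsup>p\<^sup>-\<^sup>1(\<lambda>+\<rho>)-\<rho>-\<gamma>\<^esup>] B\<^sub>\<eta>\<close>. Write \<open>p\<close> as a minimal coset representative \<open>w\<close> times elements of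
  \<open>S\<^sub>m\<close> and \<open>S\<^bsub>n-m\<^esub>\<close>, and split off from \<open>B\<^sub>\<eta>\<close> the factors \<open>(1 - q x\<^sub>i / x\<^sub>j)\<^sup>-\<^sup>1\<close> with \<open>i\<close> among the first
  \<open>m\<close> positions and \<open>j\<close> among the others: extracting the exponents \<open>a\<^sub>1, \<dots>, a\<^sub>m\<close> of the first \<open>m\<close>
  variables \<open>x\<^sub>i\<close> leaves
  \<open>q\<^bsup>|a|\<^esup> \<Prod>\<^sub>i h\<^bsub>a\<^sub>i\<^esub>(1/z)\<close>. The alternating sum over \<open>S\<^sub>m\<close> is then a Jacobi-Trudi determinant, equal to
  \<open>s\<^bsub>\<alpha>(w)/R\<^sub>1\<^esub>(1/z)\<close>, and the alternating sum over \<open>S\<^bsub>n-m\<^esub>\<close> pairs its product with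
  \<open>\<Sum>\<^sub>\<sigma> K\<^sub>\<sigma> s\<^sub>\<sigma>(z)\<close> against \<open>s\<^bsub>\<beta>(w)\<^esub>\<close>. Since multiplication by \<open>s(1/z)\<close> is adjoint to multiplication by
  \<open>s(z)\<close>, this pairing is the sum of Littlewood-Richardson coefficients.
\<close>



text \<open>The obstacle is that \<open>weyl_pi\<close> and \<open>schur_expansion\<close> are
  definite descriptions, meaningful only once the quotient and the expansion are known to exist and
  to be unique. The remedy is never to compute with a quotient: a symmetric \<open>f\<close> is
  replaced by its alternating numerator \<open>vdm n * f\<close>. An alternating polynomial is
  determined by its coefficients at strictly decreasing exponents, each of these is \<mu> + \<rho>
  for exactly one dominant \<mu>, and the numerator of the Schur polynomial of \<mu> has coefficient
  1 there and 0 at all other such exponents. So the coefficient of a Schur polynomial in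
  \<open>f\<close> is a single coefficient of the numerator, and the pairing behind the adjointness
  is a finite sum over strictly decreasing exponents.

  The inverted variables come from the roots between the blocks: \<open>x_i / x_j\<close> carries a
  negative power of the variable in the second block. Jacobi-Trudi is obtained from the fact that
  determinant and tableau sum obey the same branching rule in the number of variables. Since
  dominant weights may have negative entries, a separate argument on signs of exponents shows that
  only partitions \<sigma> contribute.\<close>

abbreviation lookup where "lookup \<equiv> Poly_Mapping.lookup"
abbreviation single where "single \<equiv> Poly_Mapping.single"
abbreviation keys where "keys \<equiv> Poly_Mapping.keys"
abbreviation map_key where "map_key \<equiv> Poly_Mapping.map_key"

type_synonym expo = "nat \<Rightarrow>\<^sub>0 int"

section \<open>Coefficients of Laurent polynomials\<close>

lemma poly_mapping_sum_singles:
  fixes f :: "'a \<Rightarrow>\<^sub>0 'b::comm_monoid_add"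
  shows "f = (\<Sum>e\<in>keys f. single e (lookup f e))"
  by (rule poly_mapping_eqI) (auto simp: lookup_sum lookup_single when_def in_keys_iff)

lemma lookup_single_times:
  fixes g :: "('a::ab_group_add) \<Rightarrow>\<^sub>0 'b::comm_ring_1"
  shows "lookup (single e c * g) k = c * lookup g (k - e)"
proof -
  have "single e c * g = (\<Sum>e'\<in>keys g. single (e + e') (c * lookup g e'))"
    by (subst poly_mapping_sum_singles[of g]) (simp add: sum_distrib_left mult_single)
  moreover have "(e + e' = k) = (e' = k - e)" for e'
    by (auto simp: algebra_simps)
  ultimately show ?thesis
    by (simp add: lookup_sum lookup_single when_def in_keys_iff)
qed

lemma lookup_times:
  fixes g :: "('a::ab_group_add) \<Rightarrow>\<^sub>0 'b::comm_ring_1"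
  shows "lookup (f * g) k = (\<Sum>e\<in>keys f. lookup f e * lookup g (k - e))"
  by (subst (1) poly_mapping_sum_singles[of f])
    (simp add: sum_distrib_right lookup_sum lookup_single_times)

lemma lookup_of_int_times:
  "lookup (of_int c * (f :: laurent)) k = c * lookup f k"
  using lookup_single_times[of 0 c f k] by (simp flip: single_of_int)

text \<open>One notion of monomial substitution serves three purposes: permuting the variables,
  inverting them (\<open>uminus\<close>), and renaming \<open>x_i\<close> to \<open>x_(i+k)\<close>
  (\<open>shift k\<close>).\<close>

definition map_exp :: "(expo \<Rightarrow> expo) \<Rightarrow> laurent \<Rightarrow> laurent" where
  "map_exp \<phi> f = (\<Sum>e\<in>keys f. single (\<phi> e) (lookup f e))"

lemma perm_act_eq_map_exp: "perm_act w = map_exp (map_key (inv w))"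
  by (simp add: fun_eq_iff perm_act_def map_exp_def)

lemma map_exp_superset:
  "finite A \<Longrightarrow> keys f \<subseteq> A \<Longrightarrow> map_exp \<phi> f = (\<Sum>e\<in>A. single (\<phi> e) (lookup f e))"
  unfolding map_exp_def by (rule sum.mono_neutral_left) (auto simp: in_keys_iff)

lemma map_exp_single [simp]: "map_exp \<phi> (single e c) = single (\<phi> e) c"
  by (subst map_exp_superset[of "{e}"]) auto

lemma map_exp_zero [simp]: "map_exp \<phi> 0 = 0"
  by (simp add: map_exp_def)

lemma map_exp_add: "map_exp \<phi> (f + g) = map_exp \<phi> f + map_exp \<phi> g"
proof -
  have "keys (f + g) \<subseteq> keys f \<union> keys g"
    by (rule keys_add)
  then show ?thesis
    by (simp add: map_exp_superset[of "keys f \<union> keys g"] lookup_add single_add sum.distrib)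
qed

lemma map_exp_sum: "map_exp \<phi> (\<Sum>i\<in>A. f i) = (\<Sum>i\<in>A. map_exp \<phi> (f i))"
  by (induction A rule: infinite_finite_induct) (auto simp: map_exp_add)

lemma map_exp_times:
  assumes "\<And>a b. \<phi> (a + b) = \<phi> a + \<phi> b"
  shows "map_exp \<phi> (f * g) = map_exp \<phi> f * map_exp \<phi> g"
proof -
  have "(\<Sum>e\<in>keys f. single e (lookup f e)) * (\<Sum>e'\<in>keys g. single e' (lookup g e')) =
      (\<Sum>e\<in>keys f. \<Sum>e'\<in>keys g. single (e + e') (lookup f e * lookup g e'))"
    by (simp add: sum_product mult_single)
  then have "f * g = (\<Sum>e\<in>keys f. \<Sum>e'\<in>keys g. single (e + e') (lookup f e * lookup g e'))"
    by (simp flip: poly_mapping_sum_singles)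
  then have "map_exp \<phi> (f * g) =
      (\<Sum>e\<in>keys f. \<Sum>e'\<in>keys g. single (\<phi> e) (lookup f e) * single (\<phi> e') (lookup g e'))"
    by (simp add: map_exp_sum assms mult_single)
  then show ?thesis
    by (simp add: map_exp_def sum_product)
qed

lemma map_exp_one: "\<phi> 0 = 0 \<Longrightarrow> map_exp \<phi> 1 = 1"
  using map_exp_single[of \<phi> 0 1] by (simp del: map_exp_single)

lemma map_exp_prod:
  assumes "\<And>a b. \<phi> (a + b) = \<phi> a + \<phi> b" "\<phi> 0 = 0"
  shows "map_exp \<phi> (\<Prod>i\<in>A. f i) = (\<Prod>i\<in>A. map_exp \<phi> (f i))"
  by (induction A rule: infinite_finite_induct)
    (simp_all add: map_exp_times[of \<phi>, OF assms(1)] map_exp_one assms(2))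

lemma map_exp_power:
  assumes "\<And>a b. \<phi> (a + b) = \<phi> a + \<phi> b" "\<phi> 0 = 0"
  shows "map_exp \<phi> (f ^ d) = map_exp \<phi> f ^ d"
  by (induction d) (simp_all add: map_exp_times[of \<phi>, OF assms(1)] map_exp_one assms(2))

lemma lookup_map_exp:
  assumes "inj \<phi>"
  shows "lookup (map_exp \<phi> f) (\<phi> e) = lookup f e"
  using assms
  by (auto simp: map_exp_def lookup_sum lookup_single when_def inj_eq in_keys_iff)

lemma keys_map_exp: "keys (map_exp \<phi> f) \<subseteq> \<phi> ` keys f"
proof -
  have "keys (map_exp \<phi> f) \<subseteq> (\<Union>e\<in>keys f. keys (single (\<phi> e) (lookup f e)))"
    unfolding map_exp_def by (rule keys_sum)
  also have "\<dots> \<subseteq> (\<Union>e\<in>keys f. {\<phi> e})"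
    by (intro UN_mono) auto
  finally show ?thesis
    by auto
qed

lemma lookup_map_exp_notin:
  "k \<notin> range \<phi> \<Longrightarrow> lookup (map_exp \<phi> f) k = 0"
  using keys_map_exp[of \<phi> f] by (auto simp: in_keys_iff)

lemma lookup_map_key: "inj w \<Longrightarrow> lookup (map_key w k) i = lookup k (w i)"
  by (simp add: map_key.rep_eq)

lemma map_key_compose_permutes:
  "u permutes A \<Longrightarrow> w permutes A' \<Longrightarrow> map_key u (map_key w k) = map_key (w \<circ> u) k"
  by (simp add: map_key_compose permutes_inj)

lemma map_key_id' [simp]: "map_key id k = k"
  by (rule poly_mapping_eqI) (simp add: lookup_map_key)

lemma map_key_inv_permutes:
  assumes "w permutes A"
  shows "map_key w (map_key (inv w) k) = k" "map_key (inv w) (map_key w k) = k"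
  using permutes_inj[OF assms] permutes_inj[OF permutes_inv[OF assms]] permutes_inverses[OF assms]
  by (auto intro!: poly_mapping_eqI simp: lookup_map_key)

text \<open>The inverse in \<open>perm_act\<close> disappears when coefficients are read off,
  because \<open>map_key w k\<close> is already the exponent moved by the inverse of
  \<open>w\<close>. From here on all arguments are about coefficients.\<close>

lemma lookup_perm_act:
  assumes "w permutes A"
  shows "lookup (perm_act w f) k = lookup f (map_key w k)"
proof -
  have "inj (map_key (inv w) :: expo \<Rightarrow> expo)"
    using map_key_inv_permutes(1)[OF assms] by (metis injI)
  from lookup_map_exp[OF this, of f "map_key w k"] show ?thesis
    by (simp add: perm_act_eq_map_exp map_key_inv_permutes[OF assms])
qed

lemma lookup_J:
  "lookup (J n f) k = (\<Sum>w | w permutes {..<n}. sign w * lookup f (map_key w k))"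
  by (simp add: J_def lookup_sum lookup_of_int_times lookup_perm_act)

lemma perm_act_times:
  assumes "w permutes A"
  shows "perm_act w (f * g) = perm_act w f * perm_act w g"
  unfolding perm_act_eq_map_exp
  by (rule map_exp_times) (simp add: map_key_plus permutes_inj[OF permutes_inv[OF assms]])


section \<open>Symmetric and alternating Laurent polynomials\<close>

text \<open>Without this bound an exponent could have entries at positions that no permutation of
  \<open>{..<n}\<close> reaches, and strictly decreasing exponents would not suffice to compare
  alternating polynomials.\<close>

definition laurent_in :: "nat \<Rightarrow> laurent set" where
  "laurent_in n = {f. \<forall>e\<in>keys f. keys e \<subseteq> {..<n}}"

lemma laurent_in_sum: "(\<And>i. i \<in> A \<Longrightarrow> f i \<in> laurent_in n) \<Longrightarrow> (\<Sum>i\<in>A. f i) \<in> laurent_in n"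
  using keys_sum[of f A] unfolding laurent_in_def by blast

lemma laurent_in_single: "keys e \<subseteq> {..<n} \<Longrightarrow> single e c \<in> laurent_in n"
  by (auto simp: laurent_in_def)

lemma laurent_in_one: "1 \<in> laurent_in n"
  by (simp add: laurent_in_def)

lemma laurent_in_times:
  assumes "f \<in> laurent_in n" "g \<in> laurent_in n"
  shows "f * g \<in> laurent_in n"
  unfolding laurent_in_def
proof (intro CollectI ballI)
  fix e assume "e \<in> keys (f * g)"
  then obtain a b where "e = a + b" "a \<in> keys f" "b \<in> keys g"
    using keys_mult[of f g] by blast
  then show "keys e \<subseteq> {..<n}"
    using keys_add[of a b] assms unfolding laurent_in_def by blast
qed

lemma laurent_in_prod: "(\<And>i. i \<in> A \<Longrightarrow> f i \<in> laurent_in n) \<Longrightarrow> (\<Prod>i\<in>A. f i) \<in> laurent_in n"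
  by (induction A rule: infinite_finite_induct) (auto intro: laurent_in_times laurent_in_one)

lemma laurent_in_power: "f \<in> laurent_in n \<Longrightarrow> f ^ d \<in> laurent_in n"
  by (induction d) (auto intro: laurent_in_times laurent_in_one)

definition symmetric :: "nat \<Rightarrow> laurent \<Rightarrow> bool" where
  "symmetric n f \<longleftrightarrow> (\<forall>w k. w permutes {..<n} \<longrightarrow> lookup f (map_key w k) = lookup f k)"

definition alternating :: "nat \<Rightarrow> laurent \<Rightarrow> bool" where
  "alternating n f \<longleftrightarrow> (\<forall>w k. w permutes {..<n} \<longrightarrow> lookup f (map_key w k) = sign w * lookup f k)"

lemma symmetric_iff: "symmetric n f \<longleftrightarrow> (\<forall>w. w permutes {..<n} \<longrightarrow> perm_act w f = f)"
  by (auto simp: symmetric_def poly_mapping_eq_iff fun_eq_iff lookup_perm_act)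

lemma symmetric_one: "symmetric n 1"
proof -
  have "map_key w k = 0 \<longleftrightarrow> k = 0" if "w permutes {..<n}" for w and k :: expo
    using map_key_inv_permutes(2)[OF that, of k] map_key_zero[OF permutes_inj[OF that]]
    by (metis map_key_zero permutes_inj[OF permutes_inv[OF that]])
  then show ?thesis
    by (simp add: symmetric_def lookup_one)
qed

lemma symmetric_times: "symmetric n f \<Longrightarrow> symmetric n g \<Longrightarrow> symmetric n (f * g)"
  by (simp add: symmetric_iff perm_act_times)

lemma symmetric_prod: "(\<And>i. i \<in> A \<Longrightarrow> symmetric n (f i)) \<Longrightarrow> symmetric n (\<Prod>i\<in>A. f i)"
  by (induction A rule: infinite_finite_induct) (auto intro: symmetric_times symmetric_one)

lemma symmetric_sum: "(\<And>i. i \<in> A \<Longrightarrow> symmetric n (f i)) \<Longrightarrow> symmetric n (\<Sum>i\<in>A. f i)"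
  by (induction A rule: infinite_finite_induct) (auto simp: symmetric_def lookup_add)

text \<open>Every permutation fixes \<open>s\<close>, so \<open>J\<close> is linear over symmetric
  polynomials. This moves orbit sums and skew Schur polynomials in and out of
  antisymmetrizations.\<close>

lemma J_symmetric_times:
  assumes "symmetric n s"
  shows "J n (s * f) = s * J n f"
  unfolding J_def sum_distrib_left
  using assms by (intro sum.cong) (auto simp: perm_act_times symmetric_iff)

lemma finite_perms [simp]: "finite {w. w permutes {..<n::nat}}"
  by (rule finite_permutations) simp

lemma sign_compose_permutes:
  "u permutes {..<n::nat} \<Longrightarrow> w permutes {..<n} \<Longrightarrow> sign (u \<circ> w) = sign u * sign w"
  by (rule sign_compose) (auto intro: permutation_permutes[THEN iffD2])

lemma alternating_J: "alternating n (J n f)"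
  unfolding alternating_def
proof (intro allI impI)
  fix u k assume u: "u permutes {..<n}"
  have "sign u * lookup (J n f) k =
      (\<Sum>w | w permutes {..<n}. sign u * (sign (u \<circ> w) * lookup f (map_key (u \<circ> w) k)))"
    unfolding lookup_J sum_distrib_left
    by (rule setum_permutations_compose_left[OF u])
  also have "\<dots> = (\<Sum>w | w permutes {..<n}. sign w * lookup f (map_key w (map_key u k)))"
    using u by (intro sum.cong)
      (auto simp: sign_compose_permutes map_key_compose_permutes simp flip: mult.assoc)
  finally show "lookup (J n f) (map_key u k) = sign u * lookup (J n f) k"
    by (simp add: lookup_J)
qed

text \<open>The transposition of \<open>i\<close> and \<open>j\<close> fixes \<open>k\<close> but
  has sign -1, and the coefficients are integers.\<close>

lemma alternating_eq_0:
  fixes k :: expo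
  assumes "alternating n f" "i < n" "j < n" "i \<noteq> j" "lookup k i = lookup k j"
  shows "lookup f k = 0"
proof -
  have w: "transpose i j permutes {..<n}"
    using assms by (auto intro: permutes_swap_id)
  have "map_key (transpose i j) k = k"
    using assms by (intro poly_mapping_eqI)
      (auto simp: lookup_map_key permutes_inj[OF w] transpose_def)
  with assms w have "lookup f k = - lookup f k"
    unfolding alternating_def by (auto simp: sign_swap_id dest!: spec[of _ "transpose i j"] spec[of _ k])
  then show ?thesis
    by simp
qed

lemma laurent_in_J:
  assumes "f \<in> laurent_in n"
  shows "J n f \<in> laurent_in n"
  unfolding J_def
proof (rule laurent_in_sum)
  fix w assume w: "w \<in> {w. w permutes {..<n}}"
  then have inv: "inv w permutes {..<n}"
    by (simp add: permutes_inv)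
  have "keys (map_key (inv w) e) \<subseteq> {..<n}" if "keys e \<subseteq> {..<n}" for e :: expo
    using that permutes_in_image[OF inv] by (auto simp: keys_map_key permutes_inj[OF inv])
  then have *: "keys e \<subseteq> {..<n}" if "e \<in> map_key (inv w) ` keys f" for e
    using assms that by (auto simp: laurent_in_def)
  have "perm_act w f \<in> laurent_in n"
    unfolding perm_act_eq_map_exp laurent_in_def
  proof (intro CollectI ballI)
    fix e assume "e \<in> keys (map_exp (map_key (inv w)) f)"
    then show "keys e \<subseteq> {..<n}"
      using keys_map_exp by (intro *) (rule subsetD)
  qed
  moreover have "of_int (sign w) \<in> laurent_in n"
    by (simp add: laurent_in_single flip: single_of_int)
  ultimately show "of_int (sign w) * perm_act w f \<in> laurent_in n"
    by (rule laurent_in_times[rotated])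
qed

section \<open>Strictly decreasing exponents as orbit representatives\<close>

definition decreasing :: "nat \<Rightarrow> expo \<Rightarrow> bool" where
  "decreasing n k \<longleftrightarrow> keys k \<subseteq> {..<n} \<and> (\<forall>i j. i < j \<longrightarrow> j < n \<longrightarrow> lookup k j < lookup k i)"

text \<open>The element of rank \<open>r\<close> in \<open>A\<close> is sent to the element at which
  \<open>f\<close> takes its value of rank \<open>r\<close>. The set \<open>A\<close> is general
  because sorting is needed both on all positions, for exponents, and on each of two blocks, for
  coset representatives.\<close>

lemma obtain_sorting_permutation:
  fixes f :: "nat \<Rightarrow> 'a::linorder"
  assumes "finite A" "inj_on f A"
  obtains v where "v permutes A" "strict_mono_on A (f \<circ> v)"
proof -
  define xs where "xs = sorted_list_of_set (f ` A)"
  define ys where "ys = sorted_list_of_set A"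
  have len: "length xs = card A" "length ys = card A"
    using assms by (simp_all add: xs_def ys_def card_image)
  have xs: "bij_betw ((!) xs) {..<card A} (f ` A)"
    by (rule bij_betw_nth) (use assms len in \<open>simp_all add: xs_def\<close>)
  have ys: "bij_betw ((!) ys) {..<card A} A"
    by (rule bij_betw_nth) (use assms len in \<open>simp_all add: ys_def\<close>)
  define rank where "rank = inv_into {..<card A} ((!) ys)"
  define v where "v x = (if x \<in> A then inv_into A f (xs ! rank x) else x)" for x
  have rank: "bij_betw rank A {..<card A}"
    unfolding rank_def by (rule bij_betw_inv_into[OF ys])
  have "bij_betw (inv_into A f) (f ` A) A"
    using assms by (simp add: bij_betw_inv_into inj_on_imp_bij_betw)
  from bij_betw_trans[OF bij_betw_trans[OF rank xs] this]
  have "bij_betw v A A"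
    by (rule bij_betw_cong[THEN iffD1, rotated]) (simp add: v_def)
  then have "v permutes A"
    by (rule bij_imp_permutes) (simp add: v_def)
  moreover have "strict_mono_on A (f \<circ> v)"
  proof (rule strict_mono_onI)
    fix x y assume xy: "x \<in> A" "y \<in> A" "x < y"
    have r: "ys ! rank x = x" "ys ! rank y = y" "rank x < card A" "rank y < card A"
      using xy ys rank by (auto simp: rank_def bij_betw_inv_into_right dest: bij_betwE)
    have "rank x < rank y"
    proof (rule ccontr)
      assume "\<not> rank x < rank y"
      then have "ys ! rank y \<le> ys ! rank x"
        using r len by (intro sorted_nth_mono) (auto simp: ys_def)
      with r xy show False by simp
    qed
    then have "xs ! rank x < xs ! rank y"
      using r len by (intro sorted_wrt_nth_less[of "(<)"]) (auto simp: xs_def)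
    moreover have "xs ! rank x \<in> f ` A" "xs ! rank y \<in> f ` A"
      using r xs by (auto dest: bij_betwE)
    ultimately show "(f \<circ> v) x < (f \<circ> v) y"
      using xy by (simp add: v_def f_inv_into_f)
  qed
  ultimately show ?thesis
    by (rule that)
qed

lemma obtain_decreasing_permutation:
  fixes k :: expo
  assumes "keys k \<subseteq> {..<n}" "inj_on (lookup k) {..<n}"
  obtains w where "w permutes {..<n}" "decreasing n (map_key w k)"
proof -
  have "inj_on (\<lambda>i. - lookup k i) {..<n}"
    using assms(2) by (simp add: inj_on_def)
  then obtain w where w: "w permutes {..<n}" "strict_mono_on {..<n} ((\<lambda>i. - lookup k i) \<circ> w)"
    using obtain_sorting_permutation[of "{..<n}" "\<lambda>i. - lookup k i"] by auto
  have "keys (map_key w k) \<subseteq> {..<n}"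
    using assms(1) permutes_in_image[OF w(1)] by (auto simp: keys_map_key permutes_inj[OF w(1)])
  with w have "decreasing n (map_key w k)"
    by (auto simp: decreasing_def lookup_map_key permutes_inj strict_mono_on_def)
  with w(1) show ?thesis
    by (rule that)
qed

text \<open>By strong induction: the preimage \<open>p\<close> of \<open>i\<close> is not below
  \<open>i\<close>, where all points are fixed. If it were above, then \<open>w i < i\<close>, so
  \<open>w i\<close> would be a fixed point and share its image with \<open>i\<close>.\<close>

lemma strict_mono_on_permutes_id:
  assumes "w permutes {..<n}" "strict_mono_on {..<n} (w :: nat \<Rightarrow> nat)"
  shows "w = id"
proof (rule ext)
  fix i show "w i = id i"
  proof (induction i rule: less_induct)
    case (less i)
    show ?case
    proof (cases "i < n")
      case True
      obtain p where p: "w p = i" "p < n"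
        using True assms(1) by (metis lessThan_iff permutes_in_image permutes_surj surjD)
      have "\<not> p < i"
        using less.IH[of p] p by auto
      moreover have "\<not> i < p"
      proof
        assume "i < p"
        then have "w i < i"
          using assms(2) p True by (auto simp: strict_mono_on_def)
        moreover from this have "w (w i) = w i"
          using less by simp
        ultimately show False
          using permutes_inj[OF assms(1)] by (metis injD less_irrefl)
      qed
      ultimately show ?thesis
        using p by auto
    qed (use assms(1) in \<open>auto simp: permutes_def\<close>)
  qed
qed

text \<open>Comparing entries of a strictly decreasing exponent reverses the comparison of
  positions, so \<open>w\<close> must be increasing.\<close>

lemma decreasing_map_key_id:
  assumes "w permutes {..<n}" "decreasing n k" "decreasing n (map_key w k)"
  shows "w = id"
proof (rule strict_mono_on_permutes_id[OF assms(1)], rule strict_mono_onI)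
  fix i j assume ij: "i \<in> {..<n}" "j \<in> {..<n}" "i < j"
  then have "lookup k (w j) < lookup k (w i)" "w i < n" "w j < n"
    using assms permutes_in_image[OF assms(1)]
    by (auto simp: decreasing_def lookup_map_key permutes_inj)
  then show "w i < w j"
    using assms(2) unfolding decreasing_def by (metis linorder_neqE_nat order_less_asym)
qed

text \<open>Any other exponent either uses a foreign variable or has a repeated entry, where both
  coefficients vanish, or can be sorted into a strictly decreasing one at the cost of a
  sign.\<close>

lemma alternating_eqI:
  fixes f g :: laurent
  assumes f: "f \<in> laurent_in n" "alternating n f" and g: "g \<in> laurent_in n" "alternating n g"
    and eq: "\<And>k. decreasing n k \<Longrightarrow> lookup f k = lookup g k"
  shows "f = g"
proof (rule poly_mapping_eqI)
  fix k :: expo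
  consider "\<not> keys k \<subseteq> {..<n}" | "\<not> inj_on (lookup k) {..<n}"
    | "keys k \<subseteq> {..<n}" "inj_on (lookup k) {..<n}" by blast
  then show "lookup f k = lookup g k"
  proof cases
    case 1
    then have "k \<notin> keys f" "k \<notin> keys g"
      using f g unfolding laurent_in_def by blast+
    then show ?thesis
      by (simp add: in_keys_iff)
  next
    case 2
    then obtain i j where "i < n" "j < n" "i \<noteq> j" "lookup k i = lookup k j"
      by (auto simp: inj_on_def)
    then show ?thesis
      using alternating_eq_0 f g by metis
  next
    case 3
    then obtain w where w: "w permutes {..<n}" "decreasing n (map_key w k)"
      by (rule obtain_decreasing_permutation)
    then have "sign w * lookup f k = sign w * lookup g k"
      using f(2) g(2) eq[OF w(2)] unfolding alternating_def by auto
    then show ?thesis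
      by (simp add: sign_def split: if_splits)
  qed
qed

text \<open>A strictly decreasing exponent meets its orbit's other members only through the
  identity, so one term of the alternating sum survives. This is the orthonormality of the Schur
  polynomials at the level of numerators.\<close>

lemma lookup_J_single_decreasing:
  assumes "decreasing n k" "decreasing n l"
  shows "lookup (J n (single k 1)) l = (if k = l then 1 else 0)"
proof -
  have "sign w * lookup (single k 1) (map_key w l) = (if w = id then (if k = l then 1 else 0) else 0)"
    if "w permutes {..<n}" for w
    using decreasing_map_key_id[OF that assms(2)] assms(1)
    by (auto simp: lookup_single when_def map_key_id id_def)
  then have "lookup (J n (single k 1)) l =
      (\<Sum>w | w permutes {..<n}. if w = id then (if k = l then 1 else 0) else 0)"
    unfolding lookup_J by (intro sum.cong) auto
  then show ?thesis
    by (simp add: permutes_id)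
qed


section \<open>Schur expansions\<close>

abbreviation rho_exp :: "nat \<Rightarrow> expo" where
  "rho_exp n \<equiv> Poly_Mapping.nth (rho n)"

abbreviation vdm :: "nat \<Rightarrow> laurent" where
  "vdm n \<equiv> J n (monomial (rho n))"

lemma lookup_rho_exp: "lookup (rho_exp n) i = (if i < n then int n - 1 - int i else 0)"
  by (auto simp: rho_def nth_default_def of_nat_diff)

lemma keys_nth_subset: "length xs = n \<Longrightarrow> keys (Poly_Mapping.nth xs) \<subseteq> {..<n}"
  by (auto simp: in_keys_iff nth_default_def simp del: keys_nth split: if_splits)

lemma decreasing_rho_exp: "decreasing n (rho_exp n)"
  unfolding decreasing_def
  by (intro conjI keys_nth_subset) (simp add: rho_def, simp add: lookup_rho_exp del: lookup_nth)

definition weakly_decreasing :: "nat \<Rightarrow> expo \<Rightarrow> bool" where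
  "weakly_decreasing n k \<longleftrightarrow> keys k \<subseteq> {..<n} \<and> (\<forall>i j. i < j \<longrightarrow> j < n \<longrightarrow> lookup k j \<le> lookup k i)"

lemma decreasing_iff_weakly:
  "decreasing n k \<longleftrightarrow> weakly_decreasing n (k - rho_exp n)"
proof -
  have "keys (k - rho_exp n) \<subseteq> {..<n} \<longleftrightarrow> keys k \<subseteq> {..<n}"
    by (auto simp: subset_iff in_keys_iff lookup_minus lookup_rho_exp simp del: lookup_nth)
  moreover have "(\<forall>i j. i < j \<longrightarrow> j < n \<longrightarrow> lookup (k - rho_exp n) j \<le> lookup (k - rho_exp n) i) \<longleftrightarrow>
      (\<forall>i j. i < j \<longrightarrow> j < n \<longrightarrow> lookup k j < lookup k i)" (is "?l \<longleftrightarrow> ?r")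
  proof
    assume l: ?l
    show ?r
    proof (intro allI impI)
      fix i j assume "i < j" "j < n"
      with l[rule_format, of i j] show "lookup k j < lookup k i"
        by (simp add: lookup_minus lookup_rho_exp del: lookup_nth)
    qed
  next
    assume r: ?r
    \<comment> \<open>Adding the position undoes \<rho> up to a constant: an integer sequence that
      drops by at least 1 at each step stays weakly decreasing after this.\<close>
    have "lookup k j + int j \<le> lookup k i + int i" if "i \<le> j" "j < n" for i j
      using that
    proof (induction j rule: dec_induct)
      case (step j)
      then show ?case
        using r[rule_format, of j "Suc j"] by simp
    qed simp
    then show ?l
      by (auto simp add: lookup_minus lookup_rho_exp algebra_simps simp del: lookup_nth)
  qed
  ultimately show ?thesis
    by (simp add: decreasing_def weakly_decreasing_def)
qed

text \<open>Both exponents are sorted arrangements of the same multiset of entries.\<close>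

lemma weakly_decreasing_unique:
  assumes "weakly_decreasing n k" "weakly_decreasing n (map_key w k)" "w permutes {..<n}"
  shows "map_key w k = k"
proof -
  define xs where "xs = map (lookup k) [0..<n]"
  define ys where "ys = map (lookup (map_key w k)) [0..<n]"
  have "ys = permute_list w xs"
    using permutes_in_image[OF assms(3)]
    by (auto simp: ys_def xs_def permute_list_def lookup_map_key permutes_inj[OF assms(3)])
  then have "mset (rev ys) = mset (rev xs)"
    using assms(3) by (simp add: xs_def)
  moreover have "sorted (rev xs)" "sorted (rev ys)"
    using assms(1,2) unfolding xs_def ys_def weakly_decreasing_def
    by (auto simp: sorted_iff_nth_mono_less rev_nth)
  ultimately have "xs = ys"
    by (metis properties_for_sort rev_rev_ident)
  then have "lookup (map_key w k) i = lookup k i" if "i < n" for i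
    using that by (simp add: xs_def ys_def)
  moreover have "lookup (map_key w k) i = lookup k i" if "\<not> i < n" for i
  proof -
    have "i \<notin> keys (map_key w k)" "i \<notin> keys k"
      using assms(1,2) that by (auto simp: weakly_decreasing_def)
    then show ?thesis
      by (simp add: in_keys_iff)
  qed
  ultimately show ?thesis
    by (intro poly_mapping_eqI) blast
qed

section \<open>Divisibility by the Weyl denominator\<close>

definition sqnorm :: "nat \<Rightarrow> expo \<Rightarrow> int" where
  "sqnorm n k = (\<Sum>i<n. (lookup k i)\<^sup>2)"

lemma sqnorm_nonneg: "0 \<le> sqnorm n k"
  by (simp add: sqnorm_def sum_nonneg)

lemma sqnorm_map_key:
  assumes "w permutes {..<n}"
  shows "sqnorm n (map_key w k) = sqnorm n k"
  using sum.permute[OF assms, of "\<lambda>i. (lookup k i)\<^sup>2"]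
  by (simp add: sqnorm_def lookup_map_key permutes_inj[OF assms] o_def)

text \<open>The maximum of \<open>\<langle>\<rho>, \<nu>\<rangle>\<close> over a permutation orbit is attained at a weakly decreasing \<open>\<nu>\<close> only,
  since swapping an ascent of \<open>\<nu>\<close> increases the value.\<close>

lemma sqnorm_rho_add_less:
  assumes k: "weakly_decreasing n k" and w: "w permutes {..<n}" and ne: "map_key w k \<noteq> k"
  shows "sqnorm n (rho_exp n + map_key w k) < sqnorm n (rho_exp n + k)"
proof -
  define V where "V \<nu> = (\<Sum>i<n. lookup (rho_exp n) i * lookup \<nu> i)" for \<nu> :: expo
  define orb where "orb = (\<lambda>w. map_key w k) ` {w. w permutes {..<n}}"
  have fin: "finite (V ` orb)"
    by (simp add: orb_def)
  have mem: "k \<in> orb" "map_key w k \<in> orb"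
    using w permutes_id[of "{..<n}"] unfolding orb_def
    by (auto intro!: image_eqI[of _ _ id])
  have max: "\<nu> = k" if \<nu>: "\<nu> \<in> orb" "V \<nu> = Max (V ` orb)" for \<nu>
  proof -
    obtain u where u: "u permutes {..<n}" "\<nu> = map_key u k"
      using \<nu> by (auto simp: orb_def)
    have keys: "keys \<nu> \<subseteq> {..<n}"
      using k permutes_in_image[OF u(1)]
      by (auto simp: u(2) keys_map_key permutes_inj[OF u(1)] weakly_decreasing_def)
    have "lookup \<nu> j \<le> lookup \<nu> i" if ij: "i < j" "j < n" for i j
    proof (rule ccontr)
      assume less: "\<not> lookup \<nu> j \<le> lookup \<nu> i"
      define t where "t = transpose i j"
      have t: "t permutes {..<n}"
        using ij by (auto simp: t_def intro: permutes_swap_id)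
      have "map_key t \<nu> \<in> orb"
        using u t by (auto simp: orb_def map_key_compose_permutes intro!: image_eqI[of _ _ "u \<circ> t"]
            permutes_compose)
      then have "V (map_key t \<nu>) \<le> V \<nu>"
        using \<nu> fin by auto
      moreover have "V (map_key t \<nu>) - V \<nu> =
          (\<Sum>l\<in>{i, j}. lookup (rho_exp n) l * (lookup \<nu> (t l) - lookup \<nu> l))"
        unfolding V_def sum_subtractf[symmetric] lookup_map_key[OF permutes_inj[OF t]]
        using ij by (intro sum.mono_neutral_cong_right)
          (auto simp: t_def transpose_def algebra_simps simp del: lookup_nth)
      moreover have "\<dots> = (int j - int i) * (lookup \<nu> j - lookup \<nu> i)"
        using ij by (simp add: t_def lookup_rho_exp algebra_simps del: lookup_nth)
      moreover have "0 < (int j - int i) * (lookup \<nu> j - lookup \<nu> i)"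
        using ij less by simp
      ultimately show False
        by simp
    qed
    with keys have "weakly_decreasing n \<nu>"
      by (simp add: weakly_decreasing_def)
    then show ?thesis
      using weakly_decreasing_unique[OF k _ u(1)] u(2) by simp
  qed
  have "Max (V ` orb) \<in> V ` orb"
    using fin mem by (intro Max_in) auto
  then have "V k = Max (V ` orb)"
    using max by auto
  moreover have "V (map_key w k) \<noteq> Max (V ` orb)"
    using max[OF mem(2)] ne by auto
  moreover have "V (map_key w k) \<le> Max (V ` orb)"
    using fin mem by auto
  ultimately have "V (map_key w k) < V k"
    by linarith
  \<comment> \<open>Expanding the square reduces the comparison of lengths to that of the pairings
    with \<rho>, since the length of \<nu> itself is constant on the orbit.\<close>
  moreover have "sqnorm n (rho_exp n + \<nu>) = sqnorm n (rho_exp n) + 2 * V \<nu> + sqnorm n \<nu>" for \<nu>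
    unfolding sqnorm_def V_def lookup_add sum_distrib_left sum.distrib[symmetric]
    by (intro sum.cong) (auto simp: power2_eq_square algebra_simps)
  ultimately show ?thesis
    by (simp add: sqnorm_map_key[OF w])
qed

lemma J_zero [simp]: "J n 0 = 0"
  by (rule poly_mapping_eqI) (simp add: lookup_J)

lemma J_add: "J n (f + g) = J n f + J n g"
  by (rule poly_mapping_eqI) (simp add: lookup_J lookup_add algebra_simps sum.distrib)

lemma J_sum: "J n (\<Sum>i\<in>A. f i) = (\<Sum>i\<in>A. J n (f i))"
  by (induction A rule: infinite_finite_induct) (auto simp: J_add)

lemma J_of_int_times: "J n (of_int c * f) = of_int c * J n f"
  by (rule poly_mapping_eqI)
    (simp add: lookup_J lookup_of_int_times sum_distrib_left mult.left_commute)

lemma J_single_map_key: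
  assumes u: "u permutes {..<n}"
  shows "J n (single (map_key u k) 1) = of_int (sign u) * J n (single k 1)"
proof (rule poly_mapping_eqI)
  fix l
  have "lookup (single (map_key u k) (1::int)) (map_key w l) = lookup (single k 1) (map_key (w \<circ> inv u) l)"
    if "w permutes {..<n}" for w
  proof -
    have "map_key (w \<circ> inv u) l = map_key (inv u) (map_key w l)"
      using that permutes_inv[OF u] by (simp add: map_key_compose_permutes)
    then have "map_key u k = map_key w l \<longleftrightarrow> k = map_key (w \<circ> inv u) l"
      using map_key_inv_permutes[OF u] by metis
    then show ?thesis
      by (auto simp: lookup_single when_def)
  qed
  then have "lookup (J n (single (map_key u k) 1)) l =
      (\<Sum>w | w permutes {..<n}. sign w * lookup (single k 1) (map_key (w \<circ> inv u) l))"
    unfolding lookup_J by (intro sum.cong) auto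
  also have "\<dots> = (\<Sum>w | w permutes {..<n}. sign (w \<circ> u) * lookup (single k 1) (map_key ((w \<circ> u) \<circ> inv u) l))"
    by (rule sum_permutations_compose_right[OF u])
  also have "\<dots> = (\<Sum>w | w permutes {..<n}. sign u * (sign w * lookup (single k 1) (map_key w l)))"
    using u permutes_inv_o[OF u] by (intro sum.cong) (auto simp: sign_compose_permutes comp_assoc)
  finally show "lookup (J n (single (map_key u k) 1)) l = lookup (of_int (sign u) * J n (single k 1)) l"
    by (simp add: lookup_of_int_times lookup_J sum_distrib_left)
qed

text \<open>Exchanging the equal entries leaves the monomial unchanged and flips the sign of its
  antisymmetrization.\<close>

lemma J_single_eq_0:
  assumes "i < n" "j < n" "i \<noteq> j" "lookup k i = lookup k j"
  shows "J n (single k 1) = 0"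
proof -
  have t: "transpose i j permutes {..<n}"
    using assms by (auto intro: permutes_swap_id)
  have "map_key (transpose i j) k = k"
    using assms by (intro poly_mapping_eqI)
      (auto simp: lookup_map_key permutes_inj[OF t] transpose_def)
  with J_single_map_key[OF t, of k] assms have "J n (single k 1) = - J n (single k 1)"
    by (simp add: sign_swap_id)
  then have "lookup (J n (single k 1)) l = - lookup (J n (single k 1)) l" for l
    by (metis lookup_uminus)
  then show ?thesis
    by (intro poly_mapping_eqI) (simp add: eq_neg_iff_add_eq_0)
qed

text \<open>Induction on the squared length of \<open>k\<close>. If \<open>k\<close> has distinct
  entries, sorting turns it into \<rho> + \<mu> with \<mu> weakly decreasing. The product of
  \<open>vdm n\<close> with the orbit sum of \<mu> is the antisymmetrization at \<rho> + \<mu> plus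
  those at \<rho> + \<nu> for the other \<nu> in the orbit. These exponents are strictly shorter, so
  the induction hypothesis covers them.\<close>

lemma vdm_dvd_J_single:
  "keys k \<subseteq> {..<n} \<Longrightarrow> vdm n dvd J n (single k 1)"
proof (induction "nat (sqnorm n k)" arbitrary: k rule: less_induct)
  case less
  show ?case
  proof (cases "inj_on (lookup k) {..<n}")
    case False
    then obtain i j where "i < n" "j < n" "i \<noteq> j" "lookup k i = lookup k j"
      by (auto simp: inj_on_def)
    then show ?thesis
      by (simp add: J_single_eq_0)
  next
    case True
    with less.prems obtain u where u: "u permutes {..<n}" "decreasing n (map_key u k)"
      by (rule obtain_decreasing_permutation)
    define \<mu> where "\<mu> = map_key u k - rho_exp n"
    have \<mu>: "weakly_decreasing n \<mu>" "map_key u k = rho_exp n + \<mu>"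
      using u(2) by (simp_all add: decreasing_iff_weakly \<mu>_def)
    define orb where "orb = (\<lambda>w. map_key w \<mu>) ` {w. w permutes {..<n}}"
    have fin: "finite orb"
      by (simp add: orb_def)
    have "id permutes {..<n}"
      by (rule permutes_id)
    then have mem: "\<mu> \<in> orb"
      unfolding orb_def by (auto intro!: image_eqI[of _ _ id])
    have orb_iff: "map_key w \<nu> \<in> orb \<longleftrightarrow> \<nu> \<in> orb" if w: "w permutes {..<n}" for w \<nu>
    proof
      assume "map_key w \<nu> \<in> orb"
      then obtain v where v: "v permutes {..<n}" "map_key w \<nu> = map_key v \<mu>"
        by (auto simp: orb_def)
      then have "\<nu> = map_key (v \<circ> inv w) \<mu>"
        using map_key_inv_permutes[OF w] permutes_inv[OF w]
        by (metis map_key_compose_permutes)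
      then show "\<nu> \<in> orb"
        using v w by (auto simp: orb_def permutes_compose permutes_inv)
    next
      assume "\<nu> \<in> orb"
      then show "map_key w \<nu> \<in> orb"
        using w by (auto simp: orb_def map_key_compose_permutes permutes_compose)
    qed
    have lookup_orb: "lookup (\<Sum>\<nu>\<in>orb. single \<nu> 1) \<nu> = (if \<nu> \<in> orb then 1 else (0::int))" for \<nu>
      using fin by (simp add: lookup_sum lookup_single when_def)
    have "symmetric n (\<Sum>\<nu>\<in>orb. single \<nu> 1)"
      by (simp add: symmetric_def lookup_orb orb_iff)
    then have "(\<Sum>\<nu>\<in>orb. single \<nu> 1) * vdm n = J n ((\<Sum>\<nu>\<in>orb. single \<nu> 1) * monomial (rho n))"
      by (rule J_symmetric_times[symmetric])
    also have "\<dots> = (\<Sum>\<nu>\<in>orb. J n (single (rho_exp n + \<nu>) 1))"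
      by (simp add: sum_distrib_right monomial_def mult_single J_sum add.commute)
    also have "\<dots> = J n (single (map_key u k) 1) + (\<Sum>\<nu>\<in>orb - {\<mu>}. J n (single (rho_exp n + \<nu>) 1))"
      using fin mem \<mu>(2) by (simp add: sum.remove)
    finally have eq: "J n (single (map_key u k) 1) = (\<Sum>\<nu>\<in>orb. single \<nu> 1) * vdm n -
        (\<Sum>\<nu>\<in>orb - {\<mu>}. J n (single (rho_exp n + \<nu>) 1))"
      by (simp add: algebra_simps)
    have "vdm n dvd J n (single (rho_exp n + \<nu>) 1)" if \<nu>: "\<nu> \<in> orb - {\<mu>}" for \<nu>
    proof (rule less.hyps)
      obtain v where v: "v permutes {..<n}" "\<nu> = map_key v \<mu>"
        using \<nu> by (auto simp: orb_def)
      have "sqnorm n (rho_exp n + \<nu>) < sqnorm n (rho_exp n + \<mu>)"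
        using sqnorm_rho_add_less[OF \<mu>(1) v(1)] v \<nu> by auto
      also have "\<dots> = sqnorm n k"
        using sqnorm_map_key[OF u(1), of k] \<mu>(2) by simp
      finally show "nat (sqnorm n (rho_exp n + \<nu>)) < nat (sqnorm n k)"
        using sqnorm_nonneg[of n "rho_exp n + \<nu>"] by linarith
      have "keys \<nu> \<subseteq> {..<n}"
        using \<mu>(1) permutes_in_image[OF v(1)]
        by (auto simp: v(2) keys_map_key permutes_inj[OF v(1)] weakly_decreasing_def)
      then show "keys (rho_exp n + \<nu>) \<subseteq> {..<n}"
        using keys_add[of "rho_exp n" \<nu>] decreasing_rho_exp[of n] unfolding decreasing_def by blast
    qed
    then have "vdm n dvd J n (single (map_key u k) 1)"
      unfolding eq by (intro dvd_diff dvd_mult dvd_sum) auto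
    then have "vdm n dvd of_int (sign u) * J n (single (map_key u k) 1)"
      by (rule dvd_mult)
    moreover have "of_int (sign u) * (of_int (sign u) * f) = (f :: laurent)" for f
      by (simp flip: mult.assoc of_int_mult)
    ultimately show ?thesis
      using J_single_map_key[OF u(1), of k] by simp
  qed
qed

lemma vdm_nonzero: "vdm n \<noteq> 0"
  using lookup_J_single_decreasing[OF decreasing_rho_exp decreasing_rho_exp, of n]
  by (auto simp: monomial_def)

text \<open>This makes the definite description in \<open>weyl_pi\<close> meaningful: the quotient
  exists by divisibility for each monomial, and it is unique by cancelling the nonzero
  \<open>vdm n\<close>.\<close>

lemma vdm_weyl_pi:
  assumes "f \<in> laurent_in n"
  shows "vdm n * weyl_pi n f = J n (monomial (rho n) * f)"
proof -
  have "monomial (rho n) * f = (\<Sum>e\<in>keys f. of_int (lookup f e) * single (rho_exp n + e) 1)"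
    by (subst poly_mapping_sum_singles[of f])
      (simp add: sum_distrib_left monomial_def mult_single flip: single_of_int)
  then have "J n (monomial (rho n) * f) = (\<Sum>e\<in>keys f. of_int (lookup f e) * J n (single (rho_exp n + e) 1))"
    by (simp add: J_sum J_of_int_times)
  moreover have "vdm n dvd J n (single (rho_exp n + e) 1)" if "e \<in> keys f" for e
  proof (rule vdm_dvd_J_single)
    have "keys e \<subseteq> {..<n}"
      using assms that by (simp add: laurent_in_def)
    then show "keys (rho_exp n + e) \<subseteq> {..<n}"
      using keys_add[of "rho_exp n" e] decreasing_rho_exp[of n] unfolding decreasing_def by blast
  qed
  ultimately have "vdm n dvd J n (monomial (rho n) * f)"
    by (auto intro!: dvd_sum)
  then obtain g where "vdm n * g = J n (monomial (rho n) * f)"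
    by (metis dvdE)
  then have "\<exists>!g. vdm n * g = J n (monomial (rho n) * f)"
    using vdm_nonzero by (metis mult_cancel_left)
  from theI'[OF this] show ?thesis
    by (simp add: weyl_pi_def)
qed


section \<open>Coefficients of Schur expansions as coefficients of numerators\<close>

abbreviation shifted :: "nat \<Rightarrow> int list \<Rightarrow> expo" where
  "shifted n \<mu> \<equiv> rho_exp n + Poly_Mapping.nth \<mu>"

lemma lookup_shifted:
  "length \<mu> = n \<Longrightarrow> lookup (shifted n \<mu>) i = (if i < n then \<mu> ! i + int n - 1 - int i else 0)"
  by (simp add: lookup_add lookup_rho_exp del: lookup_nth) (simp add: nth_default_def)

lemma keys_shifted: "length \<mu> = n \<Longrightarrow> keys (shifted n \<mu>) \<subseteq> {..<n}"
  by (auto simp: in_keys_iff lookup_shifted split: if_splits)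

lemma shifted_inj:
  assumes "length \<mu> = n" "length \<nu> = n" "shifted n \<mu> = shifted n \<nu>"
  shows "\<mu> = \<nu>"
proof (rule nth_equalityI)
  fix i assume "i < length \<mu>"
  then show "\<mu> ! i = \<nu> ! i"
    using assms lookup_shifted[of \<mu> n i] lookup_shifted[of \<nu> n i] by simp
qed (use assms in simp)

lemma decreasing_shifted:
  assumes "dominant n \<mu>"
  shows "decreasing n (shifted n \<mu>)"
  unfolding decreasing_def
proof (intro conjI allI impI)
  show "keys (shifted n \<mu>) \<subseteq> {..<n}"
    using assms by (intro keys_shifted) (simp add: dominant_def)
  fix i j assume "i < j" "j < n"
  moreover from this have "\<mu> ! j \<le> \<mu> ! i"
    using assms by (auto simp: dominant_def sorted_wrt_iff_nth_less)
  ultimately show "lookup (shifted n \<mu>) j < lookup (shifted n \<mu>) i"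
    using assms by (simp add: lookup_shifted dominant_def)
qed

lemma obtain_shifted:
  assumes "keys k \<subseteq> {..<n}"
  obtains \<mu> where "length \<mu> = n" "k = shifted n \<mu>"
proof
  let ?\<mu> = "map (\<lambda>i. lookup k i - lookup (rho_exp n) i) [0..<n]"
  show "length ?\<mu> = n"
    by simp
  show "k = shifted n ?\<mu>"
  proof (rule poly_mapping_eqI)
    fix i show "lookup k i = lookup (shifted n ?\<mu>) i"
      using assms by (cases "i < n")
        (auto simp: lookup_shifted lookup_rho_exp in_keys_iff simp del: lookup_nth)
  qed
qed

lemma obtain_shifted_dominant:
  assumes "decreasing n k"
  obtains \<mu> where "dominant n \<mu>" "k = shifted n \<mu>"
proof -
  have "keys k \<subseteq> {..<n}"
    using assms by (simp add: decreasing_def)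
  then obtain \<mu> where \<mu>: "length \<mu> = n" "k = shifted n \<mu>"
    by (rule obtain_shifted)
  have "weakly_decreasing n (Poly_Mapping.nth \<mu>)"
    using assms \<mu> by (simp add: decreasing_iff_weakly)
  then have "\<mu> ! j \<le> \<mu> ! i" if "i < j" "j < n" for i j
    using that \<mu> by (auto simp: weakly_decreasing_def nth_default_def)
  then have "dominant n \<mu>"
    using \<mu> by (auto simp: dominant_def sorted_wrt_iff_nth_less)
  then show ?thesis
    using \<mu>(2) by (rule that)
qed

lemma vdm_schur:
  assumes "length \<mu> = n"
  shows "vdm n * schur n \<mu> = J n (single (shifted n \<mu>) 1)"
proof -
  have "monomial \<mu> \<in> laurent_in n"
    unfolding monomial_def using assms by (intro laurent_in_single keys_nth_subset)
  from vdm_weyl_pi[OF this] show ?thesis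
    by (simp add: schur_def monomial_def mult_single)
qed

text \<open>Multiplication by \<open>vdm n\<close> turns the expansion into an equation between
  alternating polynomials. It can be tested at the exponents \<nu> + \<rho>, where the right side
  has exactly the coefficient of \<nu>. The equivalence yields existence and uniqueness of the
  expansion together.\<close>

lemma vdm_schur_sum_iff:
  assumes "keys c \<subseteq> {\<mu>. dominant n \<mu>}" "vdm n * f \<in> laurent_in n" "alternating n (vdm n * f)"
  shows "f = (\<Sum>\<mu>\<in>keys c. of_int (lookup c \<mu>) * schur n \<mu>) \<longleftrightarrow>
    (\<forall>\<nu>. dominant n \<nu> \<longrightarrow> lookup c \<nu> = lookup (vdm n * f) (shifted n \<nu>))"
proof -
  define g where "g = (\<Sum>\<mu>\<in>keys c. of_int (lookup c \<mu>) * J n (single (shifted n \<mu>) 1))"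
  have len: "length \<mu> = n" if "\<mu> \<in> keys c" for \<mu>
    using that assms(1) by (auto simp: dominant_def)
  have "g = J n (\<Sum>\<mu>\<in>keys c. of_int (lookup c \<mu>) * single (shifted n \<mu>) 1)"
    by (simp add: g_def J_sum J_of_int_times)
  moreover have "(\<Sum>\<mu>\<in>keys c. of_int (lookup c \<mu>) * single (shifted n \<mu>) 1) \<in> laurent_in n"
    using len by (auto intro!: laurent_in_sum laurent_in_single keys_shifted
        simp: mult_single simp flip: single_of_int)
  ultimately have g: "g \<in> laurent_in n" "alternating n g"
    by (simp_all add: laurent_in_J alternating_J)
  have lookup_g: "lookup g (shifted n \<nu>) = lookup c \<nu>" if \<nu>: "dominant n \<nu>" for \<nu>
  proof -
    have "lookup (of_int (lookup c \<mu>) * J n (single (shifted n \<mu>) 1)) (shifted n \<nu>) =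
        (if \<mu> = \<nu> then lookup c \<nu> else 0)" if "\<mu> \<in> keys c" for \<mu>
    proof -
      have "dominant n \<mu>"
        using that assms(1) by auto
      then show ?thesis
        using \<nu> shifted_inj[of \<mu> n \<nu>]
        by (auto simp: lookup_of_int_times lookup_J_single_decreasing decreasing_shifted dominant_def)
    qed
    then show ?thesis
      by (simp add: g_def lookup_sum in_keys_iff)
  qed
  have "f = (\<Sum>\<mu>\<in>keys c. of_int (lookup c \<mu>) * schur n \<mu>) \<longleftrightarrow>
      vdm n * f = vdm n * (\<Sum>\<mu>\<in>keys c. of_int (lookup c \<mu>) * schur n \<mu>)"
    using vdm_nonzero by simp
  also have "vdm n * (\<Sum>\<mu>\<in>keys c. of_int (lookup c \<mu>) * schur n \<mu>) = g"
    unfolding g_def sum_distrib_left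
    by (intro sum.cong refl) (simp add: len vdm_schur mult.left_commute)
  also have "vdm n * f = g \<longleftrightarrow> (\<forall>\<nu>. dominant n \<nu> \<longrightarrow> lookup c \<nu> = lookup (vdm n * f) (shifted n \<nu>))"
  proof
    assume "\<forall>\<nu>. dominant n \<nu> \<longrightarrow> lookup c \<nu> = lookup (vdm n * f) (shifted n \<nu>)"
    then show "vdm n * f = g"
      using assms g lookup_g
      by (intro alternating_eqI) (auto elim!: obtain_shifted_dominant)
  qed (simp add: lookup_g)
  finally show ?thesis .
qed

lemma schur_coeff_eq:
  assumes f: "vdm n * f \<in> laurent_in n" "alternating n (vdm n * f)" and \<mu>: "dominant n \<mu>"
  shows "schur_coeff n f \<mu> = lookup (vdm n * f) (shifted n \<mu>)"
proof -
  \<comment> \<open>The candidate coefficients. Setting them to 0 off the dominant weights meets the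
    support condition, and they are finitely many because \<nu> is determined by \<nu> +
    \<rho>.\<close>
  define h where "h \<nu> = (if dominant n \<nu> then lookup (vdm n * f) (shifted n \<nu>) else 0)" for \<nu>
  have "finite (shifted n -` keys (vdm n * f) \<inter> {\<nu>. dominant n \<nu>})"
    by (rule finite_vimage_IntI) (auto intro!: inj_onI shifted_inj simp: dominant_def)
  then have "finite {\<nu>. h \<nu> \<noteq> 0}"
    by (rule rev_finite_subset) (auto simp: h_def in_keys_iff split: if_splits)
  then have lookup_c: "lookup (Abs_poly_mapping h) = h"
    by simp
  then have dom: "keys (Abs_poly_mapping h) \<subseteq> {\<nu>. dominant n \<nu>}"
    by (auto simp: in_keys_iff h_def split: if_splits)
  have "\<exists>!c. keys c \<subseteq> {\<nu>. dominant n \<nu>} \<and> f = (\<Sum>\<nu>\<in>keys c. of_int (lookup c \<nu>) * schur n \<nu>)"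
  proof (rule ex1I[of _ "Abs_poly_mapping h"])
    show "keys (Abs_poly_mapping h) \<subseteq> {\<nu>. dominant n \<nu>} \<and> f = (\<Sum>\<nu>\<in>keys (Abs_poly_mapping h).
        of_int (lookup (Abs_poly_mapping h) \<nu>) * schur n \<nu>)"
      using vdm_schur_sum_iff[OF dom f] dom by (simp add: lookup_c h_def)
  next
    fix c assume c: "keys c \<subseteq> {\<nu>. dominant n \<nu>} \<and> f = (\<Sum>\<nu>\<in>keys c. of_int (lookup c \<nu>) * schur n \<nu>)"
    then have "\<forall>\<nu>. dominant n \<nu> \<longrightarrow> lookup c \<nu> = lookup (vdm n * f) (shifted n \<nu>)"
      using vdm_schur_sum_iff[OF _ f, of c] by simp
    moreover have "lookup c \<nu> = 0" if "\<not> dominant n \<nu>" for \<nu>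
      using c that by (auto simp: in_keys_iff)
    ultimately show "c = Abs_poly_mapping h"
      by (intro poly_mapping_eqI) (simp add: lookup_c h_def)
  qed
  from theI'[OF this] have
    "keys (schur_expansion n f) \<subseteq> {\<nu>. dominant n \<nu>}"
    "f = (\<Sum>\<nu>\<in>keys (schur_expansion n f). of_int (lookup (schur_expansion n f) \<nu>) * schur n \<nu>)"
    unfolding schur_expansion_def by simp_all
  then show ?thesis
    using vdm_schur_sum_iff[OF _ f, of "schur_expansion n f"] \<mu> by (simp add: schur_coeff_def)
qed

lemma schur_coeff_weyl_pi:
  assumes "f \<in> laurent_in n" "dominant n \<mu>"
  shows "schur_coeff n (weyl_pi n f) \<mu> = lookup (J n (monomial (rho n) * f)) (shifted n \<mu>)"
proof -
  have "monomial (rho n) * f \<in> laurent_in n"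
    unfolding monomial_def
    by (intro laurent_in_times laurent_in_single keys_nth_subset assms) (simp add: rho_def)
  then show ?thesis
    using schur_coeff_eq[OF _ _ assms(2), of "weyl_pi n f"] assms
    by (simp add: vdm_weyl_pi laurent_in_J alternating_J)
qed

text \<open>The adjointness \<open>\<langle>s\<^sup>\<perp> f, g\<rangle> = \<langle>f, s g\<rangle>\<close>: inverting the variables of \<open>s\<close> turns
  multiplication by \<open>s\<close> into its transpose.\<close>

lemma lookup_bar_times_alternating:
  assumes f: "f \<in> laurent_in n" "alternating n f" and s: "symmetric n s"
  shows "lookup (map_exp uminus s * f) b =
    (\<Sum>k | k \<in> keys f \<and> decreasing n k. lookup f k * lookup (s * J n (single b 1)) k)"
proof -
  define D where "D = {k. k \<in> keys f \<and> decreasing n k}"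
  define W where "W = {w. w permutes {..<n}}"
  \<comment> \<open>The entries of an exponent in the support of an alternating polynomial are
    distinct, so it is a permutation of a strictly decreasing one in exactly one way.\<close>
  have bij: "bij_betw (\<lambda>(k, w). map_key w k) (D \<times> W) (keys f)"
    unfolding bij_betw_def
  proof
    show "inj_on (\<lambda>(k, w). map_key w k) (D \<times> W)"
    proof (rule inj_onI, clarify)
      fix k u k' u' assume a: "k \<in> D" "u \<in> W" "k' \<in> D" "u' \<in> W" "map_key u k = map_key u' k'"
      then have u: "u permutes {..<n}" "u' permutes {..<n}" "inv u permutes {..<n}"
        by (simp_all add: W_def permutes_inv)
      have k: "k = map_key (u' \<circ> inv u) k'"
        using a(5) map_key_inv_permutes(2)[OF u(1), of k] u by (simp add: map_key_compose_permutes)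
      then have "u' \<circ> inv u = id"
        using a u decreasing_map_key_id[of "u' \<circ> inv u" n k'] by (auto simp: D_def intro: permutes_compose)
      then have "u' = u"
        by (metis comp_assoc comp_id fun.map_comp id_comp permutes_inv_o(2) u(1))
      with k u show "k = k' \<and> u = u'"
        by (simp add: permutes_inv_o)
    qed
    show "(\<lambda>(k, w). map_key w k) ` (D \<times> W) = keys f"
    proof (intro equalityI subsetI)
      fix k assume "k \<in> (\<lambda>(k, w). map_key w k) ` (D \<times> W)"
      then show "k \<in> keys f"
        using f(2) by (auto simp: D_def W_def alternating_def in_keys_iff)
    next
      fix k assume k: "k \<in> keys f"
      then have "inj_on (lookup k) {..<n}"
        using alternating_eq_0[OF f(2)] by (auto simp: inj_on_def in_keys_iff)
      moreover have "keys k \<subseteq> {..<n}"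
        using k f by (auto simp: laurent_in_def)
      ultimately obtain w where w: "w permutes {..<n}" "decreasing n (map_key w k)"
        by (metis obtain_decreasing_permutation)
      then have "map_key w k \<in> D"
        using k f(2) by (auto simp: D_def alternating_def in_keys_iff)
      moreover have "inv w \<in> W"
        using w by (simp add: W_def permutes_inv)
      ultimately show "k \<in> (\<lambda>(k, w). map_key w k) ` (D \<times> W)"
        using map_key_inv_permutes(2)[OF w(1), of k] by (auto intro!: image_eqI[of _ _ "(map_key w k, inv w)"])
    qed
  qed
  have bar: "lookup (map_exp uminus s) (b - k) = lookup s (k - b)" for k
    using lookup_map_exp[of uminus s "k - b"] by simp
  have "lookup (map_exp uminus s * f) b = (\<Sum>k\<in>keys f. lookup f k * lookup s (k - b))"
    by (subst mult.commute) (simp add: lookup_times bar)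
  also have "\<dots> = (\<Sum>(k, w)\<in>D \<times> W. lookup f (map_key w k) * lookup s (map_key w k - b))"
    using sum.reindex_bij_betw[OF bij, of "\<lambda>k. lookup f k * lookup s (k - b)"]
    by (simp add: case_prod_beta)
  also have "\<dots> = (\<Sum>k\<in>D. lookup f k * (\<Sum>w\<in>W. sign w * lookup s (map_key w k - b)))"
    using f(2) unfolding sum.cartesian_product[symmetric] sum_distrib_left
    by (intro sum.cong) (auto simp: alternating_def W_def)
  \<comment> \<open>The signed sum over permutations is a coefficient of the antisymmetrization of
    \<open>s\<close> times a monomial, from which the symmetric \<open>s\<close> is taken
    out.\<close>
  also have "\<dots> = (\<Sum>k\<in>D. lookup f k * lookup (s * J n (single b 1)) k)"
    unfolding J_symmetric_times[OF s, symmetric] lookup_J W_def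
    by (simp add: mult.commute[of s] lookup_single_times)
  finally show ?thesis
    by (simp add: D_def)
qed


section \<open>Jacobi-Trudi determinants\<close>

definition geom :: "laurent \<Rightarrow> laurent fps" where
  "geom c = Abs_fps (\<lambda>d. c ^ d)"

lemma geom_nth [simp]: "fps_nth (geom c) d = c ^ d"
  by (simp add: geom_def)

text \<open>The complete homogeneous symmetric polynomial \<open>h_a\<close>, read off its
  generating function. The index is an integer because determinants produce negative indices, at
  which \<open>h_a\<close> is 0.\<close>

definition hsym :: "nat \<Rightarrow> int \<Rightarrow> laurent" where
  "hsym N a = (if a < 0 then 0 else fps_nth (\<Prod>j<N. geom (X j)) (nat a))"

lemma hsym_neg: "a < 0 \<Longrightarrow> hsym N a = 0"
  by (simp add: hsym_def)

lemma hsym_0: "hsym 0 a = (if a = 0 then 1 else 0)"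
  by (auto simp: hsym_def)

text \<open>The geometric series of the last variable is split off. Terms with
  \<open>c < \<mu>\<close> vanish, so the lower limit can be any \<open>lo\<close> up to \<mu>; a
  limit independent of \<mu> is what allows all entries of a determinant to be expanded over the
  same ranges.\<close>

lemma hsym_Suc:
  assumes "lo \<le> \<mu>"
  shows "hsym (Suc N) (l - \<mu>) = (\<Sum>c\<in>{lo..l}. X N ^ nat (l - c) * hsym N (c - \<mu>))"
proof (cases "l < \<mu>")
  case True
  then show ?thesis
    by (simp add: hsym_neg)
next
  case False
  define p where "p = (\<Prod>j<N. geom (X j))"
  have "hsym (Suc N) (l - \<mu>) = (\<Sum>i\<le>nat (l - \<mu>). fps_nth p i * X N ^ (nat (l - \<mu>) - i))"
    using False by (simp add: hsym_def fps_mult_nth p_def atLeast0AtMost)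
  also have "\<dots> = (\<Sum>c\<in>{\<mu>..l}. X N ^ nat (l - c) * hsym N (c - \<mu>))"
    using False
    by (intro sum.reindex_bij_witness[of _ "\<lambda>c. nat (c - \<mu>)" "\<lambda>i. int i + \<mu>"])
      (auto simp: hsym_def p_def mult.commute nat_diff_distrib' intro!: arg_cong2[of _ _ _ _ "(*)"] arg_cong2[of _ _ _ _ "(^)"])
  also have "\<dots> = (\<Sum>c\<in>{lo..l}. X N ^ nat (l - c) * hsym N (c - \<mu>))"
    using assms by (intro sum.mono_neutral_left) (auto simp: hsym_neg)
  finally show ?thesis .
qed

definition jt :: "nat \<Rightarrow> nat \<Rightarrow> (nat \<Rightarrow> int) \<Rightarrow> (nat \<Rightarrow> int) \<Rightarrow> laurent" where
  "jt N m L M = (\<Sum>u | u permutes {..<m}. of_int (sign u) * (\<Prod>i<m. hsym N (L (u i) - M i)))"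

lemma jt_swap:
  assumes "i < m" "j < m" "i \<noteq> j"
  shows "jt N m (L \<circ> transpose i j) M = - jt N m L M"
proof -
  have t: "transpose i j permutes {..<m}"
    using assms by (auto intro: permutes_swap_id)
  have "jt N m L M = (\<Sum>u | u permutes {..<m}. of_int (sign (transpose i j \<circ> u)) *
      (\<Prod>l<m. hsym N (L ((transpose i j \<circ> u) l) - M l)))"
    unfolding jt_def by (rule setum_permutations_compose_left[OF t])
  also have "\<dots> = - jt N m (L \<circ> transpose i j) M"
    unfolding jt_def sum_negf[symmetric] using assms t
    by (intro sum.cong) (auto simp: sign_compose_permutes sign_swap_id)
  finally show ?thesis
    by simp
qed

text \<open>This is multilinearity of the determinant after each entry has been expanded by
  \<open>hsym_Suc\<close>. The common bound \<open>lo\<close> makes the range of \<open>c i\<close>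
  depend on \<open>L i\<close> only, so one set of tuples serves all permutations.\<close>

lemma jt_Suc_all:
  assumes lo: "\<And>i. i < m \<Longrightarrow> lo \<le> M i"
  shows "jt (Suc N) m L M = (\<Sum>c\<in>Pi\<^sub>E {..<m} (\<lambda>i. {lo..L i}).
    X N ^ nat (\<Sum>i<m. L i - c i) * jt N m c M)"
proof -
  have "(\<Prod>i<m. hsym (Suc N) (L (u i) - M i)) = (\<Sum>c\<in>Pi\<^sub>E {..<m} (\<lambda>i. {lo..L i}).
      X N ^ nat (\<Sum>i<m. L i - c i) * (\<Prod>i<m. hsym N (c (u i) - M i)))"
    if u: "u permutes {..<m}" for u
  proof -
    \<comment> \<open>Indexing the product by the argument of \<open>L\<close> instead of
      \<open>M\<close> attaches the choice \<open>c i\<close> to \<open>L i\<close>, independently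
      of \<open>u\<close>.\<close>
    define v where "v = inv u"
    have v: "v permutes {..<m}" "v (u i) = i" for i
      using u by (simp_all add: v_def permutes_inv permutes_inverses)
    have "(\<Prod>i<m. hsym (Suc N) (L (u i) - M i)) = (\<Prod>i<m. hsym (Suc N) (L i - M (v i)))"
      using prod.permute[OF u, of "\<lambda>i. hsym (Suc N) (L i - M (v i))"] by (simp add: o_def v)
    also have "\<dots> = (\<Prod>i<m. \<Sum>c\<in>{lo..L i}. X N ^ nat (L i - c) * hsym N (c - M (v i)))"
      using lo permutes_in_image[OF v(1)] by (intro prod.cong hsym_Suc) auto
    also have "\<dots> = (\<Sum>c\<in>Pi\<^sub>E {..<m} (\<lambda>i. {lo..L i}).
        \<Prod>i<m. X N ^ nat (L i - c i) * hsym N (c i - M (v i)))"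
      by (rule prod_sum_PiE) auto
    also have "\<dots> = (\<Sum>c\<in>Pi\<^sub>E {..<m} (\<lambda>i. {lo..L i}).
        X N ^ nat (\<Sum>i<m. L i - c i) * (\<Prod>i<m. hsym N (c (u i) - M i)))"
    proof (rule sum.cong[OF refl])
      fix c assume c: "c \<in> Pi\<^sub>E {..<m} (\<lambda>i. {lo..L i})"
      have "(\<Sum>i<m. nat (L i - c i)) = nat (\<Sum>i<m. L i - c i)"
      proof -
        have "c i \<le> L i" if "i < m" for i
          using PiE_mem[OF c, of i] that by simp
        then have "(\<Sum>i<m. int (nat (L i - c i))) = (\<Sum>i<m. L i - c i)"
          by (intro sum.cong) simp_all
        then show ?thesis
          by (metis nat_int of_nat_sum)
      qed
      moreover have "(\<Prod>i<m. hsym N (c i - M (v i))) = (\<Prod>i<m. hsym N (c (u i) - M i))"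
        using prod.permute[OF u, of "\<lambda>i. hsym N (c i - M (v i))"] by (simp add: o_def v)
      ultimately show "(\<Prod>i<m. X N ^ nat (L i - c i) * hsym N (c i - M (v i))) =
          X N ^ nat (\<Sum>i<m. L i - c i) * (\<Prod>i<m. hsym N (c (u i) - M i))"
        by (simp add: prod.distrib flip: power_sum)
    qed
    finally show ?thesis .
  qed
  then have "jt (Suc N) m L M = (\<Sum>u | u permutes {..<m}. \<Sum>c\<in>Pi\<^sub>E {..<m} (\<lambda>i. {lo..L i}).
      X N ^ nat (\<Sum>i<m. L i - c i) * (of_int (sign u) * (\<Prod>i<m. hsym N (c (u i) - M i))))"
    by (simp add: jt_def sum_distrib_left mult.left_commute)
  then show ?thesis
    unfolding jt_def sum_distrib_left by (subst sum.swap) simp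
qed

text \<open>The tuples violating the interlacing condition \<open>L\<^bsub>i+1\<^esub> < c\<^sub>i\<close> cancel in pairs: if \<open>i\<close> is the
  first violation, exchange \<open>c\<^sub>i\<close> and \<open>c\<^bsub>i+1\<^esub>\<close>.\<close>

lemma jt_Suc:
  assumes lo: "\<And>i. i < m \<Longrightarrow> lo \<le> M i" and L: "\<And>i. Suc i < m \<Longrightarrow> L (Suc i) < L i"
  shows "jt (Suc N) m L M =
    (\<Sum>c | c \<in> Pi\<^sub>E {..<m} (\<lambda>i. {lo..L i}) \<and> (\<forall>i. Suc i < m \<longrightarrow> L (Suc i) < c i).
    X N ^ nat (\<Sum>i<m. L i - c i) * jt N m c M)"
proof -
  define P where "P = Pi\<^sub>E {..<m} (\<lambda>i. {lo..L i})"
  define f where "f c = X N ^ nat (\<Sum>i<m. L i - c i) * jt N m c M" for c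
  define good where "good = {c \<in> P. \<forall>i. Suc i < m \<longrightarrow> L (Suc i) < c i}"
  define bad where "bad i = {c \<in> P. c i \<le> L (Suc i) \<and> (\<forall>j<i. L (Suc j) < c j)}" for i
  have fin: "finite P"
    by (simp add: P_def finite_PiE)
  have Pmem: "lo \<le> c x \<and> c x \<le> L x" if "c \<in> P" "x < m" for c x
    using PiE_mem[OF that(1)[unfolded P_def], of x] that(2) by simp
  have Pext: "c x = undefined" if "c \<in> P" "\<not> x < m" for c x
    using PiE_arb[OF that(1)[unfolded P_def], of x] that(2) by simp
  have PI: "c \<in> P" if "\<And>x. x < m \<Longrightarrow> lo \<le> c x \<and> c x \<le> L x" "\<And>x. \<not> x < m \<Longrightarrow> c x = undefined" for c
    unfolding P_def using that by (intro PiE_I) simp_all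
  have zero: "sum f (bad i) = 0" if i: "Suc i < m" for i
  proof -
    define t where "t = transpose i (Suc i)"
    have t: "t permutes {..<m}"
      using i by (auto simp: t_def intro: permutes_swap_id)
    have tt: "t (t x) = x" for x
      by (simp add: t_def)
    have mem: "c \<circ> t \<in> bad i" if c: "c \<in> bad i" for c
    proof -
      have cP: "c \<in> P" "c i \<le> L (Suc i)" "\<forall>j<i. L (Suc j) < c j"
        using c by (auto simp: bad_def)
      have le: "c (Suc i) \<le> L (Suc i)"
        using Pmem[OF cP(1), of "Suc i"] i by simp
      \<comment> \<open>The exchanged tuple stays in range: \<open>c i \<le> L (Suc i)\<close> is
        the violation itself, and \<open>c (Suc i) \<le> L (Suc i) < L i\<close>.\<close>
      have "lo \<le> (c \<circ> t) x \<and> (c \<circ> t) x \<le> L x" if "x < m" for x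
      proof -
        have "lo \<le> c (t x) \<and> c (t x) \<le> L (t x)"
          using cP(1) permutes_in_image[OF t, of x] that by (intro Pmem) auto
        then show ?thesis
          using cP(2) L[OF i] le by (auto simp: t_def transpose_def split: if_splits)
      qed
      moreover have "(c \<circ> t) x = undefined" if "\<not> x < m" for x
        using Pext[OF cP(1) that] that i by (auto simp: t_def transpose_def)
      ultimately have "c \<circ> t \<in> P"
        by (intro PI) auto
      moreover have "(c \<circ> t) i \<le> L (Suc i)"
        using le by (simp add: t_def)
      moreover have "L (Suc j) < (c \<circ> t) j" if "j < i" for j
        using cP(3) that by (auto simp: t_def transpose_def)
      ultimately show ?thesis
        by (simp add: bad_def)
    qed
    have inv: "(c \<circ> t) \<circ> t = c" for c :: "nat \<Rightarrow> int"
      by (simp add: fun_eq_iff tt)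
    have "sum f (bad i) = sum (\<lambda>c. f (c \<circ> t)) (bad i)"
      by (rule sum.reindex_bij_witness[of _ "\<lambda>c. c \<circ> t" "\<lambda>c. c \<circ> t"]) (simp_all only: mem inv)
    also have "\<dots> = sum (\<lambda>c. - f c) (bad i)"
    proof (rule sum.cong[OF refl])
      fix c
      have "(\<Sum>i<m. L i - (c \<circ> t) i) = (\<Sum>i<m. L i - c i)"
        using sum.permute[OF t, of c] by (simp add: sum_subtractf o_def)
      then show "f (c \<circ> t) = - f c"
        using jt_swap[of i m "Suc i" N c M] i by (simp add: f_def t_def)
    qed
    finally have "sum f (bad i) = - sum f (bad i)"
      by (simp add: sum_negf)
    then have "lookup (sum f (bad i)) k = - lookup (sum f (bad i)) k" for k
      by (metis lookup_uminus)
    then show ?thesis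
      by (intro poly_mapping_eqI) (simp add: eq_neg_iff_add_eq_0)
  qed
  have "P - good = (\<Union>i\<in>{i. Suc i < m}. bad i)"
  proof (intro equalityI subsetI)
    fix c assume c: "c \<in> P - good"
    then obtain i where i: "Suc i < m" "c i \<le> L (Suc i)"
      by (force simp: good_def)
    define i' where "i' = (LEAST i. c i \<le> L (Suc i))"
    have "c i' \<le> L (Suc i')" "i' \<le> i"
      unfolding i'_def using i(2) by (rule LeastI, intro Least_le i(2))
    moreover have "L (Suc j) < c j" if "j < i'" for j
      using not_less_Least[OF that[unfolded i'_def]] by simp
    ultimately show "c \<in> (\<Union>i\<in>{i. Suc i < m}. bad i)"
      using c i by (intro UN_I[of i']) (auto simp: bad_def)
  qed (auto simp: bad_def good_def)
  moreover have "bad i \<inter> bad j = {}" if "i \<noteq> j" for i j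
  proof -
    have "bad i \<inter> bad j = {}" if "i < j" for i j
      using that by (force simp: bad_def not_less)
    with that show ?thesis
      by (metis Int_commute linorder_neqE_nat)
  qed
  moreover have "finite {i. Suc i < m}"
    by (rule finite_subset[of _ "{..<m}"]) auto
  ultimately have "sum f (P - good) = (\<Sum>i | Suc i < m. sum f (bad i))"
    using fin by (simp add: bad_def sum.UNION_disjoint)
  then have "sum f (P - good) = 0"
    by (simp add: zero)
  then have "sum f P = sum f good"
    using sum.subset_diff[of good P f] fin by (auto simp: good_def)
  moreover have "jt (Suc N) m L M = sum f P"
    unfolding f_def P_def by (rule jt_Suc_all[OF lo])
  ultimately show ?thesis
    by (simp add: f_def good_def P_def)
qed

text \<open>By the pigeonhole principle, every permutation sends some \<open>i \<le> k\<close> to a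
  value at least \<open>k\<close>. The corresponding index satisfies
  \<open>L (u i) \<le> L k < M k \<le> M i\<close>, so it is negative.\<close>

lemma jt_eq_0:
  assumes L: "\<And>i j. i \<le> j \<Longrightarrow> j < m \<Longrightarrow> L j \<le> L i" and M: "\<And>i j. i \<le> j \<Longrightarrow> j < m \<Longrightarrow> M j \<le> M i"
    and k: "k < m" "L k < M k"
  shows "jt N m L M = 0"
  unfolding jt_def
proof (intro sum.neutral ballI)
  fix u assume "u \<in> {u. u permutes {..<m}}"
  then have u: "u permutes {..<m}"
    by simp
  have "\<exists>i\<le>k. k \<le> u i"
  proof (rule ccontr)
    assume "\<not> (\<exists>i\<le>k. k \<le> u i)"
    then have "u ` {..k} \<subseteq> {..<k}"
      by (fastforce simp: not_le)
    then have "card (u ` {..k}) \<le> card {..<k}"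
      by (intro card_mono) auto
    then show False
      by (simp add: card_image permutes_inj_on[OF u])
  qed
  then obtain i where i: "i \<le> k" "k \<le> u i"
    by blast
  then have "i < m" "u i < m"
    using k permutes_in_image[OF u, of i] by auto
  then have "L (u i) - M i < 0"
    using L[OF i(2)] M[OF i(1) k(1)] k(2) by simp
  then have "hsym N (L (u i) - M i) = 0"
    by (rule hsym_neg)
  then show "of_int (sign u) * (\<Prod>i<m. hsym N (L (u i) - M i)) = 0"
    using \<open>i < m\<close> by (auto intro!: prod_zero)
qed

text \<open>Without variables \<open>h_a\<close> is 1 for \<open>a = 0\<close> and 0 otherwise. A
  permutation contributes only if \<open>L\<close> after \<open>u\<close> equals \<open>M\<close>;
  then the sums of \<open>L\<close> and \<open>M\<close> agree, which together with
  \<open>M \<le> L\<close> forces \<open>M = L\<close>, and injectivity of \<open>L\<close> forces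
  \<open>u = id\<close>.\<close>

lemma jt_0:
  assumes L: "inj_on L {..<m}" and le: "\<And>i. i < m \<Longrightarrow> M i \<le> L i"
  shows "jt 0 m L M = (if \<forall>i<m. M i = L i then 1 else 0)"
proof -
  have "of_int (sign u) * (\<Prod>i<m. hsym 0 (L (u i) - M i)) =
      (if u = id then (if \<forall>i<m. M i = L i then 1 else 0) else 0 :: laurent)"
    if u: "u permutes {..<m}" for u
  proof (cases "\<forall>i<m. L (u i) = M i")
    case True
    have "(\<Sum>i<m. L i) = (\<Sum>i<m. M i)"
      using sum.permute[OF u, of L] True by (simp add: o_def)
    then have eq: "\<forall>i<m. M i = L i"
      using sum_strict_mono_ex1[of "{..<m}" M L] le by (force simp: order_less_le)
    then have "u i = i" for i
      using True L permutes_in_image[OF u, of i] permutes_not_in[OF u, of i]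
      by (cases "i < m") (auto simp: inj_on_def)
    then have "u = id"
      by auto
    with eq show ?thesis
      by (simp add: hsym_0)
  next
    case False
    then obtain i where "i < m" "L (u i) \<noteq> M i"
      by blast
    then have "(\<Prod>i<m. hsym 0 (L (u i) - M i)) = 0"
      by (auto intro!: prod_zero bexI[of _ i] simp: hsym_0)
    with False show ?thesis
      by auto
  qed
  then have "jt 0 m L M =
      (\<Sum>u | u permutes {..<m}. if u = id then (if \<forall>i<m. M i = L i then 1 else 0) else 0)"
    unfolding jt_def by (intro sum.cong) auto
  then show ?thesis
    by (simp add: permutes_id)
qed


section \<open>Skew Schur polynomials\<close>

lemma skew_cells_Sigma:
  assumes "\<And>r. r < length \<alpha> \<Longrightarrow> 0 \<le> \<mu> ! r"
  shows "skew_cells \<alpha> \<mu> = Sigma {..<length \<alpha>} (\<lambda>r. {nat (\<mu> ! r)..<nat (\<alpha> ! r)})"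
  using assms by (fastforce simp: skew_cells_def)

lemma finite_skew_cells:
  assumes "\<And>r. r < length \<alpha> \<Longrightarrow> 0 \<le> \<mu> ! r"
  shows "finite (skew_cells \<alpha> \<mu>)"
  by (simp add: skew_cells_Sigma[OF assms])

lemma card_skew_cells:
  assumes "\<And>r. r < length \<alpha> \<Longrightarrow> 0 \<le> \<mu> ! r" "\<And>r. r < length \<alpha> \<Longrightarrow> \<mu> ! r \<le> \<alpha> ! r"
  shows "int (card (skew_cells \<alpha> \<mu>)) = (\<Sum>r<length \<alpha>. \<alpha> ! r - \<mu> ! r)"
proof -
  have "int (card (skew_cells \<alpha> \<mu>)) = (\<Sum>r<length \<alpha>. int (nat (\<alpha> ! r) - nat (\<mu> ! r)))"
    by (simp add: skew_cells_Sigma[OF assms(1)])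
  also have "\<dots> = (\<Sum>r<length \<alpha>. \<alpha> ! r - \<mu> ! r)"
  proof (intro sum.cong refl)
    fix r assume "r \<in> {..<length \<alpha>}"
    with assms[of r] show "int (nat (\<alpha> ! r) - nat (\<mu> ! r)) = \<alpha> ! r - \<mu> ! r"
      by simp
  qed
  finally show ?thesis .
qed

lemma finite_skew_ssyt:
  assumes "\<And>r. r < length \<alpha> \<Longrightarrow> 0 \<le> \<mu> ! r"
  shows "finite (skew_ssyt N \<alpha> \<mu>)"
  by (rule finite_subset[of _ "skew_cells \<alpha> \<mu> \<rightarrow>\<^sub>E {..<N}"])
    (auto simp: skew_ssyt_def intro!: finite_PiE finite_skew_cells assms)

lemma skew_ssyt_undefined: "T \<in> skew_ssyt N \<alpha> \<mu> \<Longrightarrow> p \<notin> skew_cells \<alpha> \<mu> \<Longrightarrow> T p = undefined"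
  unfolding skew_ssyt_def by (drule CollectD, drule conjunct1, erule PiE_arb)

text \<open>The intermediate shapes for which the cells outside them form a horizontal strip, no two
  in a column. These are the shapes left after deleting the largest letter of a tableau.\<close>

definition interlacing :: "int list \<Rightarrow> int list \<Rightarrow> int list set" where
  "interlacing \<alpha> \<mu> = {\<kappa>. length \<kappa> = length \<alpha> \<and> (\<forall>r<length \<alpha>. \<mu> ! r \<le> \<kappa> ! r \<and> \<kappa> ! r \<le> \<alpha> ! r) \<and>
     (\<forall>r. Suc r < length \<alpha> \<longrightarrow> \<alpha> ! Suc r \<le> \<kappa> ! r)}"

lemma downclosed_eq_atLeastLessThan:
  fixes A :: "nat set"
  assumes "finite A" "A \<subseteq> {a..}" "\<And>c c'. c \<in> A \<Longrightarrow> a \<le> c' \<Longrightarrow> c' < c \<Longrightarrow> c' \<in> A"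
  shows "A = {a..<a + card A}"
proof (cases "A = {}")
  case False
  have "A = {a..<Suc (Max A)}"
  proof (intro equalityI subsetI)
    fix c assume "c \<in> A"
    then show "c \<in> {a..<Suc (Max A)}"
      using assms by (auto simp: less_Suc_eq_le)
  next
    fix c assume "c \<in> {a..<Suc (Max A)}"
    then show "c \<in> A"
      using assms(3)[OF Max_in[OF assms(1) False], of c] Max_in[OF assms(1) False]
      by (cases "c = Max A") auto
  qed
  moreover have "a \<le> Max A"
    using Max_in[OF assms(1) False] assms(2) by auto
  ultimately show ?thesis
    by (metis card_atLeastLessThan le_add_diff_inverse le_SucI)
qed simp

text \<open>Weakly increasing rows make the small cells left-justified in each row, and their number
  defines \<kappa>. Strictly increasing columns give the interlacing: a cell with another cell below
  it cannot carry the largest letter.\<close>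

lemma ssyt_small_cells:
  assumes T: "T \<in> skew_ssyt (Suc N) \<alpha> \<mu>" and \<alpha>: "\<And>r s. r \<le> s \<Longrightarrow> s < length \<alpha> \<Longrightarrow> \<alpha> ! s \<le> \<alpha> ! r"
    and \<mu>: "\<And>r s. r \<le> s \<Longrightarrow> s < length \<alpha> \<Longrightarrow> \<mu> ! s \<le> \<mu> ! r" "\<And>r. r < length \<alpha> \<Longrightarrow> 0 \<le> \<mu> ! r"
    and le: "\<And>r. r < length \<alpha> \<Longrightarrow> \<mu> ! r \<le> \<alpha> ! r"
  obtains \<kappa> where "\<kappa> \<in> interlacing \<alpha> \<mu>" "skew_cells \<kappa> \<mu> = {p \<in> skew_cells \<alpha> \<mu>. T p < N}"
proof -
  define A where "A r = {c. (r, c) \<in> skew_cells \<alpha> \<mu> \<and> T (r, c) < N}" for r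
  define \<kappa> where "\<kappa> = map (\<lambda>r. \<mu> ! r + int (card (A r))) [0..<length \<alpha>]"
  have row: "T (r, c) \<le> T (r, c')"
    if "(r, c) \<in> skew_cells \<alpha> \<mu>" "(r, c') \<in> skew_cells \<alpha> \<mu>" "c < c'" for r c c'
    using T that unfolding skew_ssyt_def by blast
  have col: "T (r, c) < T (r', c)"
    if "(r, c) \<in> skew_cells \<alpha> \<mu>" "(r', c) \<in> skew_cells \<alpha> \<mu>" "r < r'" for r r' c
    using T that unfolding skew_ssyt_def by blast
  have letter: "T p < Suc N" if "p \<in> skew_cells \<alpha> \<mu>" for p
    using T that unfolding skew_ssyt_def by blast
  have Ar: "A r = {nat (\<mu> ! r)..<nat (\<mu> ! r) + card (A r)}" if r: "r < length \<alpha>" for r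
  proof (rule downclosed_eq_atLeastLessThan)
    show "finite (A r)"
      by (rule finite_subset[of _ "{..<nat (\<alpha> ! r)}"]) (auto simp: A_def skew_cells_def)
    show "A r \<subseteq> {nat (\<mu> ! r)..}"
      by (auto simp: A_def skew_cells_def)
    fix c c' assume c: "c \<in> A r" "nat (\<mu> ! r) \<le> c'" "c' < c"
    then have c': "(r, c') \<in> skew_cells \<alpha> \<mu>"
      by (auto simp: A_def skew_cells_def)
    then show "c' \<in> A r"
      using c row[OF c', of c] by (auto simp: A_def)
  qed
  have len: "length \<kappa> = length \<alpha>"
    by (simp add: \<kappa>_def)
  have cell_iff: "(r, c) \<in> skew_cells \<kappa> \<mu> \<longleftrightarrow> (r, c) \<in> skew_cells \<alpha> \<mu> \<and> T (r, c) < N" for r c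
  proof (cases "r < length \<alpha>")
    case True
    have "(r, c) \<in> skew_cells \<kappa> \<mu> \<longleftrightarrow> c \<in> {nat (\<mu> ! r)..<nat (\<mu> ! r) + card (A r)}"
      using True \<mu>(2)[OF True] by (auto simp: skew_cells_def \<kappa>_def)
    also have "\<dots> \<longleftrightarrow> c \<in> A r"
      using Ar[OF True] by simp
    finally show ?thesis
      by (simp add: A_def)
  qed (simp add: skew_cells_def \<kappa>_def)
  have "\<kappa> ! r \<le> \<alpha> ! r" if r: "r < length \<alpha>" for r
  proof (rule ccontr)
    assume "\<not> \<kappa> ! r \<le> \<alpha> ! r"
    then have "(r, nat (\<alpha> ! r)) \<in> skew_cells \<kappa> \<mu>"
      using r le[OF r] \<mu>(2)[OF r] len by (auto simp: skew_cells_def)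
    then have "(r, nat (\<alpha> ! r)) \<in> skew_cells \<alpha> \<mu>"
      by (simp only: cell_iff)
    then show False
      using \<mu>(2)[OF r] le[OF r] by (simp add: skew_cells_def)
  qed
  moreover have "\<alpha> ! Suc r \<le> \<kappa> ! r" if r: "Suc r < length \<alpha>" for r
  proof (rule ccontr)
    assume less: "\<not> \<alpha> ! Suc r \<le> \<kappa> ! r"
    \<comment> \<open>The first column of row \<open>r\<close> beyond \<kappa>. If the row below
      still had a cell there, the letter above it would be small.\<close>
    define c where "c = nat (\<kappa> ! r)"
    have "\<mu> ! r \<le> \<kappa> ! r"
      using r by (simp add: \<kappa>_def)
    then have c: "int c = \<kappa> ! r" "\<mu> ! r \<le> int c" "int c < \<alpha> ! Suc r"
      using \<mu>(2)[of r] r less by (auto simp: c_def)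
    then have cells: "(r, c) \<in> skew_cells \<alpha> \<mu>" "(Suc r, c) \<in> skew_cells \<alpha> \<mu>"
      using r \<alpha>[of r "Suc r"] \<mu>(1)[of r "Suc r"] by (auto simp: skew_cells_def)
    then have "T (r, c) < N"
      using col[OF cells] letter[OF cells(2)] by simp
    then have "(r, c) \<in> skew_cells \<kappa> \<mu>"
      using cells by (simp add: cell_iff)
    then show False
      using c(1) by (simp add: skew_cells_def)
  qed
  ultimately have "\<kappa> \<in> interlacing \<alpha> \<mu>"
    using len by (auto simp: interlacing_def \<kappa>_def)
  moreover have "skew_cells \<kappa> \<mu> = {p \<in> skew_cells \<alpha> \<mu>. T p < N}"
    using cell_iff by auto
  ultimately show ?thesis
    by (rule that)
qed

text \<open>The branching rule: a tableau with letters up to \<open>N\<close> is a tableau with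
  letters below \<open>N\<close> on an interlacing shape, together with a horizontal strip filled
  with \<open>N\<close>.\<close>

lemma skew_schur_Suc:
  assumes \<alpha>: "\<And>r s. r \<le> s \<Longrightarrow> s < length \<alpha> \<Longrightarrow> \<alpha> ! s \<le> \<alpha> ! r"
    and \<mu>: "\<And>r s. r \<le> s \<Longrightarrow> s < length \<alpha> \<Longrightarrow> \<mu> ! s \<le> \<mu> ! r" "\<And>r. r < length \<alpha> \<Longrightarrow> 0 \<le> \<mu> ! r"
    and le: "\<And>r. r < length \<alpha> \<Longrightarrow> \<mu> ! r \<le> \<alpha> ! r"
  shows "skew_schur (Suc N) \<alpha> \<mu> = (\<Sum>\<kappa>\<in>interlacing \<alpha> \<mu>.
    X N ^ nat (\<Sum>r<length \<alpha>. \<alpha> ! r - \<kappa> ! r) * skew_schur N \<kappa> \<mu>)"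
proof -
  define ext where "ext \<kappa> T = (\<lambda>p. if p \<in> skew_cells \<kappa> \<mu> then T p
    else if p \<in> skew_cells \<alpha> \<mu> then N else undefined)" for \<kappa> and T :: "nat \<times> nat \<Rightarrow> nat"
  define W where "W T = (\<Prod>p\<in>skew_cells \<alpha> \<mu>. X (T p))" for T
  have sub: "skew_cells \<kappa> \<mu> \<subseteq> skew_cells \<alpha> \<mu>" if "\<kappa> \<in> interlacing \<alpha> \<mu>" for \<kappa>
    using that by (force simp: interlacing_def skew_cells_def)
  have small: "{p \<in> skew_cells \<alpha> \<mu>. ext \<kappa> T p < N} = skew_cells \<kappa> \<mu>"
    if "\<kappa> \<in> interlacing \<alpha> \<mu>" "T \<in> skew_ssyt N \<kappa> \<mu>" for \<kappa> T
    using that(2) sub[OF that(1)] by (auto simp: ext_def skew_ssyt_def)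
  \<comment> \<open>The bound of \<kappa> from below by \<mu> matters: otherwise a row without cells
    would not determine its entry of \<kappa>.\<close>
  have inj_cells: "\<kappa> = \<kappa>'" if \<kappa>: "\<kappa> \<in> interlacing \<alpha> \<mu>" "\<kappa>' \<in> interlacing \<alpha> \<mu>"
    and eq: "skew_cells \<kappa> \<mu> = skew_cells \<kappa>' \<mu>" for \<kappa> \<kappa>'
  proof (rule nth_equalityI)
    show len: "length \<kappa> = length \<kappa>'"
      using \<kappa> by (simp add: interlacing_def)
    fix r assume r: "r < length \<kappa>"
    have *: "\<not> a ! r < b ! r" if "a \<in> interlacing \<alpha> \<mu>" "b \<in> interlacing \<alpha> \<mu>"
      "skew_cells a \<mu> = skew_cells b \<mu>" for a b
    proof
      assume less: "a ! r < b ! r"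
      have a: "\<mu> ! r \<le> a ! r" "length b = length \<alpha>" "r < length \<alpha>"
        using that \<kappa>(1) r by (auto simp: interlacing_def)
      then have "(r, nat (a ! r)) \<in> skew_cells b \<mu>"
        using less \<mu>(2)[OF a(3)] by (auto simp: skew_cells_def)
      then have "(r, nat (a ! r)) \<in> skew_cells a \<mu>"
        by (simp add: that)
      moreover have "0 \<le> a ! r"
        using a \<mu>(2)[OF a(3)] by simp
      ultimately show False
        by (simp add: skew_cells_def)
    qed
    from *[OF \<kappa> eq] *[OF \<kappa>(2,1) eq[symmetric]] show "\<kappa> ! r = \<kappa>' ! r"
      by simp
  qed
  have bij: "bij_betw (\<lambda>(\<kappa>, T). ext \<kappa> T) (Sigma (interlacing \<alpha> \<mu>) (\<lambda>\<kappa>. skew_ssyt N \<kappa> \<mu>))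
    (skew_ssyt (Suc N) \<alpha> \<mu>)"
    unfolding bij_betw_def
  proof
    show "inj_on (\<lambda>(\<kappa>, T). ext \<kappa> T) (Sigma (interlacing \<alpha> \<mu>) (\<lambda>\<kappa>. skew_ssyt N \<kappa> \<mu>))"
    proof (rule inj_onI, clarify)
      fix \<kappa> T \<kappa>' T'
      assume a: "\<kappa> \<in> interlacing \<alpha> \<mu>" "T \<in> skew_ssyt N \<kappa> \<mu>" "\<kappa>' \<in> interlacing \<alpha> \<mu>"
        "T' \<in> skew_ssyt N \<kappa>' \<mu>" "ext \<kappa> T = ext \<kappa>' T'"
      then have \<kappa>: "\<kappa> = \<kappa>'"
        using small[of \<kappa> T] small[of \<kappa>' T'] by (intro inj_cells) auto
      have "T p = T' p" for p
      proof (cases "p \<in> skew_cells \<kappa> \<mu>")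
        case True
        then show ?thesis
          using fun_cong[OF a(5), of p] \<kappa> by (simp add: ext_def)
      next
        case False
        then show ?thesis
          using skew_ssyt_undefined[OF a(2)] skew_ssyt_undefined[OF a(4)] \<kappa> by simp
      qed
      with \<kappa> show "\<kappa> = \<kappa>' \<and> T = T'"
        by auto
    qed
    show "(\<lambda>(\<kappa>, T). ext \<kappa> T) ` Sigma (interlacing \<alpha> \<mu>) (\<lambda>\<kappa>. skew_ssyt N \<kappa> \<mu>) = skew_ssyt (Suc N) \<alpha> \<mu>"
    proof (intro equalityI subsetI)
      fix T' assume "T' \<in> (\<lambda>(\<kappa>, T). ext \<kappa> T) ` Sigma (interlacing \<alpha> \<mu>) (\<lambda>\<kappa>. skew_ssyt N \<kappa> \<mu>)"
      then obtain \<kappa> T where \<kappa>: "\<kappa> \<in> interlacing \<alpha> \<mu>" and T: "T \<in> skew_ssyt N \<kappa> \<mu>" and T': "T' = ext \<kappa> T"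
        by auto
      have letter: "T p < N" if "p \<in> skew_cells \<kappa> \<mu>" for p
        using T that unfolding skew_ssyt_def by blast
      have len: "length \<kappa> = length \<alpha>"
        using \<kappa> by (simp add: interlacing_def)
      show "T' \<in> skew_ssyt (Suc N) \<alpha> \<mu>"
        unfolding skew_ssyt_def
      proof (intro CollectI conjI allI impI)
        show "T' \<in> skew_cells \<alpha> \<mu> \<rightarrow>\<^sub>E {..<Suc N}"
          using letter sub[OF \<kappa>] by (intro PiE_I) (auto simp: T' ext_def less_SucI)
      next
        fix r c c' assume c: "(r, c) \<in> skew_cells \<alpha> \<mu> \<and> (r, c') \<in> skew_cells \<alpha> \<mu> \<and> c < c'"
        show "T' (r, c) \<le> T' (r, c')"
        proof (cases "(r, c') \<in> skew_cells \<kappa> \<mu>")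
          case True
          then have "(r, c) \<in> skew_cells \<kappa> \<mu>"
            using c by (auto simp: skew_cells_def)
          then show ?thesis
            using True T c unfolding T' ext_def skew_ssyt_def by auto
        next
          case False
          then show ?thesis
            using c letter[of "(r, c)"] by (auto simp: T' ext_def)
        qed
      next
        fix r r' c assume c: "(r, c) \<in> skew_cells \<alpha> \<mu> \<and> (r', c) \<in> skew_cells \<alpha> \<mu> \<and> r < r'"
        then have r: "r' < length \<alpha>" "int c < \<alpha> ! r'" "\<mu> ! r \<le> int c"
          by (auto simp: skew_cells_def)
        \<comment> \<open>Interlacing puts the upper of two cells in a column inside \<kappa>, so
          \<open>N\<close> can occur only as the lower one.\<close>
        have "\<alpha> ! r' \<le> \<alpha> ! Suc r"
          using c r by (intro \<alpha>) auto
        also have "\<dots> \<le> \<kappa> ! r"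
          using \<kappa> c r by (auto simp: interlacing_def)
        finally have mem: "(r, c) \<in> skew_cells \<kappa> \<mu>"
          using r c len by (auto simp: skew_cells_def)
        show "T' (r, c) < T' (r', c)"
        proof (cases "(r', c) \<in> skew_cells \<kappa> \<mu>")
          case True
          then show ?thesis
            using mem T c unfolding T' ext_def skew_ssyt_def by auto
        next
          case False
          then show ?thesis
            using c mem letter[OF mem] by (auto simp: T' ext_def)
        qed
      qed
    next
      fix T' assume T': "T' \<in> skew_ssyt (Suc N) \<alpha> \<mu>"
      obtain \<kappa> where \<kappa>: "\<kappa> \<in> interlacing \<alpha> \<mu>" "skew_cells \<kappa> \<mu> = {p \<in> skew_cells \<alpha> \<mu>. T' p < N}"
        using ssyt_small_cells[OF T' \<alpha> \<mu> le] by metis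
      define T where "T = restrict T' (skew_cells \<kappa> \<mu>)"
      have "T \<in> skew_cells \<kappa> \<mu> \<rightarrow>\<^sub>E {..<N}"
        unfolding T_def by (rule PiE_I) (auto simp: \<kappa>(2))
      moreover have "T (r, c) \<le> T (r, c')"
        if "(r, c) \<in> skew_cells \<kappa> \<mu> \<and> (r, c') \<in> skew_cells \<kappa> \<mu> \<and> c < c'" for r c c'
        using T' that sub[OF \<kappa>(1)] unfolding T_def skew_ssyt_def by (simp add: subset_iff)
      moreover have "T (r, c) < T (r', c)"
        if "(r, c) \<in> skew_cells \<kappa> \<mu> \<and> (r', c) \<in> skew_cells \<kappa> \<mu> \<and> r < r'" for r r' c
        using T' that sub[OF \<kappa>(1)] unfolding T_def skew_ssyt_def by (simp add: subset_iff)
      ultimately have "T \<in> skew_ssyt N \<kappa> \<mu>"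
        unfolding skew_ssyt_def by blast
      moreover have "T' p = ext \<kappa> T p" for p
      proof (cases "p \<in> skew_cells \<alpha> \<mu>")
        case True
        then have "T' p < Suc N"
          using T' unfolding skew_ssyt_def by blast
        with True show ?thesis
          by (simp add: ext_def T_def \<kappa>(2))
      next
        case False
        then show ?thesis
          using skew_ssyt_undefined[OF T'] sub[OF \<kappa>(1)] by (auto simp: ext_def)
      qed
      ultimately show "T' \<in> (\<lambda>(\<kappa>, T). ext \<kappa> T) ` Sigma (interlacing \<alpha> \<mu>) (\<lambda>\<kappa>. skew_ssyt N \<kappa> \<mu>)"
        using \<kappa>(1) by (auto intro!: image_eqI[of _ _ "(\<kappa>, T)"])
    qed
  qed
  have weight: "W (ext \<kappa> T) = X N ^ nat (\<Sum>r<length \<alpha>. \<alpha> ! r - \<kappa> ! r) * (\<Prod>p\<in>skew_cells \<kappa> \<mu>. X (T p))"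
    if \<kappa>: "\<kappa> \<in> interlacing \<alpha> \<mu>" for \<kappa> T
  proof -
    have fin: "finite (skew_cells \<alpha> \<mu>)"
      by (rule finite_skew_cells[OF \<mu>(2)])
    have len: "length \<kappa> = length \<alpha>"
      using \<kappa> by (simp add: interlacing_def)
    have "int (card (skew_cells \<alpha> \<mu> - skew_cells \<kappa> \<mu>)) =
        int (card (skew_cells \<alpha> \<mu>)) - int (card (skew_cells \<kappa> \<mu>))"
      using card_Diff_subset[OF finite_subset[OF sub[OF \<kappa>] fin] sub[OF \<kappa>]]
        card_mono[OF fin sub[OF \<kappa>]] by simp
    also have "\<dots> = (\<Sum>r<length \<alpha>. \<alpha> ! r - \<mu> ! r) - (\<Sum>r<length \<alpha>. \<kappa> ! r - \<mu> ! r)"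
      using \<kappa> card_skew_cells[of \<kappa> \<mu>] card_skew_cells[of \<alpha> \<mu>] \<mu>(2) le len
      by (simp add: interlacing_def)
    also have "\<dots> = (\<Sum>r<length \<alpha>. \<alpha> ! r - \<kappa> ! r)"
      by (simp add: sum_subtractf)
    finally have card: "nat (\<Sum>r<length \<alpha>. \<alpha> ! r - \<kappa> ! r) = card (skew_cells \<alpha> \<mu> - skew_cells \<kappa> \<mu>)"
      by linarith
    have "W (ext \<kappa> T) = (\<Prod>p\<in>skew_cells \<alpha> \<mu> - skew_cells \<kappa> \<mu>. X (ext \<kappa> T p)) *
        (\<Prod>p\<in>skew_cells \<kappa> \<mu>. X (ext \<kappa> T p))"
      unfolding W_def by (rule prod.subset_diff[OF sub[OF \<kappa>] fin])
    also have "(\<Prod>p\<in>skew_cells \<kappa> \<mu>. X (ext \<kappa> T p)) = (\<Prod>p\<in>skew_cells \<kappa> \<mu>. X (T p))"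
      by (intro prod.cong) (auto simp: ext_def)
    also have "(\<Prod>p\<in>skew_cells \<alpha> \<mu> - skew_cells \<kappa> \<mu>. X (ext \<kappa> T p)) =
        (\<Prod>p\<in>skew_cells \<alpha> \<mu> - skew_cells \<kappa> \<mu>. X N)"
      by (intro prod.cong) (auto simp: ext_def)
    finally show ?thesis
      by (simp add: card)
  qed
  have fin: "finite (interlacing \<alpha> \<mu>)"
  proof (rule finite_subset)
    show "interlacing \<alpha> \<mu> \<subseteq> {\<kappa>. set \<kappa> \<subseteq> (\<Union>r<length \<alpha>. {\<mu> ! r..\<alpha> ! r}) \<and> length \<kappa> = length \<alpha>}"
      by (auto simp: interlacing_def in_set_conv_nth intro!: bexI)
    show "finite {\<kappa>. set \<kappa> \<subseteq> (\<Union>r<length \<alpha>. {\<mu> ! r..\<alpha> ! r}) \<and> length \<kappa> = length \<alpha>}"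
      by (rule finite_lists_length_eq) auto
  qed
  have "skew_schur (Suc N) \<alpha> \<mu> = (\<Sum>(\<kappa>, T)\<in>Sigma (interlacing \<alpha> \<mu>) (\<lambda>\<kappa>. skew_ssyt N \<kappa> \<mu>). W (ext \<kappa> T))"
    using sum.reindex_bij_betw[OF bij, of W] by (simp add: skew_schur_def W_def case_prod_beta)
  also have "\<dots> = (\<Sum>\<kappa>\<in>interlacing \<alpha> \<mu>. \<Sum>T\<in>skew_ssyt N \<kappa> \<mu>. W (ext \<kappa> T))"
    using fin \<mu>(2) by (intro sum.Sigma[symmetric]) (auto intro!: finite_skew_ssyt simp: interlacing_def)
  also have "\<dots> = (\<Sum>\<kappa>\<in>interlacing \<alpha> \<mu>. X N ^ nat (\<Sum>r<length \<alpha>. \<alpha> ! r - \<kappa> ! r) * skew_schur N \<kappa> \<mu>)"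
    unfolding skew_schur_def sum_distrib_left by (intro sum.cong refl) (simp add: weight)
  finally show ?thesis .
qed


lemma jt_cong:
  assumes "\<And>i. i < m \<Longrightarrow> L i = L' i" "\<And>i. i < m \<Longrightarrow> M i = M' i"
  shows "jt N m L M = jt N m L' M'"
  unfolding jt_def
proof (intro sum.cong refl arg_cong2[of _ _ _ _ "(*)"] prod.cong)
  fix u i assume "u \<in> {u. u permutes {..<m}}" "i \<in> {..<m}"
  then show "hsym N (L (u i) - M i) = hsym N (L' (u i) - M' i)"
    using assms permutes_in_image[of u "{..<m}" i] by simp
qed

lemma skew_schur_0:
  assumes \<mu>: "\<And>r. r < length \<alpha> \<Longrightarrow> 0 \<le> \<mu> ! r" and le: "\<And>r. r < length \<alpha> \<Longrightarrow> \<mu> ! r \<le> \<alpha> ! r"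
  shows "skew_schur 0 \<alpha> \<mu> = (if \<forall>r<length \<alpha>. \<mu> ! r = \<alpha> ! r then 1 else 0)"
proof (cases "\<forall>r<length \<alpha>. \<mu> ! r = \<alpha> ! r")
  case True
  then have "skew_cells \<alpha> \<mu> = {}"
    by (auto simp: skew_cells_def)
  moreover from this have "skew_ssyt 0 \<alpha> \<mu> = {\<lambda>_. undefined}"
    by (auto simp: skew_ssyt_def)
  ultimately show ?thesis
    using True by (simp add: skew_schur_def)
next
  case False
  then obtain r where "r < length \<alpha>" "\<mu> ! r < \<alpha> ! r"
    using le by (auto simp: order_less_le)
  then have "(r, nat (\<mu> ! r)) \<in> skew_cells \<alpha> \<mu>"
    using \<mu> by (simp add: skew_cells_def)
  then have "skew_ssyt 0 \<alpha> \<mu> = {}"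
    unfolding skew_ssyt_def by blast
  then show ?thesis
    using False by (auto simp: skew_schur_def)
qed

text \<open>Induction on the number of variables. Adding a variable expands the determinant by
  \<open>jt_Suc\<close> and the tableau sum by \<open>skew_schur_Suc\<close>, and
  \<open>c i = \<kappa> ! i - i\<close> matches the two index sets.\<close>

theorem jacobi_trudi:
  assumes "\<And>r s. r \<le> s \<Longrightarrow> s < length \<alpha> \<Longrightarrow> \<alpha> ! s \<le> \<alpha> ! r"
    and "\<And>r s. r \<le> s \<Longrightarrow> s < length \<alpha> \<Longrightarrow> \<mu> ! s \<le> \<mu> ! r" "\<And>r. r < length \<alpha> \<Longrightarrow> 0 \<le> \<mu> ! r"
    and "\<And>r. r < length \<alpha> \<Longrightarrow> \<mu> ! r \<le> \<alpha> ! r"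
  shows "skew_schur N \<alpha> \<mu> = jt N (length \<alpha>) (\<lambda>i. \<alpha> ! i - int i) (\<lambda>i. \<mu> ! i - int i)"
  using assms
proof (induction N arbitrary: \<alpha>)
  case 0
  have "inj_on (\<lambda>i. \<alpha> ! i - int i) {..<length \<alpha>}"
  proof (rule linorder_inj_onI)
    fix i j :: nat assume "i < j" "j \<in> {..<length \<alpha>}"
    then show "\<alpha> ! i - int i \<noteq> \<alpha> ! j - int j"
      using "0.prems"(1)[of i j] by simp
  qed auto
  then show ?case
    using 0 by (simp add: skew_schur_0 jt_0)
next
  case (Suc N)
  note \<alpha> = Suc.prems(1) and \<mu> = Suc.prems(2,3) and le = Suc.prems(4)
  define m where "m = length \<alpha>"
  define L where "L i = \<alpha> ! i - int i" for i
  define M where "M i = \<mu> ! i - int i" for i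
  \<comment> \<open>A lower bound for all \<open>M i\<close>, since the entries of \<mu> are
    nonnegative and \<open>i < m\<close>.\<close>
  define lo where "lo = - int m"
  define I where "I = {c \<in> Pi\<^sub>E {..<m} (\<lambda>i. {lo..L i}). \<forall>i. Suc i < m \<longrightarrow> L (Suc i) < c i}"
  define I' where "I' = {c \<in> I. \<forall>i<m. M i \<le> c i}"
  have lo: "lo \<le> M i" if "i < m" for i
    using \<mu>(2)[of i] that by (simp add: lo_def M_def m_def)
  have M: "M j \<le> M i" if "i \<le> j" "j < m" for i j
    using \<mu>(1)[of i j] that by (simp add: M_def m_def)
  have "jt (Suc N) m L M = (\<Sum>c\<in>I. X N ^ nat (\<Sum>i<m. L i - c i) * jt N m c M)"
    unfolding I_def
  proof (rule jt_Suc[OF lo])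
    fix i assume "Suc i < m"
    then show "L (Suc i) < L i"
      using \<alpha>[of i "Suc i"] by (simp add: L_def m_def)
  qed
  \<comment> \<open>The remaining tuples are decreasing, because
    \<open>c (Suc i) \<le> L (Suc i) < c i\<close>. One that falls below \<open>M\<close> at some
    position therefore has a vanishing determinant.\<close>
  also have "\<dots> = (\<Sum>c\<in>I'. X N ^ nat (\<Sum>i<m. L i - c i) * jt N m c M)"
  proof (rule sum.mono_neutral_right)
    show "finite I"
      unfolding I_def by (rule finite_subset[of _ "Pi\<^sub>E {..<m} (\<lambda>i. {lo..L i})"]) (auto intro: finite_PiE)
    show "I' \<subseteq> I"
      by (auto simp: I'_def)
    show "\<forall>c\<in>I - I'. X N ^ nat (\<Sum>i<m. L i - c i) * jt N m c M = 0"
    proof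
      fix c assume c: "c \<in> I - I'"
      then obtain k where k: "k < m" "c k < M k"
        by (auto simp: I'_def)
      have step: "c (Suc i) \<le> c i" if "Suc i < m" for i
      proof -
        have "c (Suc i) \<in> {lo..L (Suc i)}"
          using c that unfolding I_def by blast
        moreover have "L (Suc i) < c i"
          using c that by (auto simp: I_def)
        ultimately show ?thesis
          by simp
      qed
      have "c j \<le> c i" if "i \<le> j" "j < m" for i j
        using that
      proof (induction j rule: dec_induct)
        case (step j)
        then show ?case
          using \<open>\<And>i. Suc i < m \<Longrightarrow> c (Suc i) \<le> c i\<close>[of j] by simp
      qed simp
      then have "jt N m c M = 0"
        using M k by (rule jt_eq_0)
      then show "X N ^ nat (\<Sum>i<m. L i - c i) * jt N m c M = 0"
        by simp
    qed
  qed
  \<comment> \<open>The strict inequality \<open>L (Suc i) < c i\<close> turns into the weak one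
    \<open>\<alpha> ! Suc i \<le> \<kappa> ! i\<close>, since the subtracted positions differ by
    1.\<close>
  also have "\<dots> = (\<Sum>\<kappa>\<in>interlacing \<alpha> \<mu>. X N ^ nat (\<Sum>r<m. \<alpha> ! r - \<kappa> ! r) * skew_schur N \<kappa> \<mu>)"
  proof (rule sum.reindex_bij_witness[of _ "\<lambda>\<kappa>. restrict (\<lambda>i. \<kappa> ! i - int i) {..<m}"
        "\<lambda>c. map (\<lambda>i. c i + int i) [0..<m]"])
    fix c assume c: "c \<in> I'"
    have c_le: "lo \<le> c i \<and> c i \<le> L i" "M i \<le> c i" if "i < m" for i
      using c that by (auto simp: I'_def I_def dest: PiE_mem)
    have c_gt: "L (Suc i) < c i" if "Suc i < m" for i
      using c that by (auto simp: I'_def I_def)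
    have c_undef: "c i = undefined" if "\<not> i < m" for i
      using c that unfolding I'_def I_def by (metis (mono_tags, lifting) PiE_arb lessThan_iff mem_Collect_eq)
    show "restrict (\<lambda>i. map (\<lambda>i. c i + int i) [0..<m] ! i - int i) {..<m} = c"
      by (rule ext) (simp add: restrict_def c_undef)
    show mem: "map (\<lambda>i. c i + int i) [0..<m] \<in> interlacing \<alpha> \<mu>"
      unfolding interlacing_def
    proof (intro CollectI conjI allI impI)
      fix r assume r: "r < length \<alpha>"
      show "\<mu> ! r \<le> map (\<lambda>i. c i + int i) [0..<m] ! r" "map (\<lambda>i. c i + int i) [0..<m] ! r \<le> \<alpha> ! r"
        using c_le[of r] r by (simp_all add: m_def L_def M_def)
    next
      fix r assume "Suc r < length \<alpha>"
      then show "\<alpha> ! Suc r \<le> map (\<lambda>i. c i + int i) [0..<m] ! r"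
        using c_gt[of r] by (simp add: m_def L_def)
    qed (simp add: m_def)
    let ?\<kappa> = "map (\<lambda>i. c i + int i) [0..<m]"
    have step: "?\<kappa> ! Suc i \<le> ?\<kappa> ! i" if "Suc i < m" for i
      using c_le(1)[OF that] c_gt[OF that] that by simp
    have "skew_schur N ?\<kappa> \<mu> = jt N (length ?\<kappa>) (\<lambda>i. ?\<kappa> ! i - int i) (\<lambda>i. \<mu> ! i - int i)"
    proof (rule Suc.IH)
      fix r s assume "r \<le> s" "s < length ?\<kappa>"
      then show "?\<kappa> ! s \<le> ?\<kappa> ! r"
      proof (induction s rule: dec_induct)
        case (step s)
        then show ?case
          using \<open>\<And>i. Suc i < m \<Longrightarrow> ?\<kappa> ! Suc i \<le> ?\<kappa> ! i\<close>[of s] by simp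
      qed simp
    next
      fix r s assume "r \<le> s" "s < length ?\<kappa>"
      then show "\<mu> ! s \<le> \<mu> ! r"
        using \<mu>(1) by (simp add: m_def)
    next
      fix r assume "r < length ?\<kappa>"
      then show "0 \<le> \<mu> ! r" "\<mu> ! r \<le> ?\<kappa> ! r"
        using \<mu>(2) c_le(2)[of r] by (simp_all add: m_def M_def)
    qed
    also have "\<dots> = jt N m c M"
      unfolding length_map length_upt diff_zero by (rule jt_cong) (simp_all add: M_def)
    finally show "X N ^ nat (\<Sum>r<m. \<alpha> ! r - ?\<kappa> ! r) * skew_schur N ?\<kappa> \<mu> =
        X N ^ nat (\<Sum>i<m. L i - c i) * jt N m c M"
      by (simp add: L_def algebra_simps)
  next
    fix \<kappa> assume \<kappa>: "\<kappa> \<in> interlacing \<alpha> \<mu>"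
    then show "map (\<lambda>i. restrict (\<lambda>i. \<kappa> ! i - int i) {..<m} i + int i) [0..<m] = \<kappa>"
      by (intro nth_equalityI) (auto simp: interlacing_def m_def)
    have "\<mu> ! i \<le> \<kappa> ! i \<and> \<kappa> ! i \<le> \<alpha> ! i" if "i < m" for i
      using \<kappa> that by (simp add: interlacing_def m_def)
    then have "M i \<le> \<kappa> ! i - int i \<and> \<kappa> ! i - int i \<le> L i" if "i < m" for i
      using that by (simp add: M_def L_def)
    then have *: "M i \<le> \<kappa> ! i - int i \<and> lo \<le> \<kappa> ! i - int i \<and> \<kappa> ! i - int i \<le> L i" if "i < m" for i
      using that lo[of i] by force
    have "L (Suc i) < \<kappa> ! i - int i" if "Suc i < m" for i
      using \<kappa> that by (auto simp: interlacing_def m_def L_def)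
    then show "restrict (\<lambda>i. \<kappa> ! i - int i) {..<m} \<in> I'"
      using * by (simp add: I'_def I_def)
  qed
  also have "\<dots> = skew_schur (Suc N) \<alpha> \<mu>"
    using skew_schur_Suc[OF \<alpha> \<mu> le, of N] by (simp add: m_def)
  finally show ?case
    by (simp add: m_def L_def[abs_def] M_def[abs_def])
qed


section \<open>Symmetry and variables of the Jacobi-Trudi determinants\<close>

lemma map_exp_prod_geom:
  assumes \<phi>: "\<And>a b. \<phi> (a + b) = \<phi> a + \<phi> b" "\<phi> 0 = 0" and "finite A"
  shows "map_exp \<phi> (fps_nth (\<Prod>j\<in>A. geom (f j)) d) = fps_nth (\<Prod>j\<in>A. geom (map_exp \<phi> (f j))) d"
  using \<open>finite A\<close>
proof (induction A arbitrary: d rule: finite_induct)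
  case empty
  then show ?case
    by (simp add: map_exp_one \<phi>)
next
  case (insert j A)
  then show ?case
    by (simp add: fps_mult_nth map_exp_sum map_exp_times[of \<phi>, OF \<phi>(1)] map_exp_power[of \<phi>, OF \<phi>])
qed

text \<open>Homogeneity in the degree. It later separates \<open>x_i\<close> from the inverted
  variables in a product of root factors with common \<open>i\<close>.\<close>

lemma prod_geom_scale:
  assumes "finite A"
  shows "fps_nth (\<Prod>j\<in>A. geom (c * f j)) d = c ^ d * fps_nth (\<Prod>j\<in>A. geom (f j)) d"
  using assms
proof (induction A arbitrary: d rule: finite_induct)
  case (insert j A)
  have *: "c ^ i * f j ^ i * (c ^ (d - i) * g) = c ^ d * (f j ^ i * g)" if "i \<le> d" for i g
    using that power_add[of c i "d - i"] by (simp add: mult_ac)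
  show ?case
    using insert by (simp add: fps_mult_nth sum_distrib_left power_mult_distrib)
      (intro sum.cong refl *, simp)
qed simp

lemma laurent_in_prod_geom:
  assumes "finite A" "\<And>j. j \<in> A \<Longrightarrow> f j \<in> laurent_in n"
  shows "fps_nth (\<Prod>j\<in>A. geom (f j)) d \<in> laurent_in n"
  using assms
proof (induction A arbitrary: d rule: finite_induct)
  case empty
  then show ?case
    by (simp add: laurent_in_def)
next
  case (insert j A)
  then show ?case
    by (auto simp: fps_mult_nth intro!: laurent_in_sum laurent_in_times laurent_in_power)
qed

lemma symmetric_hsym: "symmetric N (hsym N a)"
  unfolding symmetric_iff
proof (intro allI impI)
  fix w assume w: "w permutes {..<N}"
  have inv: "inv w permutes {..<N}"
    by (rule permutes_inv[OF w])
  have X: "perm_act w (X j) = X (w j)" for j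
  proof -
    have "map_key (inv w) (single j 1) = single (w j) (1 :: int)"
      using map_key_single[OF permutes_inj[OF inv], of "w j" "1 :: int"] permutes_inverses(2)[OF w] by simp
    then show ?thesis
      by (simp add: X_def perm_act_eq_map_exp)
  qed
  have "perm_act w (fps_nth (\<Prod>j<N. geom (X j)) d) = fps_nth (\<Prod>j<N. geom (X j)) d" for d
  proof -
    have "perm_act w (fps_nth (\<Prod>j<N. geom (X j)) d) = fps_nth (\<Prod>j<N. geom (X (w j))) d"
      unfolding X[symmetric] unfolding perm_act_eq_map_exp
      by (rule map_exp_prod_geom) (simp_all add: map_key_plus permutes_inj[OF inv])
    also have "(\<Prod>j<N. geom (X (w j))) = (\<Prod>j<N. geom (X j))"
      using prod.permute[OF w, of "\<lambda>j. geom (X j)"] by (simp add: o_def)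
    finally show ?thesis .
  qed
  then show "perm_act w (hsym N a) = hsym N a"
    by (simp add: hsym_def perm_act_eq_map_exp)
qed

lemma laurent_in_of_int: "of_int c \<in> laurent_in n"
  by (simp add: laurent_in_single flip: single_of_int)

lemma X_in: "j < n \<Longrightarrow> X j \<in> laurent_in n"
  by (simp add: X_def laurent_in_single)

lemma X_quot_in: "i < n \<Longrightarrow> j < n \<Longrightarrow> X_quot i j \<in> laurent_in n"
  using keys_diff[of "single i (1 :: int)" "single j 1"] unfolding X_quot_def
  by (intro laurent_in_single) auto

lemma hsym_in: "hsym N a \<in> laurent_in N"
proof (cases "a < 0")
  case True
  then show ?thesis
    by (simp add: hsym_def laurent_in_def)
next
  case False
  then show ?thesis
    by (auto simp: hsym_def intro!: laurent_in_prod_geom X_in)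
qed

lemma symmetric_of_int_times: "symmetric n f \<Longrightarrow> symmetric n (of_int c * f)"
  by (simp add: symmetric_def lookup_of_int_times)

lemma symmetric_jt: "symmetric N (jt N m L M)"
  unfolding jt_def
  by (intro symmetric_sum symmetric_of_int_times symmetric_prod symmetric_hsym)

lemma jt_in: "jt N m L M \<in> laurent_in N"
  unfolding jt_def
  by (intro laurent_in_sum laurent_in_times laurent_in_of_int laurent_in_prod hsym_in)

section \<open>Coefficients of the root products\<close>

lemma root_factor_eq_geom: "root_factor (i, j) = geom (X_quot i j)"
proof -
  let ?c = "fps_const (X_quot i j) * fps_X"
  have "(1 - ?c) * geom (X_quot i j) = 1"
  proof (rule fps_ext)
    fix d
    have "fps_nth (?c * geom (X_quot i j)) d = (if d = 0 then 0 else X_quot i j ^ d)"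
      by (cases d) (simp_all add: mult.assoc)
    then show "fps_nth ((1 - ?c) * geom (X_quot i j)) d = fps_nth 1 d"
      by (simp add: left_diff_distrib)
  qed
  then have "root_factor (i, j) * ((1 - ?c) * geom (X_quot i j)) = root_factor (i, j)"
    by simp
  moreover have "root_factor (i, j) * ((1 - ?c) * geom (X_quot i j)) =
      ((1 - ?c) * root_factor (i, j)) * geom (X_quot i j)"
    by (simp only: mult_ac)
  ultimately show ?thesis
    by (simp add: root_factor_inverse)
qed

lemma Roots_subset: "Roots \<eta> \<subseteq> {..<sum_list \<eta>} \<times> {..<sum_list \<eta>}"
  by (auto simp: Roots_def)

lemma finite_Roots: "finite (Roots \<eta>)"
  by (rule finite_subset[OF Roots_subset]) auto

lemma B_in: "fps_nth (B \<eta>) d \<in> laurent_in (sum_list \<eta>)"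
proof -
  have "B \<eta> = (\<Prod>p\<in>Roots \<eta>. geom (X_quot (fst p) (snd p)))"
    unfolding B_def by (intro prod.cong refl) (auto simp: root_factor_eq_geom)
  then show ?thesis
    using Roots_subset[of \<eta>] by (auto intro!: laurent_in_prod_geom finite_Roots X_quot_in)
qed

text \<open>The first cut gives all pairs that leave the first block. A later cut gives nothing new
  for \<open>i < k\<close>, and for \<open>i \<ge> k\<close> it is a cut of the remaining blocks
  moved by \<open>k\<close>.\<close>

lemma Roots_Cons:
  "Roots (k # \<eta>) = {..<k} \<times> {k..<k + sum_list \<eta>} \<union> (\<lambda>(i, j). (i + k, j + k)) ` Roots \<eta>"
proof (intro equalityI subsetI)
  fix p assume "p \<in> Roots (k # \<eta>)"
  then obtain i j r where p: "p = (i, j)" "r \<in> {1..Suc (length \<eta>)}" "i < sum_list (take r (k # \<eta>))"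
    "sum_list (take r (k # \<eta>)) \<le> j" "j < k + sum_list \<eta>"
    by (auto simp: Roots_def)
  then obtain r' where r: "r = Suc r'"
    by (cases r) auto
  show "p \<in> {..<k} \<times> {k..<k + sum_list \<eta>} \<union> (\<lambda>(i, j). (i + k, j + k)) ` Roots \<eta>"
  proof (cases "i < k")
    case False
    then have "r' \<noteq> 0"
      using p r by (cases r') auto
    then have "(i - k, j - k) \<in> Roots \<eta>"
      using p False r by (auto simp: Roots_def intro!: bexI[of _ r'])
    then show ?thesis
      using p False r by (auto intro!: image_eqI[of _ _ "(i - k, j - k)"])
  qed (use p r in auto)
next
  fix p assume "p \<in> {..<k} \<times> {k..<k + sum_list \<eta>} \<union> (\<lambda>(i, j). (i + k, j + k)) ` Roots \<eta>"
  then show "p \<in> Roots (k # \<eta>)"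
  proof
    assume "p \<in> {..<k} \<times> {k..<k + sum_list \<eta>}"
    then show ?thesis
      by (auto simp: Roots_def intro!: bexI[of _ 1])
  next
    assume "p \<in> (\<lambda>(i, j). (i + k, j + k)) ` Roots \<eta>"
    then obtain i j r where "p = (i + k, j + k)" "r \<in> {1..length \<eta>}" "i < sum_list (take r \<eta>)"
      "sum_list (take r \<eta>) \<le> j" "j < sum_list \<eta>"
      by (auto simp: Roots_def)
    then show ?thesis
      by (auto simp: Roots_def intro!: bexI[of _ "Suc r"])
  qed
qed

section \<open>Exponents split into the first block and a shifted remainder\<close>

definition shift :: "nat \<Rightarrow> expo \<Rightarrow> expo" where
  "shift k e = (\<Sum>i\<in>keys e. single (i + k) (lookup e i))"

lemma lookup_shift: "lookup (shift k e) i = (if i < k then 0 else lookup e (i - k))"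
proof (cases "i < k")
  case True
  then show ?thesis
    by (auto simp: shift_def lookup_sum lookup_single when_def intro!: sum.neutral)
next
  case False
  then have "(x + k = i) = (x = i - k)" for x
    by auto
  with False show ?thesis
    by (simp add: shift_def lookup_sum lookup_single when_def in_keys_iff)
qed

lemma shift_add: "shift k (a + b) = shift k a + shift k b"
  by (rule poly_mapping_eqI) (simp add: lookup_shift lookup_add)

lemma shift_zero [simp]: "shift k 0 = 0"
  by (simp add: shift_def)

lemma shift_uminus: "shift k (- a) = - shift k a"
  by (rule poly_mapping_eqI) (simp add: lookup_shift)

lemma shift_single [simp]: "shift k (single i c) = single (i + k) c"
  by (rule poly_mapping_eqI) (auto simp: lookup_shift lookup_single when_def)

lemma inj_shift: "inj (shift k)"
proof (rule injI, rule poly_mapping_eqI)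
  fix a b i assume "shift k a = shift k b"
  then show "lookup a i = lookup b i"
    using lookup_shift[of k a "i + k"] lookup_shift[of k b "i + k"] by simp
qed

lemma map_exp_map_exp: "map_exp \<phi> (map_exp \<psi> f) = map_exp (\<lambda>e. \<phi> (\<psi> e)) f"
  unfolding map_exp_def[of \<psi>] map_exp_def[of "\<lambda>e. \<phi> (\<psi> e)"] by (simp add: map_exp_sum)

text \<open>The bound \<open>D\<close> of the tuple entries is kept apart from \<open>d\<close>, so
  that the induction can lower the degree without changing the index set. Tuples of too large degree
  are removed by the condition.\<close>

lemma fps_nth_prod_mult:
  fixes f :: "nat \<Rightarrow> 'a::comm_ring_1 fps"
  assumes "d \<le> D"
  shows "fps_nth ((\<Prod>i<k. f i) * g) d = (\<Sum>a\<in>Pi\<^sub>E {..<k} (\<lambda>_. {..D}).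
    if sum a {..<k} \<le> d then (\<Prod>i<k. fps_nth (f i) (a i)) * fps_nth g (d - sum a {..<k}) else 0)"
  using assms
proof (induction k arbitrary: d)
  case (Suc k)
  define F where "F d a = (if sum a {..<k} \<le> d then
      (\<Prod>i<k. fps_nth (f i) (a i)) * fps_nth g (d - sum a {..<k}) else 0)" for d a
  define G where "G a = (if sum a {..<Suc k} \<le> d then
      (\<Prod>i<Suc k. fps_nth (f i) (a i)) * fps_nth g (d - sum a {..<Suc k}) else 0)" for a
  have "fps_nth ((\<Prod>i<Suc k. f i) * g) d = fps_nth (f k * ((\<Prod>i<k. f i) * g)) d"
    by (simp add: mult_ac)
  also have "\<dots> = (\<Sum>x\<le>d. fps_nth (f k) x * (\<Sum>a\<in>Pi\<^sub>E {..<k} (\<lambda>_. {..D}). F (d - x) a))"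
    using Suc.prems unfolding fps_mult_nth[of "f k"] atLeast0AtMost
    by (intro sum.cong refl) (subst Suc.IH, simp_all add: F_def)
  also have "\<dots> = (\<Sum>x\<le>D. if x \<le> d then fps_nth (f k) x * (\<Sum>a\<in>Pi\<^sub>E {..<k} (\<lambda>_. {..D}). F (d - x) a) else 0)"
    using Suc.prems by (intro sum.mono_neutral_cong_left) auto
  also have "\<dots> = (\<Sum>x\<le>D. \<Sum>a\<in>Pi\<^sub>E {..<k} (\<lambda>_. {..D}). G (a(k := x)))"
  proof (rule sum.cong[OF refl])
    fix x assume "x \<in> {..D}"
    have upd: "sum (a(k := x)) {..<k} = sum a {..<k}"
      "(\<Prod>i<k. fps_nth (f i) ((a(k := x)) i)) = (\<Prod>i<k. fps_nth (f i) (a i))" for a :: "nat \<Rightarrow> nat"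
      by (auto intro!: sum.cong prod.cong)
    have "G (a(k := x)) = (if x \<le> d then fps_nth (f k) x * F (d - x) a else 0)" for a
      unfolding G_def F_def lessThan_Suc by (auto simp: upd diff_diff_eq mult_ac add_ac simp del: fun_upd_apply)
        (auto simp: mult_ac add_ac upd)
    then show "(if x \<le> d then fps_nth (f k) x * (\<Sum>a\<in>Pi\<^sub>E {..<k} (\<lambda>_. {..D}). F (d - x) a) else 0) =
        (\<Sum>a\<in>Pi\<^sub>E {..<k} (\<lambda>_. {..D}). G (a(k := x)))"
      by (simp add: sum_distrib_left)
  qed
  also have "\<dots> = (\<Sum>p\<in>{..D} \<times> Pi\<^sub>E {..<k} (\<lambda>_. {..D}). G ((snd p)(k := fst p)))"
    by (simp add: sum.cartesian_product case_prod_beta)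
  also have "\<dots> = (\<Sum>a\<in>(\<lambda>(x, a). a(k := x)) ` ({..D} \<times> Pi\<^sub>E {..<k} (\<lambda>_. {..D})). G a)"
    using inj_combinator[of k "{..<k}" "\<lambda>_. {..D}"]
    by (subst sum.reindex) (auto simp: case_prod_beta)
  also have "(\<lambda>(x, a). a(k := x)) ` ({..D} \<times> Pi\<^sub>E {..<k} (\<lambda>_. {..D})) = Pi\<^sub>E {..<Suc k} (\<lambda>_. {..D})"
    unfolding lessThan_Suc by (rule PiE_insert_eq[symmetric])
  finally show ?case
    by (simp only: G_def)
qed simp

definition vec :: "nat \<Rightarrow> (nat \<Rightarrow> int) \<Rightarrow> expo" where
  "vec k a = (\<Sum>i<k. single i (a i))"

lemma lookup_vec: "lookup (vec k a) i = (if i < k then a i else 0)"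
  by (auto simp: vec_def lookup_sum lookup_single when_def)

lemma X_power: "X i ^ d = single (single i (int d)) 1"
  by (induction d) (simp_all add: X_def mult_single flip: single_add)

lemma prod_single: "(\<Prod>i\<in>A. single (e i) (1::int)) = single (\<Sum>i\<in>A. e i) 1" for e :: "'a \<Rightarrow> expo"
  by (induction A rule: infinite_finite_induct) (simp_all add: mult_single)

lemma B_Cons:
  "B (k # \<eta>) = (\<Prod>i<k. \<Prod>j<sum_list \<eta>. geom (X_quot i (j + k))) *
    Abs_fps (\<lambda>d. map_exp (shift k) (fps_nth (B \<eta>) d))"
proof -
  have disj: "({..<k} \<times> {k..<k + sum_list \<eta>}) \<inter> (\<lambda>(i, j). (i + k, j + k)) ` Roots \<eta> = {}"
    by auto
  have inj: "inj_on (\<lambda>(i, j). (i + k, j + k)) (Roots \<eta>)"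
    by (auto simp: inj_on_def)
  have "B (k # \<eta>) = (\<Prod>p\<in>{..<k} \<times> {k..<k + sum_list \<eta>}. root_factor p) *
      (\<Prod>p\<in>Roots \<eta>. root_factor (case p of (i, j) \<Rightarrow> (i + k, j + k)))"
    unfolding B_def Roots_Cons using disj by (simp add: prod.union_disjoint finite_Roots prod.reindex[OF inj] o_def)
  also have "(\<Prod>p\<in>{..<k} \<times> {k..<k + sum_list \<eta>}. root_factor p) =
      (\<Prod>i<k. \<Prod>j\<in>{k..<k + sum_list \<eta>}. geom (X_quot i j))"
    unfolding root_factor_eq_geom[symmetric] prod.cartesian_product by simp
  also have "\<dots> = (\<Prod>i<k. \<Prod>j<sum_list \<eta>. geom (X_quot i (j + k)))"
  proof (rule prod.cong[OF refl])
    fix i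
    show "(\<Prod>j\<in>{k..<k + sum_list \<eta>}. geom (X_quot i j)) = (\<Prod>j<sum_list \<eta>. geom (X_quot i (j + k)))"
      by (rule prod.reindex_bij_witness[of _ "\<lambda>j. j + k" "\<lambda>j. j - k"]) auto
  qed
  also have "(\<Prod>p\<in>Roots \<eta>. root_factor (case p of (i, j) \<Rightarrow> (i + k, j + k))) =
      Abs_fps (\<lambda>d. map_exp (shift k) (fps_nth (B \<eta>) d))"
  proof (rule fps_ext)
    fix d
    have "B \<eta> = (\<Prod>p\<in>Roots \<eta>. geom (X_quot (fst p) (snd p)))"
      unfolding B_def by (intro prod.cong refl) (auto simp: root_factor_eq_geom)
    then have "map_exp (shift k) (fps_nth (B \<eta>) d) =
        fps_nth (\<Prod>p\<in>Roots \<eta>. geom (map_exp (shift k) (X_quot (fst p) (snd p)))) d"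
      by (simp add: map_exp_prod_geom shift_add finite_Roots)
    also have "(\<Prod>p\<in>Roots \<eta>. geom (map_exp (shift k) (X_quot (fst p) (snd p)))) =
        (\<Prod>p\<in>Roots \<eta>. root_factor (case p of (i, j) \<Rightarrow> (i + k, j + k)))"
    proof (intro prod.cong refl, clarify)
      fix i j
      have "shift k (single i 1 - single j 1) = single (i + k) 1 - single (j + k) 1"
        using shift_add[of k "single i 1" "- single j 1"] by (simp add: shift_uminus)
      then show "geom (map_exp (shift k) (X_quot (fst (i, j)) (snd (i, j)))) = root_factor (i + k, j + k)"
        by (simp add: root_factor_eq_geom X_quot_def)
    qed
    finally show "fps_nth (\<Prod>p\<in>Roots \<eta>. root_factor (case p of (i, j) \<Rightarrow> (i + k, j + k))) d =
        fps_nth (Abs_fps (\<lambda>d. map_exp (shift k) (fps_nth (B \<eta>) d))) d"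
      by simp
  qed
  finally show ?thesis .
qed

text \<open>For \<open>i < k\<close> the variable \<open>x_i\<close> occurs only in the factors of
  its own row of roots, where each power of \<open>q\<close> brings exactly one power of
  \<open>x_i\<close>. The exponents \<open>A i\<close> therefore prescribe the degree taken from
  each row and single out one tuple; a row of degree \<open>a\<close> contributes \<open>h_a\<close>
  in the inverted variables of the remaining blocks.\<close>

lemma lookup_B_Cons:
  "lookup (fps_nth (B (k # \<eta>)) d) (vec k A + shift k b) =
    (if (\<forall>i<k. 0 \<le> A i) \<and> (\<Sum>i<k. A i) \<le> int d
     then lookup (map_exp uminus (\<Prod>i<k. hsym (sum_list \<eta>) (A i)) *
       fps_nth (B \<eta>) (d - nat (\<Sum>i<k. A i))) b
     else 0)"
proof -
  define N where "N = sum_list \<eta>"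
  define P where "P = Pi\<^sub>E {..<k} (\<lambda>_. {..d})"
  define g where "g a = map_exp uminus (\<Prod>i<k. hsym N (int (a i))) * fps_nth (B \<eta>) (d - sum a {..<k})"
    for a :: "nat \<Rightarrow> nat"
  have factor: "fps_nth (\<Prod>j<N. geom (X_quot i (j + k))) a =
      single (single i (int a)) 1 * map_exp (shift k) (map_exp uminus (hsym N (int a)))" for i a
  proof -
    \<comment> \<open>The inverse of the variable \<open>x_(j+k)\<close>, so that a root quotient
      becomes a product with the common factor \<open>X i\<close>.\<close>
    define Y where "Y j = map_exp (\<lambda>e. shift k (- e)) (X j)" for j
    have "X_quot i (j + k) = X i * Y j" for j
      by (simp add: X_quot_def X_def Y_def shift_uminus mult_single)
    then have "fps_nth (\<Prod>j<N. geom (X_quot i (j + k))) a = X i ^ a * fps_nth (\<Prod>j<N. geom (Y j)) a"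
      by (simp add: prod_geom_scale)
    also have "fps_nth (\<Prod>j<N. geom (Y j)) a = map_exp (\<lambda>e. shift k (- e)) (hsym N (int a))"
      by (simp add: Y_def hsym_def map_exp_prod_geom shift_uminus shift_add)
    finally show ?thesis
      by (simp add: X_power map_exp_map_exp)
  qed
  have "fps_nth (B (k # \<eta>)) d = (\<Sum>a\<in>P. if sum a {..<k} \<le> d then
      (\<Prod>i<k. fps_nth (\<Prod>j<N. geom (X_quot i (j + k))) (a i)) *
      map_exp (shift k) (fps_nth (B \<eta>) (d - sum a {..<k})) else 0)"
    unfolding B_Cons N_def P_def by (subst fps_nth_prod_mult[OF order_refl]) (simp cong: if_cong)
  also have "\<dots> = (\<Sum>a\<in>P. if sum a {..<k} \<le> d then
      single (vec k (\<lambda>i. int (a i))) 1 * map_exp (shift k) (g a) else 0)"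
    by (intro sum.cong refl) (simp add: factor prod.distrib prod_single vec_def g_def
        map_exp_prod[of uminus] map_exp_prod[of "shift k"] map_exp_times[of "shift k"] shift_add mult.assoc)
  finally have "lookup (fps_nth (B (k # \<eta>)) d) (vec k A + shift k b) = (\<Sum>a\<in>P. if sum a {..<k} \<le> d then
      lookup (map_exp (shift k) (g a)) (vec k A + shift k b - vec k (\<lambda>i. int (a i))) else 0)"
    by (simp add: lookup_sum lookup_single_times if_distrib[of "\<lambda>f. lookup f _"] cong: if_cong)
  also have "\<dots> = (\<Sum>a\<in>P. if sum a {..<k} \<le> d \<and> (\<forall>i<k. A i = int (a i)) then lookup (g a) b else 0)"
  proof (intro sum.cong refl)
    fix a
    have "lookup (map_exp (shift k) (g a)) (vec k A + shift k b - vec k (\<lambda>i. int (a i))) =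
        (if \<forall>i<k. A i = int (a i) then lookup (g a) b else 0)"
    proof (cases "\<forall>i<k. A i = int (a i)")
      case True
      then have "vec k A = vec k (\<lambda>i. int (a i))"
        by (simp add: vec_def)
      then show ?thesis
        using True by (simp add: lookup_map_exp inj_shift)
    next
      case False
      then obtain i where i: "i < k" "A i \<noteq> int (a i)"
        by blast
      \<comment> \<open>Where \<open>A\<close> and \<open>a\<close> disagree a nonzero exponent at
        position \<open>i < k\<close> is left over, and no shifted exponent has one.\<close>
      have "vec k A + shift k b - vec k (\<lambda>i. int (a i)) \<notin> range (shift k)"
      proof
        assume "vec k A + shift k b - vec k (\<lambda>i. int (a i)) \<in> range (shift k)"
        then obtain e where "vec k A + shift k b - vec k (\<lambda>i. int (a i)) = shift k e"
          by blast
        then have "lookup (vec k A + shift k b - vec k (\<lambda>i. int (a i))) i = lookup (shift k e) i"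
          by simp
        then show False
          using i by (simp add: lookup_add lookup_minus lookup_vec lookup_shift)
      qed
      with False show ?thesis
        by (auto simp: lookup_map_exp_notin)
    qed
    then show "(if sum a {..<k} \<le> d then
        lookup (map_exp (shift k) (g a)) (vec k A + shift k b - vec k (\<lambda>i. int (a i))) else 0) =
        (if sum a {..<k} \<le> d \<and> (\<forall>i<k. A i = int (a i)) then lookup (g a) b else 0)"
      by (simp only: if_if_eq_conj)
  qed
  also have "\<dots> = (if (\<forall>i<k. 0 \<le> A i) \<and> (\<Sum>i<k. A i) \<le> int d then
      lookup (map_exp uminus (\<Prod>i<k. hsym N (A i)) * fps_nth (B \<eta>) (d - nat (\<Sum>i<k. A i))) b else 0)"
  proof (cases "(\<forall>i<k. 0 \<le> A i) \<and> (\<Sum>i<k. A i) \<le> int d")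
    case True
    define a where "a = restrict (\<lambda>i. nat (A i)) {..<k}"
    have a: "A i = int (a i)" if "i < k" for i
      using True that by (simp add: a_def)
    then have sum: "(\<Sum>i<k. A i) = int (sum a {..<k})"
      by simp
    have le: "sum a {..<k} \<le> d"
      using conjunct2[OF True] unfolding sum by (simp only: of_nat_le_iff)
    have "a i \<le> d" if "i < k" for i
    proof -
      have "a i \<le> sum a {..<k}"
        using that by (intro member_le_sum) auto
      with le show ?thesis
        by linarith
    qed
    then have "a \<in> P"
      unfolding P_def by (intro PiE_I) (auto simp: a_def)
    have only: "a' = a" if "a' \<in> P" "\<forall>i<k. A i = int (a' i)" for a'
    proof (rule PiE_ext)
      show "a' \<in> Pi\<^sub>E {..<k} (\<lambda>_. {..d})" "a \<in> Pi\<^sub>E {..<k} (\<lambda>_. {..d})"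
        using that \<open>a \<in> P\<close> by (simp_all add: P_def)
      show "a' i = a i" if "i \<in> {..<k}" for i
        using a[of i] \<open>\<forall>i<k. A i = int (a' i)\<close> that by simp
    qed
    have "(\<Sum>a'\<in>P. if sum a' {..<k} \<le> d \<and> (\<forall>i<k. A i = int (a' i)) then lookup (g a') b else 0) =
        (\<Sum>a'\<in>P. if a' = a then lookup (g a) b else 0)"
    proof (intro sum.cong refl)
      fix a' assume "a' \<in> P"
      then show "(if sum a' {..<k} \<le> d \<and> (\<forall>i<k. A i = int (a' i)) then lookup (g a') b else 0) =
          (if a' = a then lookup (g a) b else 0)"
        using only[of a'] a le by auto
    qed
    also have "\<dots> = lookup (g a) b"
      using \<open>a \<in> P\<close> by (simp add: P_def finite_PiE)
    also have "g a = map_exp uminus (\<Prod>i<k. hsym N (A i)) * fps_nth (B \<eta>) (d - nat (\<Sum>i<k. A i))"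
      unfolding g_def sum nat_int using a by simp
    finally show ?thesis
      using True by simp
  next
    case False
    have "\<not> (sum a {..<k} \<le> d \<and> (\<forall>i<k. A i = int (a i)))" for a :: "nat \<Rightarrow> nat"
    proof
      assume *: "sum a {..<k} \<le> d \<and> (\<forall>i<k. A i = int (a i))"
      then have "(\<Sum>i<k. A i) = int (sum a {..<k})"
        by simp
      then have "(\<Sum>i<k. A i) \<le> int d"
        using * by (simp only: of_nat_le_iff)
      moreover have "\<forall>i<k. 0 \<le> A i"
        using * by simp
      ultimately show False
        using False by blast
    qed
    then show ?thesis
      unfolding if_not_P[OF False] by (intro sum.neutral ballI if_not_P)
  qed
  finally show ?thesis
    by (simp only: N_def)
qed


section \<open>Coset representatives\<close>

definition shift_perm :: "nat \<Rightarrow> (nat \<Rightarrow> nat) \<Rightarrow> nat \<Rightarrow> nat" where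
  "shift_perm m v i = (if i < m then i else v (i - m) + m)"

lemma shift_perm_simps [simp]:
  "i < m \<Longrightarrow> shift_perm m v i = i" "shift_perm m v (m + j) = m + v j"
  by (simp_all add: shift_perm_def)

lemma shift_perm_permutes:
  assumes v: "v permutes {..<N}"
  shows "shift_perm m v permutes {m..<m + N}"
proof (rule bij_imp_permutes)
  have "bij_betw (\<lambda>i. i - m) {m..<m + N} {..<N}"
    by (rule bij_betwI[of _ _ _ "\<lambda>j. j + m"]) auto
  moreover have "bij_betw (\<lambda>j. j + m) {..<N} {m..<m + N}"
    by (rule bij_betwI[of _ _ _ "\<lambda>i. i - m"]) auto
  ultimately have "bij_betw ((\<lambda>j. j + m) \<circ> (v \<circ> (\<lambda>i. i - m))) {m..<m + N} {m..<m + N}"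
    using permutes_imp_bij[OF v] by (blast intro: bij_betw_trans)
  then show "bij_betw (shift_perm m v) {m..<m + N} {m..<m + N}"
    by (rule bij_betw_cong[THEN iffD1, rotated]) (simp add: shift_perm_def)
  fix x assume "x \<notin> {m..<m + N}"
  then show "shift_perm m v x = x"
    using permutes_not_in[OF v, of "x - m"] by (auto simp: shift_perm_def)
qed

text \<open>Building \<open>v\<close> from transpositions builds the shifted permutation from the
  shifted transpositions.\<close>

lemma sign_shift_perm:
  assumes "v permutes {..<N}"
  shows "sign (shift_perm m v) = sign v"
  using assms finite_lessThan[of N]
proof (induction v rule: permutes_induct)
  case id
  have "shift_perm m id = id"
    by (auto simp: shift_perm_def)
  then show ?case
    by (simp only: sign_id)
next
  case (swap a b p)
  have eq: "shift_perm m (transpose a b \<circ> p) = transpose (a + m) (b + m) \<circ> shift_perm m p"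
    by (auto simp: shift_perm_def transpose_def fun_eq_iff)
  have 1: "permutation (shift_perm m p)"
    using shift_perm_permutes[OF swap.hyps(4)] permutation_permutes by blast
  have 2: "permutation p"
    using swap.hyps(4) permutation_permutes by blast
  show ?case
    unfolding eq sign_compose[OF permutation_swap_id 1] sign_compose[OF permutation_swap_id 2]
    using swap by (simp add: sign_swap_id)
qed

lemma obtain_shift_perm:
  assumes x: "x permutes {m..<m + N}"
  obtains v where "v permutes {..<N}" "x = shift_perm m v"
proof
  define v where "v i = (if i < N then x (i + m) - m else i)" for i
  have "bij_betw (\<lambda>i. i - m) {m..<m + N} {..<N}"
    by (rule bij_betwI[of _ _ _ "\<lambda>j. j + m"]) auto
  moreover have "bij_betw (\<lambda>j. j + m) {..<N} {m..<m + N}"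
    by (rule bij_betwI[of _ _ _ "\<lambda>i. i - m"]) auto
  ultimately have "bij_betw ((\<lambda>i. i - m) \<circ> (x \<circ> (\<lambda>j. j + m))) {..<N} {..<N}"
    using permutes_imp_bij[OF x] by (blast intro: bij_betw_trans)
  then have "bij_betw v {..<N} {..<N}"
    by (rule bij_betw_cong[THEN iffD1, rotated]) (simp add: v_def)
  then show "v permutes {..<N}"
    by (rule bij_imp_permutes) (simp add: v_def)
  show "x = shift_perm m v"
  proof
    fix i
    consider "i < m" | "i \<in> {m..<m + N}" | "m + N \<le> i"
      by fastforce
    then show "x i = shift_perm m v i"
    proof cases
      case 2
      then have "x i \<in> {m..<m + N}"
        using permutes_in_image[OF x] by simp
      with 2 show ?thesis
        by (auto simp: shift_perm_def v_def)
    qed (use permutes_not_in[OF x, of i] in \<open>auto simp: shift_perm_def v_def\<close>)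
  qed
qed

text \<open>For uniqueness, let \<open>w y = w' y'\<close> with block-preserving \<open>y\<close>
  and \<open>y'\<close>. Then \<open>x = y' y^(-1)\<close> preserves the blocks and
  \<open>w = w' x\<close>, so monotonicity of \<open>w\<close> and \<open>w'\<close> on each block
  makes \<open>x\<close> increasing and hence the identity. For existence, the values of
  \<open>p\<close> are sorted on each block separately.\<close>

lemma bij_betw_coset_decomposition:
  "bij_betw (\<lambda>(w, u, v). w \<circ> (shift_perm m v \<circ> u))
    (min_coset_reps (m + N) m \<times> {u. u permutes {..<m}} \<times> {v. v permutes {..<N}})
    {p. p permutes {..<m + N}}"
  unfolding bij_betw_def
proof
  have perm: "shift_perm m v \<circ> u permutes {..<m + N}" if "u permutes {..<m}" "v permutes {..<N}" for u v
  proof (rule permutes_compose)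
    show "u permutes {..<m + N}"
      by (rule permutes_subset[OF that(1)]) auto
    show "shift_perm m v permutes {..<m + N}"
      by (rule permutes_subset[OF shift_perm_permutes[OF that(2)]]) auto
  qed
  have low: "(shift_perm m v \<circ> u) i < m \<longleftrightarrow> i < m" if "u permutes {..<m}" for u v i
    using permutes_in_image[OF that, of i] by (auto simp: shift_perm_def)
  show "inj_on (\<lambda>(w, u, v). w \<circ> (shift_perm m v \<circ> u))
    (min_coset_reps (m + N) m \<times> {u. u permutes {..<m}} \<times> {v. v permutes {..<N}})"
  proof (rule inj_onI)
    fix a b
    assume ab: "a \<in> min_coset_reps (m + N) m \<times> {u. u permutes {..<m}} \<times> {v. v permutes {..<N}}"
        "b \<in> min_coset_reps (m + N) m \<times> {u. u permutes {..<m}} \<times> {v. v permutes {..<N}}"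
      and ab_eq: "(case a of (w, u, v) \<Rightarrow> w \<circ> (shift_perm m v \<circ> u)) =
        (case b of (w, u, v) \<Rightarrow> w \<circ> (shift_perm m v \<circ> u))"
    obtain w u v w' u' v' where a: "a = (w, u, v)" and b: "b = (w', u', v')"
      by (cases a, cases b) auto
    have w: "w \<in> min_coset_reps (m + N) m" "w' \<in> min_coset_reps (m + N) m"
      and u: "u permutes {..<m}" "u' permutes {..<m}"
      and v: "v permutes {..<N}" "v' permutes {..<N}"
      and eq: "w \<circ> (shift_perm m v \<circ> u) = w' \<circ> (shift_perm m v' \<circ> u')"
      using ab ab_eq by (simp_all add: a b)
    define y where "y = shift_perm m v \<circ> u"
    define y' where "y' = shift_perm m v' \<circ> u'"
    define x where "x = y' \<circ> inv y"
    have y: "y permutes {..<m + N}" "y' permutes {..<m + N}"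
      using perm u v by (simp_all add: y_def y'_def)
    have x: "x permutes {..<m + N}"
      unfolding x_def using y by (intro permutes_compose permutes_inv)
    have wx: "w i = w' (x i)" for i
      using fun_cong[OF eq, of "inv y i"] permutes_inverses(1)[OF y(1), of i]
      by (simp add: x_def y_def y'_def)
    have lowx: "x i < m \<longleftrightarrow> i < m" for i
      using low[OF u(1), of v "inv y i"] low[OF u(2), of v' "inv y i"] permutes_inverses(1)[OF y(1), of i]
      by (simp add: x_def y_def y'_def)
    have mono: "a < b \<Longrightarrow> b < m \<Longrightarrow> z a < z b" "m \<le> a \<Longrightarrow> a < b \<Longrightarrow> b < m + N \<Longrightarrow> z a < z b"
      if "z \<in> min_coset_reps (m + N) m" for z a b
      using that by (simp_all add: min_coset_reps_def strict_mono_on_def)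
    have "strict_mono_on {..<m + N} x"
    proof (rule strict_mono_onI)
      fix i j assume ij: "i \<in> {..<m + N}" "j \<in> {..<m + N}" "i < j"
      have xN: "x i < m + N" "x j < m + N"
        using ij permutes_in_image[OF x] by auto
      consider "j < m" | "i < m" "m \<le> j" | "m \<le> i"
        using ij by linarith
      then show "x i < x j"
      proof cases
        case 1
        then have less: "w' (x i) < w' (x j)"
          using mono(1)[of w i j] w ij by (simp flip: wx)
        show ?thesis
        proof (rule ccontr)
          assume "\<not> x i < x j"
          then consider "x i = x j" | "x j < x i"
            by linarith
          then show False
            using mono(1)[of w' "x j" "x i"] w less lowx[of i] 1 ij by cases auto
        qed
      next
        case 2
        then show ?thesis
          using lowx[of i] lowx[of j] by auto
      next
        case 3
        then have less: "w' (x i) < w' (x j)"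
          using mono(2)[of w i j] w ij by (simp flip: wx)
        show ?thesis
        proof (rule ccontr)
          assume "\<not> x i < x j"
          then consider "x i = x j" | "x j < x i"
            by linarith
          then show False
            using mono(2)[of w' "x j" "x i"] w less lowx[of j] xN 3 ij by cases auto
        qed
      qed
    qed
    with x have "x = id"
      by (rule strict_mono_on_permutes_id)
    then have "w = w'"
      using wx by auto
    moreover have yy: "y i = y' i" for i
      using fun_cong[OF \<open>x = id\<close>, of "y i"] permutes_inverses(2)[OF y(1), of i] by (simp add: x_def)
    have "u i = u' i" for i
    proof (cases "i < m")
      case True
      then have "u i < m" "u' i < m"
        using permutes_in_image[OF u(1), of i] permutes_in_image[OF u(2), of i] by auto
      then show ?thesis
        using yy[of i] by (simp add: y_def y'_def)
    next
      case False
      then show ?thesis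
        using permutes_not_in[OF u(1), of i] permutes_not_in[OF u(2), of i] by simp
    qed
    moreover have "v j = v' j" for j
      using yy[of "m + j"] permutes_not_in[OF u(1), of "m + j"] permutes_not_in[OF u(2), of "m + j"]
      by (simp add: y_def y'_def)
    ultimately show "a = b"
      by (auto simp: a b)
  qed
  show "(\<lambda>(w, u, v). w \<circ> (shift_perm m v \<circ> u)) `
    (min_coset_reps (m + N) m \<times> {u. u permutes {..<m}} \<times> {v. v permutes {..<N}}) =
    {p. p permutes {..<m + N}}"
  proof (intro equalityI subsetI)
    fix p assume "p \<in> (\<lambda>(w, u, v). w \<circ> (shift_perm m v \<circ> u)) `
      (min_coset_reps (m + N) m \<times> {u. u permutes {..<m}} \<times> {v. v permutes {..<N}})"
    then show "p \<in> {p. p permutes {..<m + N}}"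
      using perm by (auto simp: min_coset_reps_def intro: permutes_compose)
  next
    fix p assume "p \<in> {p. p permutes {..<m + N}}"
    then have p: "p permutes {..<m + N}"
      by simp
    obtain u where u: "u permutes {..<m}" "strict_mono_on {..<m} (p \<circ> u)"
      using obtain_sorting_permutation[of "{..<m}" p] permutes_inj_on[OF p] by auto
    obtain y where y: "y permutes {m..<m + N}" "strict_mono_on {m..<m + N} (p \<circ> y)"
      using obtain_sorting_permutation[of "{m..<m + N}" p] permutes_inj_on[OF p] by auto
    \<comment> \<open>The permutations that sort \<open>p\<close> are the inverses of the wanted
      block factors, hence the inverse of \<open>y\<close> here and of \<open>u\<close> in the
      witness.\<close>
    obtain v where v: "v permutes {..<N}" "inv y = shift_perm m v"
      using obtain_shift_perm[OF permutes_inv[OF y(1)]] by blast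
    define w where "w = p \<circ> (u \<circ> y)"
    have "u permutes {..<m + N}"
      by (rule permutes_subset[OF u(1)]) auto
    moreover have "y permutes {..<m + N}"
      by (rule permutes_subset[OF y(1)]) auto
    ultimately have "w permutes {..<m + N}"
      unfolding w_def using p by (intro permutes_compose)
    moreover have "strict_mono_on {..<m} w"
      using u(2) permutes_not_in[OF y(1)] by (auto simp: strict_mono_on_def w_def)
    moreover have "strict_mono_on {m..<m + N} w"
    proof -
      have "u (y i) = y i" if "i \<in> {m..<m + N}" for i
        using permutes_in_image[OF y(1), of i] that by (intro permutes_not_in[OF u(1)]) auto
      then show ?thesis
        using y(2) by (auto simp: strict_mono_on_def w_def)
    qed
    ultimately have "w \<in> min_coset_reps (m + N) m"
      by (simp add: min_coset_reps_def)
    moreover have "w \<circ> (shift_perm m v \<circ> inv u) = p"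
    proof
      fix i
      show "(w \<circ> (shift_perm m v \<circ> inv u)) i = p i"
        unfolding v(2)[symmetric] w_def
        by (simp add: permutes_inverses(1)[OF y(1)] permutes_inverses(1)[OF u(1)])
    qed
    ultimately show "p \<in> (\<lambda>(w, u, v). w \<circ> (shift_perm m v \<circ> u)) `
      (min_coset_reps (m + N) m \<times> {u. u permutes {..<m}} \<times> {v. v permutes {..<N}})"
      using v(1) permutes_inv[OF u(1)] by (auto intro!: image_eqI[of _ _ "(w, inv u, v)"])
  qed
qed

text \<open>The sum over permutations of the first block is placed innermost since it is evaluated
  first, as a determinant for fixed \<open>w\<close> and \<open>v\<close>.\<close>

lemma sum_permutations_coset:
  "(\<Sum>p | p permutes {..<m + N}. sign p * f p) =
    (\<Sum>w\<in>min_coset_reps (m + N) m. sign w * (\<Sum>v | v permutes {..<N}. sign v *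
      (\<Sum>u | u permutes {..<m}. sign u * f (w \<circ> (shift_perm m v \<circ> u)))))"
proof -
  have "(\<Sum>p | p permutes {..<m + N}. sign p * f p) =
      (\<Sum>(w, u, v)\<in>min_coset_reps (m + N) m \<times> {u. u permutes {..<m}} \<times> {v. v permutes {..<N}}.
      sign (w \<circ> (shift_perm m v \<circ> u)) * f (w \<circ> (shift_perm m v \<circ> u)))"
    using sum.reindex_bij_betw[OF bij_betw_coset_decomposition, of "\<lambda>p. sign p * f p" m N]
    by (simp add: case_prod_beta)
  also have "\<dots> = (\<Sum>(w, u, v)\<in>min_coset_reps (m + N) m \<times> {u. u permutes {..<m}} \<times> {v. v permutes {..<N}}.
      sign w * (sign v * (sign u * f (w \<circ> (shift_perm m v \<circ> u)))))"
  proof (intro sum.cong refl, clarify)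
    fix w u v assume a: "w \<in> min_coset_reps (m + N) m" "u permutes {..<m}" "v permutes {..<N}"
    have *: "permutation w" "permutation (shift_perm m v)" "permutation u"
      using a shift_perm_permutes[OF a(3), of m] unfolding min_coset_reps_def permutation_permutes by blast+
    have "sign (w \<circ> (shift_perm m v \<circ> u)) = sign w * (sign v * sign u)"
      unfolding sign_compose[OF *(1) permutation_compose[OF *(2,3)]] sign_compose[OF *(2,3)]
        sign_shift_perm[OF a(3)] ..
    then show "sign (w \<circ> (shift_perm m v \<circ> u)) * f (w \<circ> (shift_perm m v \<circ> u)) =
        sign w * (sign v * (sign u * f (w \<circ> (shift_perm m v \<circ> u))))"
      by simp
  qed
  also have "\<dots> = (\<Sum>w\<in>min_coset_reps (m + N) m. sign w * (\<Sum>u | u permutes {..<m}. \<Sum>v | v permutes {..<N}.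
      sign v * (sign u * f (w \<circ> (shift_perm m v \<circ> u)))))"
    by (simp add: sum.cartesian_product sum_distrib_left case_prod_beta)
  also have "\<dots> = (\<Sum>w\<in>min_coset_reps (m + N) m. sign w * (\<Sum>v | v permutes {..<N}. sign v *
      (\<Sum>u | u permutes {..<m}. sign u * f (w \<circ> (shift_perm m v \<circ> u)))))"
    unfolding sum_distrib_left by (subst sum.swap) simp
  finally show ?thesis .
qed


section \<open>The recurrence\<close>

lemma monomial_rho_times: "monomial (rho n) * (monomial \<gamma> * f) = single (shifted n \<gamma>) 1 * f"
  by (simp add: monomial_def mult_single flip: mult.assoc)

text \<open>Both \<open>weyl_pi\<close> and the Schur expansion are gone here: multiplying by
  \<open>vdm\<close> undoes the division in \<open>weyl_pi\<close>. The formula is applied to the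
  full data and again to the data without the first block.\<close>

lemma K_nth:
  assumes "dominant (sum_list \<eta>) \<mu>" "length \<gamma> = sum_list \<eta>"
  shows "fps_nth (K \<mu> \<gamma> \<eta>) d =
    lookup (J (sum_list \<eta>) (single (shifted (sum_list \<eta>) \<gamma>) 1 * fps_nth (B \<eta>) d)) (shifted (sum_list \<eta>) \<mu>)"
proof -
  have "monomial \<gamma> * fps_nth (B \<eta>) d \<in> laurent_in (sum_list \<eta>)"
    unfolding monomial_def
    by (intro laurent_in_times laurent_in_single keys_nth_subset B_in assms)
  then show ?thesis
    using assms by (simp add: K_def H_def schur_coeff_weyl_pi monomial_rho_times)
qed

lemma LR_eq:
  assumes "dominant N \<sigma>" "length \<beta> = N" "symmetric N (skew_schur N \<alpha> \<nu>)"
    "skew_schur N \<alpha> \<nu> \<in> laurent_in N"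
  shows "LR N \<sigma> \<alpha> \<nu> \<beta> =
    lookup (skew_schur N \<alpha> \<nu> * J N (single (shifted N \<beta>) 1)) (shifted N \<sigma>)"
proof -
  have eq: "vdm N * (skew_schur N \<alpha> \<nu> * schur N \<beta>) = J N (skew_schur N \<alpha> \<nu> * single (shifted N \<beta>) 1)"
    using vdm_schur[OF assms(2)] by (simp add: J_symmetric_times[OF assms(3)] mult.left_commute)
  have "skew_schur N \<alpha> \<nu> * single (shifted N \<beta>) 1 \<in> laurent_in N"
    by (intro laurent_in_times laurent_in_single keys_shifted assms)
  then have "LR N \<sigma> \<alpha> \<nu> \<beta> = lookup (vdm N * (skew_schur N \<alpha> \<nu> * schur N \<beta>)) (shifted N \<sigma>)"
    unfolding LR_def by (intro schur_coeff_eq assms) (simp_all add: eq laurent_in_J alternating_J)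
  then show ?thesis
    by (simp add: eq J_symmetric_times[OF assms(3)])
qed

lemma skew_schur_nonneg:
  assumes "lookup (skew_schur N \<alpha> \<nu>) e \<noteq> 0"
  shows "0 \<le> lookup e i"
proof -
  have "skew_schur N \<alpha> \<nu> = (\<Sum>T\<in>skew_ssyt N \<alpha> \<nu>. single (\<Sum>p\<in>skew_cells \<alpha> \<nu>. single (T p) 1) 1)"
    by (simp only: skew_schur_def X_def prod_single)
  then have "(\<Sum>T\<in>skew_ssyt N \<alpha> \<nu>.
      lookup (single (\<Sum>p\<in>skew_cells \<alpha> \<nu>. single (T p) (1::int)) (1::int)) e) \<noteq> 0"
    using assms by (simp only: lookup_sum not_False_eq_True)
  then obtain T where
    "lookup (single (\<Sum>p\<in>skew_cells \<alpha> \<nu>. single (T p) (1::int)) (1::int)) e \<noteq> 0"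
    by (rule sum.not_neutral_contains_not_neutral)
  then have "e = (\<Sum>p\<in>skew_cells \<alpha> \<nu>. single (T p) 1)"
    by (auto simp: lookup_single when_def split: if_splits)
  then show ?thesis
    by (auto simp: lookup_sum lookup_single when_def intro!: sum_nonneg)
qed

text \<open>A skew Schur polynomial has no negative exponents, and neither has the monomial of
  \<beta> + \<rho>. So a contributing \<sigma> + \<rho> has nonnegative entries, and its last entry
  is that of \<sigma>.\<close>

lemma LR_nonzero_imp_partition:
  assumes LR: "LR N \<sigma> \<alpha> \<nu> \<beta> \<noteq> 0" and \<sigma>: "dominant N \<sigma>" and \<beta>: "length \<beta> = N"
    and s: "symmetric N (skew_schur N \<alpha> \<nu>)" "skew_schur N \<alpha> \<nu> \<in> laurent_in N"
    and nonneg: "\<And>i. 0 \<le> lookup (shifted N \<beta>) i"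
  shows "is_partition N \<sigma>"
proof -
  have "lookup (J N (single (shifted N \<beta>) 1 * skew_schur N \<alpha> \<nu>)) (shifted N \<sigma>) \<noteq> 0"
    using LR unfolding LR_eq[OF \<sigma> \<beta> s] J_symmetric_times[OF s(1), symmetric]
    by (simp add: mult.commute)
  then obtain w where w: "w permutes {..<N}"
    "lookup (skew_schur N \<alpha> \<nu>) (map_key w (shifted N \<sigma>) - shifted N \<beta>) \<noteq> 0"
    unfolding lookup_J lookup_single_times
    by (rule sum.not_neutral_contains_not_neutral) auto
  have \<sigma>_shifted: "0 \<le> lookup (shifted N \<sigma>) i" for i
  proof -
    have "0 \<le> lookup (map_key w (shifted N \<sigma>) - shifted N \<beta>) (inv w i)"
      by (rule skew_schur_nonneg[OF w(2)])
    then have "lookup (shifted N \<beta>) (inv w i) \<le> lookup (shifted N \<sigma>) i"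
      using permutes_inverses(1)[OF w(1), of i]
      by (simp only: lookup_minus lookup_map_key[OF permutes_inj[OF w(1)]])
    then show ?thesis
      using nonneg[of "inv w i"] by linarith
  qed
  have len: "length \<sigma> = N"
    using \<sigma> by (simp add: dominant_def)
  have "0 \<le> \<sigma> ! i" if i: "i < N" for i
  proof -
    \<comment> \<open>\<rho> ends in 0, and the last entry of a dominant weight bounds all others
      from below.\<close>
    have "0 \<le> \<sigma> ! (N - 1)"
      using \<sigma>_shifted[of "N - 1"] i len by (simp add: lookup_shifted of_nat_diff)
    also have "\<sigma> ! (N - 1) \<le> \<sigma> ! i"
    proof (cases "i = N - 1")
      case False
      then show ?thesis
        using \<sigma> i by (simp add: dominant_def sorted_wrt_iff_nth_less)
    qed simp
    finally show ?thesis .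
  qed
  then show ?thesis
    using \<sigma> len by (auto simp: is_partition_def in_set_conv_nth)
qed

lemma symmetric_bar:
  assumes "symmetric n s"
  shows "symmetric n (map_exp uminus s)"
proof -
  have "lookup (map_exp uminus s) k = lookup s (- k)" for k
    using lookup_map_exp[of uminus s "- k"] by simp
  moreover have "map_key w (- k) = - map_key w k" if "w permutes {..<n}" for w and k :: expo
    by (rule poly_mapping_eqI) (simp add: lookup_map_key permutes_inj[OF that])
  ultimately show ?thesis
    using assms by (metis symmetric_def)
qed

text \<open>Once the symmetric factor is outside \<open>J\<close>, the remaining alternating
  polynomial has the values of \<open>K\<close> as its coefficients at \<sigma> + \<rho>.
  Adjointness transfers the factor, without inversion of variables, to the numerator of \<beta>,
  where the coefficients are the Littlewood-Richardson numbers.\<close>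

lemma sum_LR_K:
  assumes \<gamma>: "length \<gamma> = sum_list \<eta>" and \<beta>: "length \<beta> = sum_list \<eta>"
    and s: "symmetric (sum_list \<eta>) (skew_schur (sum_list \<eta>) \<alpha> \<nu>)"
      "skew_schur (sum_list \<eta>) \<alpha> \<nu> \<in> laurent_in (sum_list \<eta>)"
    and nonneg: "\<And>i. 0 \<le> lookup (shifted (sum_list \<eta>) \<beta>) i"
  shows "lookup (J (sum_list \<eta>) (single (shifted (sum_list \<eta>) \<gamma>) 1 *
      (map_exp uminus (skew_schur (sum_list \<eta>) \<alpha> \<nu>) * fps_nth (B \<eta>) d))) (shifted (sum_list \<eta>) \<beta>) =
    (\<Sum>\<sigma> | is_partition (sum_list \<eta>) \<sigma> \<and> LR (sum_list \<eta>) \<sigma> \<alpha> \<nu> \<beta> \<noteq> 0.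
      LR (sum_list \<eta>) \<sigma> \<alpha> \<nu> \<beta> * fps_nth (K \<sigma> \<gamma> \<eta>) d)"
proof -
  define N where "N = sum_list \<eta>"
  define S where "S = skew_schur N \<alpha> \<nu>"
  define F where "F = J N (single (shifted N \<gamma>) 1 * fps_nth (B \<eta>) d)"
  note s = s[folded N_def]
  have F: "F \<in> laurent_in N" "alternating N F"
    unfolding F_def N_def
    by (intro laurent_in_J laurent_in_times laurent_in_single keys_shifted B_in \<gamma>, rule alternating_J)
  have K: "fps_nth (K \<sigma> \<gamma> \<eta>) d = lookup F (shifted N \<sigma>)" if "dominant N \<sigma>" for \<sigma>
    using K_nth[of \<eta> \<sigma> \<gamma> d] that \<gamma> by (simp add: F_def N_def)
  define P where "P \<sigma> = LR N \<sigma> \<alpha> \<nu> \<beta>" for \<sigma>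
  have P: "P \<sigma> = lookup (S * J N (single (shifted N \<beta>) 1)) (shifted N \<sigma>)" if "dominant N \<sigma>" for \<sigma>
    using LR_eq[OF that _ s] \<beta> by (simp add: P_def S_def N_def)
  have "J N (single (shifted N \<gamma>) 1 * (map_exp uminus S * fps_nth (B \<eta>) d)) = map_exp uminus S * F"
    unfolding F_def S_def mult.left_commute[of "single (shifted N \<gamma>) 1"]
    by (rule J_symmetric_times[OF symmetric_bar[OF s(1)]])
  moreover have "lookup (map_exp uminus S * F) (shifted N \<beta>) =
      (\<Sum>k | k \<in> keys F \<and> decreasing N k. lookup F k * lookup (S * J N (single (shifted N \<beta>) 1)) k)"
    unfolding S_def by (rule lookup_bar_times_alternating[OF F s(1)])
  moreover have "\<dots> = (\<Sum>\<sigma> | dominant N \<sigma> \<and> shifted N \<sigma> \<in> keys F.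
      lookup F (shifted N \<sigma>) * lookup (S * J N (single (shifted N \<beta>) 1)) (shifted N \<sigma>))"
  proof (rule sum.reindex_bij_betw[symmetric], rule bij_betwI')
    show "shifted N \<sigma> = shifted N \<tau> \<longleftrightarrow> \<sigma> = \<tau>"
      if "\<sigma> \<in> {\<sigma>. dominant N \<sigma> \<and> shifted N \<sigma> \<in> keys F}" "\<tau> \<in> {\<sigma>. dominant N \<sigma> \<and> shifted N \<sigma> \<in> keys F}"
      for \<sigma> \<tau>
      using that shifted_inj[of \<sigma> N \<tau>] by (auto simp: dominant_def)
    show "shifted N \<sigma> \<in> {k. k \<in> keys F \<and> decreasing N k}"
      if "\<sigma> \<in> {\<sigma>. dominant N \<sigma> \<and> shifted N \<sigma> \<in> keys F}" for \<sigma>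
      using that decreasing_shifted by auto
    show "\<exists>\<sigma>\<in>{\<sigma>. dominant N \<sigma> \<and> shifted N \<sigma> \<in> keys F}. k = shifted N \<sigma>"
      if k: "k \<in> {k. k \<in> keys F \<and> decreasing N k}" for k
    proof -
      obtain \<sigma> where "dominant N \<sigma>" "k = shifted N \<sigma>"
        using k obtain_shifted_dominant[of N k] by auto
      with k show ?thesis
        by auto
    qed
  qed
  moreover have "\<dots> = (\<Sum>\<sigma> | dominant N \<sigma> \<and> shifted N \<sigma> \<in> keys F. P \<sigma> * fps_nth (K \<sigma> \<gamma> \<eta>) d)"
    by (intro sum.cong refl) (simp add: P K)
  \<comment> \<open>The support of one factor is exchanged for the support of the other; outside the
    intersection one of the two factors is 0.\<close>
  moreover have "\<dots> = (\<Sum>\<sigma> | is_partition N \<sigma> \<and> P \<sigma> \<noteq> 0. P \<sigma> * fps_nth (K \<sigma> \<gamma> \<eta>) d)"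
  proof (rule sum.mono_neutral_cong)
    show "finite {\<sigma>. dominant N \<sigma> \<and> shifted N \<sigma> \<in> keys F}"
    proof (rule finite_imageD)
      show "finite (shifted N ` {\<sigma>. dominant N \<sigma> \<and> shifted N \<sigma> \<in> keys F})"
        by (rule finite_subset[of _ "keys F"]) auto
      show "inj_on (shifted N) {\<sigma>. dominant N \<sigma> \<and> shifted N \<sigma> \<in> keys F}"
        by (auto intro!: inj_onI shifted_inj simp: dominant_def)
    qed
    show "finite {\<sigma>. is_partition N \<sigma> \<and> P \<sigma> \<noteq> 0}"
      unfolding P_def by (rule finite_LR)
    show "P \<sigma> * fps_nth (K \<sigma> \<gamma> \<eta>) d = 0"
      if "\<sigma> \<in> {\<sigma>. dominant N \<sigma> \<and> shifted N \<sigma> \<in> keys F} - {\<sigma>. is_partition N \<sigma> \<and> P \<sigma> \<noteq> 0}" for \<sigma>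
      using that LR_nonzero_imp_partition[OF _ _ _ s nonneg[folded N_def], of \<sigma>] \<beta>
      by (auto simp: P_def N_def)
    show "P \<sigma> * fps_nth (K \<sigma> \<gamma> \<eta>) d = 0"
      if "\<sigma> \<in> {\<sigma>. is_partition N \<sigma> \<and> P \<sigma> \<noteq> 0} - {\<sigma>. dominant N \<sigma> \<and> shifted N \<sigma> \<in> keys F}" for \<sigma>
      using that K[of \<sigma>] by (auto simp: is_partition_def in_keys_iff)
  qed simp
  ultimately show ?thesis
    by (simp only: N_def S_def P_def)
qed

lemma nth_dot_inv:
  assumes "length \<mu> = n" "w permutes {..<n}" "i < n"
  shows "dot_inv w \<mu> ! i = lookup (shifted n \<mu>) (w i) - (int n - 1 - int i)"
proof -
  have "w i < n"
    using assms permutes_in_image[OF assms(2), of i] by simp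
  then show ?thesis
    using assms unfolding lookup_shifted[OF assms(1)]
    by (simp add: dot_inv_def Let_def permute_list_nth rho_def of_nat_diff)
qed

lemma length_dot_inv: "length (dot_inv w \<mu>) = length \<mu>"
  by (simp add: dot_inv_def Let_def rho_def permute_list_def)

lemma weakly_decreasing_nthI:
  fixes xs :: "int list"
  assumes "\<And>i. Suc i < m \<Longrightarrow> xs ! Suc i \<le> xs ! i" "r \<le> s" "s < m"
  shows "xs ! s \<le> xs ! r"
  using assms(2,3)
proof (induction s rule: dec_induct)
  case (step s)
  then show ?case
    using assms(1)[of s] by simp
qed simp

text \<open>The recurrence at \<open>q^d\<close>, where multiplication by a power of
  \<open>q\<close> lowers the degree in \<open>K\<close>. The guard \<open>\<le> int d\<close>
  ensures that the subtraction of natural numbers is not truncated.\<close>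

lemma K_Cons_nth:
  fixes \<gamma> \<mu> :: "int list" and \<eta> :: "nat list"
  assumes \<gamma>: "length \<gamma> = m + sum_list \<eta>" and R: "is_partition m (take m \<gamma>)"
    and \<mu>: "is_partition (m + sum_list \<eta>) \<mu>"
  defines "\<alpha> \<equiv> \<lambda>w. take m (dot_inv w \<mu>)" and "\<beta> \<equiv> \<lambda>w. drop m (dot_inv w \<mu>)"
  shows "fps_nth (K \<mu> \<gamma> (m # \<eta>)) d = (\<Sum>w\<in>min_coset_reps (m + sum_list \<eta>) m. sign w *
    (if contains (\<alpha> w) (take m \<gamma>) \<and> sum_list (\<alpha> w) - sum_list (take m \<gamma>) \<le> int d
     then \<Sum>\<sigma> | is_partition (sum_list \<eta>) \<sigma> \<and> LR (sum_list \<eta>) \<sigma> (\<alpha> w) (take m \<gamma>) (\<beta> w) \<noteq> 0.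
       LR (sum_list \<eta>) \<sigma> (\<alpha> w) (take m \<gamma>) (\<beta> w) *
       fps_nth (K \<sigma> (drop m \<gamma>) \<eta>) (d - nat (sum_list (\<alpha> w) - sum_list (take m \<gamma>)))
     else 0))"
proof -
  define N where "N = sum_list \<eta>"
  define n where "n = m + N"
  define \<nu> where "\<nu> = take m \<gamma>"
  have len: "length \<mu> = n" "length \<gamma> = n" "length \<nu> = m" "length (drop m \<gamma>) = N"
    using \<gamma> \<mu> by (simp_all add: is_partition_def dominant_def n_def N_def \<nu>_def)
  have \<nu>_nth: "\<nu> ! i = \<gamma> ! i" if "i < m" for i
    using that by (simp add: \<nu>_def)
  have \<nu>_nonneg: "0 \<le> \<nu> ! i" if "i < m" for i
    using R that len(3) by (auto simp: is_partition_def simp flip: \<nu>_def)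
  have \<nu>_dec: "\<nu> ! s \<le> \<nu> ! r" if "r \<le> s" "s < m" for r s
  proof (cases "r = s")
    case False
    then show ?thesis
      using R that len(3) by (auto simp: is_partition_def dominant_def sorted_wrt_iff_nth_less simp flip: \<nu>_def)
  qed simp
  have \<mu>_dec: "decreasing n (shifted n \<mu>)"
    using \<mu> by (intro decreasing_shifted) (simp add: is_partition_def n_def N_def)
  have \<mu>_nonneg: "0 \<le> lookup (shifted n \<mu>) i" for i
  proof (cases "i < n")
    case True
    then have "0 \<le> \<mu> ! i"
      using \<mu> len(1) by (simp add: is_partition_def)
    with True show ?thesis
      by (simp add: lookup_shifted[OF len(1)])
  qed (simp add: lookup_shifted[OF len(1)])
  have "fps_nth (K \<mu> \<gamma> (m # \<eta>)) d = (\<Sum>p | p permutes {..<m + N}. sign p *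
      lookup (fps_nth (B (m # \<eta>)) d) (map_key p (shifted n \<mu>) - shifted n \<gamma>))"
    using K_nth[of "m # \<eta>" \<mu> \<gamma> d] \<mu> \<gamma>
    by (simp add: lookup_J lookup_single_times is_partition_def n_def N_def)
  also have "\<dots> = (\<Sum>w\<in>min_coset_reps n m. sign w * (\<Sum>v | v permutes {..<N}. sign v *
      (\<Sum>u | u permutes {..<m}. sign u * lookup (fps_nth (B (m # \<eta>)) d)
        (map_key (w \<circ> (shift_perm m v \<circ> u)) (shifted n \<mu>) - shifted n \<gamma>))))"
    unfolding n_def by (rule sum_permutations_coset)
  also have "\<dots> = (\<Sum>w\<in>min_coset_reps n m. sign w *
    (if contains (\<alpha> w) \<nu> \<and> sum_list (\<alpha> w) - sum_list \<nu> \<le> int d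
     then \<Sum>\<sigma> | is_partition N \<sigma> \<and> LR N \<sigma> (\<alpha> w) \<nu> (\<beta> w) \<noteq> 0. LR N \<sigma> (\<alpha> w) \<nu> (\<beta> w) *
       fps_nth (K \<sigma> (drop m \<gamma>) \<eta>) (d - nat (sum_list (\<alpha> w) - sum_list \<nu>))
     else 0))"
  proof (intro sum.cong refl arg_cong2[of _ _ _ _ "(*)"])
    fix w assume w_mem: "w \<in> min_coset_reps n m"
    then have w: "w permutes {..<n}"
      by (simp add: min_coset_reps_def)
    define L where "L i = lookup (shifted n \<mu>) (w i)" for i
    have len_\<alpha>: "length (\<alpha> w) = m" "length (\<beta> w) = N"
      by (simp_all add: \<alpha>_def \<beta>_def length_dot_inv len n_def)
    have \<alpha>_nth: "\<alpha> w ! i = L i - (int n - 1 - int i)" if "i < m" for i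
      using that nth_dot_inv[OF len(1) w, of i] by (simp add: \<alpha>_def L_def n_def)
    \<comment> \<open>The last \<open>N\<close> entries of \<rho> for \<open>n\<close> variables are
      \<rho> for \<open>N\<close> variables, so \<beta> + \<rho> consists of entries of \<mu> +
      \<rho>.\<close>
    have \<beta>_nth: "\<beta> w ! j = L (m + j) - (int N - 1 - int j)" if "j < N" for j
      using that nth_dot_inv[OF len(1) w, of "m + j"] len by (simp add: \<beta>_def L_def n_def length_dot_inv)
    have \<alpha>_step: "\<alpha> w ! Suc i \<le> \<alpha> w ! i" if i: "Suc i < m" for i
    proof -
      have "w i < w (Suc i)" "w (Suc i) < n"
        using w_mem i permutes_in_image[OF w, of "Suc i"]
        by (auto simp: min_coset_reps_def strict_mono_on_def n_def)
      then have "L (Suc i) < L i"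
        using \<mu>_dec by (simp add: L_def decreasing_def)
      then show ?thesis
        using i by (simp add: \<alpha>_nth)
    qed
    have \<alpha>_dec: "\<alpha> w ! s \<le> \<alpha> w ! r" if "r \<le> s" "s < m" for r s
      using \<alpha>_step that by (rule weakly_decreasing_nthI)
    have \<beta>_shifted: "lookup (shifted N (\<beta> w)) j = (if j < N then L (m + j) else 0)" for j
      by (simp add: lookup_shifted len_\<alpha> \<beta>_nth)
    define Lj where "Lj i = \<alpha> w ! i - int i" for i
    define Mj where "Mj i = \<nu> ! i - int i" for i
    define D where "D = sum_list (\<alpha> w) - sum_list \<nu>"
    define b where "b v = map_key v (shifted N (\<beta> w)) - shifted N (drop m \<gamma>)" for v
    \<comment> \<open>The exponent splits along the blocks. On the first block the constant part
      \<open>n - 1\<close> of \<rho> cancels, and the position left over provides the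
      \<open>- i\<close> of the Jacobi-Trudi indices.\<close>
    have expo: "map_key (w \<circ> (shift_perm m v \<circ> u)) (shifted n \<mu>) - shifted n \<gamma> =
        vec m (\<lambda>i. Lj (u i) - Mj i) + shift m (b v)"
      if u: "u permutes {..<m}" and v: "v permutes {..<N}" for u v
    proof (rule poly_mapping_eqI)
      fix i
      have inj: "inj (w \<circ> (shift_perm m v \<circ> u))"
        using w u shift_perm_permutes[OF v, of m] by (intro inj_compose) (auto intro: permutes_inj)
      consider "i < m" | j where "i = m + j" "j < N" | "m + N \<le> i"
        by (metis add_less_cancel_left le_add_diff_inverse not_le)
      then show "lookup (map_key (w \<circ> (shift_perm m v \<circ> u)) (shifted n \<mu>) - shifted n \<gamma>) i =
          lookup (vec m (\<lambda>i. Lj (u i) - Mj i) + shift m (b v)) i"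
      proof cases
        case 1
        then have "u i < m"
          using permutes_in_image[OF u, of i] by simp
        then have "lookup (map_key (w \<circ> (shift_perm m v \<circ> u)) (shifted n \<mu>)) i = L (u i)"
          by (simp add: lookup_map_key[OF inj] L_def)
        moreover have "lookup (shifted n \<gamma>) i = \<nu> ! i + int n - 1 - int i"
          unfolding lookup_shifted[OF len(2)] using 1 by (simp add: n_def \<nu>_nth)
        ultimately show ?thesis
          using 1 \<open>u i < m\<close>
          by (simp only: lookup_minus lookup_add lookup_vec lookup_shift Lj_def Mj_def \<alpha>_nth) simp
      next
        case 2
        have "v j < N"
          using permutes_in_image[OF v, of j] 2 by simp
        have "u i = i"
          using permutes_not_in[OF u, of i] 2 by simp
        then have "lookup (map_key (w \<circ> (shift_perm m v \<circ> u)) (shifted n \<mu>)) i = L (m + v j)"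
          using 2 by (simp add: lookup_map_key[OF inj] L_def)
        moreover have "lookup (shifted n \<gamma>) i = lookup (shifted N (drop m \<gamma>)) j"
          unfolding lookup_shifted[OF len(2)] lookup_shifted[OF len(4)] using 2 by (simp add: n_def len(2)[unfolded n_def])
        moreover have "lookup (map_key v (shifted N (\<beta> w))) j = L (m + v j)"
          using \<open>v j < N\<close> by (simp add: lookup_map_key[OF permutes_inj[OF v]] \<beta>_shifted)
        ultimately show ?thesis
          using 2 by (simp only: lookup_minus lookup_add lookup_vec lookup_shift b_def) simp
      next
        case 3
        have ids: "u i = i" "v (i - m) = i - m" "w i = i"
          using permutes_not_in[OF u, of i] permutes_not_in[OF v, of "i - m"] permutes_not_in[OF w, of i] 3
          by (auto simp: n_def)
        then have "lookup (map_key (w \<circ> (shift_perm m v \<circ> u)) (shifted n \<mu>)) i = 0"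
          unfolding lookup_map_key[OF inj] lookup_shifted[OF len(1)]
          using 3 by (simp add: shift_perm_def n_def)
        moreover have "lookup (shifted n \<gamma>) i = 0"
          unfolding lookup_shifted[OF len(2)] using 3 by (simp add: n_def)
        moreover have "lookup (b v) (i - m) = 0"
        proof -
          have "\<not> i - m < N"
            using 3 by linarith
          then show ?thesis
            unfolding b_def lookup_minus lookup_map_key[OF permutes_inj[OF v]] \<beta>_shifted
              lookup_shifted[OF len(4)] ids(2) by simp
        qed
        ultimately show ?thesis
          using 3 by (simp only: lookup_minus lookup_add lookup_vec lookup_shift) simp
      qed
    qed
    \<comment> \<open>The power of \<open>q\<close> taken from the roots leaving the first block
      does not depend on \<open>u\<close>, so it can be taken out of the determinant.\<close>
    have sumD: "(\<Sum>i<m. Lj (u i) - Mj i) = D" if u: "u permutes {..<m}" for u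
    proof -
      have "(\<Sum>i<m. Lj (u i)) = (\<Sum>i<m. Lj i)"
        using sum.permute[OF u, of Lj] by (simp add: o_def)
      then show ?thesis
        by (simp add: sum_subtractf Lj_def Mj_def D_def sum_list_sum_nth len_\<alpha> len atLeast0LessThan)
    qed
    define S where "S = jt N m Lj Mj"
    have inner: "(\<Sum>u | u permutes {..<m}. sign u * lookup (fps_nth (B (m # \<eta>)) d)
        (map_key (w \<circ> (shift_perm m v \<circ> u)) (shifted n \<mu>) - shifted n \<gamma>)) =
        (if D \<le> int d then lookup (map_exp uminus S * fps_nth (B \<eta>) (d - nat D)) (b v) else 0)"
      if v: "v permutes {..<N}" for v
    proof -
      have "lookup (fps_nth (B (m # \<eta>)) d) (map_key (w \<circ> (shift_perm m v \<circ> u)) (shifted n \<mu>) - shifted n \<gamma>) =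
          (if D \<le> int d then lookup (map_exp uminus (\<Prod>i<m. hsym N (Lj (u i) - Mj i)) *
            fps_nth (B \<eta>) (d - nat D)) (b v) else 0)" if u: "u permutes {..<m}" for u
      \<comment> \<open>When an index is negative the coefficient is 0, and so is the product of the
        \<open>hsym\<close>. Hence one formula holds for all \<open>u\<close>, as the determinant
        requires.\<close>
      proof (cases "\<forall>i<m. 0 \<le> Lj (u i) - Mj i")
        case True
        then show ?thesis
          unfolding expo[OF u v] lookup_B_Cons sumD[OF u] N_def by simp
      next
        case False
        then obtain i where "i < m" "Lj (u i) - Mj i < 0"
          by force
        then have "(\<Prod>i<m. hsym N (Lj (u i) - Mj i)) = 0"
          by (auto intro!: prod_zero bexI[of _ i] hsym_neg)
        moreover have "\<not> ((\<forall>i<m. 0 \<le> Lj (u i) - Mj i) \<and> (\<Sum>i<m. Lj (u i) - Mj i) \<le> int d)"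
          using False by blast
        ultimately show ?thesis
          unfolding expo[OF u v] lookup_B_Cons by (simp only: if_False map_exp_zero mult_zero_left lookup_zero if_cancel)
      qed
      then have "(\<Sum>u | u permutes {..<m}. sign u * lookup (fps_nth (B (m # \<eta>)) d)
          (map_key (w \<circ> (shift_perm m v \<circ> u)) (shifted n \<mu>) - shifted n \<gamma>)) =
          (\<Sum>u | u permutes {..<m}. sign u * (if D \<le> int d then
            lookup (map_exp uminus (\<Prod>i<m. hsym N (Lj (u i) - Mj i)) *
            fps_nth (B \<eta>) (d - nat D)) (b v) else 0))"
        by (intro sum.cong) auto
      also have "\<dots> = (if D \<le> int d then lookup ((\<Sum>u | u permutes {..<m}. of_int (sign u) *
          map_exp uminus (\<Prod>i<m. hsym N (Lj (u i) - Mj i))) * fps_nth (B \<eta>) (d - nat D)) (b v) else 0)"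
        by (simp add: sum_distrib_right lookup_sum lookup_of_int_times mult.assoc)
      also have "(\<Sum>u | u permutes {..<m}. of_int (sign u) *
          map_exp uminus (\<Prod>i<m. hsym N (Lj (u i) - Mj i))) = map_exp uminus S"
      proof -
        have "map_exp uminus (of_int c) = of_int c" for c
          by (simp flip: single_of_int)
        then show ?thesis
          by (simp add: S_def jt_def map_exp_sum map_exp_times)
      qed
      finally show ?thesis .
    qed
    have "(\<Sum>v | v permutes {..<N}. sign v * (\<Sum>u | u permutes {..<m}. sign u *
        lookup (fps_nth (B (m # \<eta>)) d)
        (map_key (w \<circ> (shift_perm m v \<circ> u)) (shifted n \<mu>) - shifted n \<gamma>))) =
        (if D \<le> int d then lookup (J N (single (shifted N (drop m \<gamma>)) 1 *
          (map_exp uminus S * fps_nth (B \<eta>) (d - nat D)))) (shifted N (\<beta> w)) else 0)"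
      by (simp add: inner lookup_J lookup_single_times b_def)
    also have "\<dots> = (if contains (\<alpha> w) \<nu> \<and> D \<le> int d
      then \<Sum>\<sigma> | is_partition N \<sigma> \<and> LR N \<sigma> (\<alpha> w) \<nu> (\<beta> w) \<noteq> 0. LR N \<sigma> (\<alpha> w) \<nu> (\<beta> w) *
        fps_nth (K \<sigma> (drop m \<gamma>) \<eta>) (d - nat D)
      else 0)"
    proof (cases "contains (\<alpha> w) \<nu>")
      case True
      then have le: "\<nu> ! r \<le> \<alpha> w ! r" if "r < m" for r
        using that len(3) by (auto simp: contains_def list_all2_conv_all_nth)
      have S: "skew_schur N (\<alpha> w) \<nu> = S"
        using jacobi_trudi[of "\<alpha> w" \<nu> N] \<alpha>_dec \<nu>_dec \<nu>_nonneg le len_\<alpha>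
        by (simp add: S_def Lj_def[abs_def] Mj_def[abs_def])
      have "0 \<le> lookup (shifted N (\<beta> w)) i" for i
        by (simp add: \<beta>_shifted L_def \<mu>_nonneg)
      then have "lookup (J N (single (shifted N (drop m \<gamma>)) 1 *
          (map_exp uminus S * fps_nth (B \<eta>) (d - nat D)))) (shifted N (\<beta> w)) =
          (\<Sum>\<sigma> | is_partition N \<sigma> \<and> LR N \<sigma> (\<alpha> w) \<nu> (\<beta> w) \<noteq> 0. LR N \<sigma> (\<alpha> w) \<nu> (\<beta> w) *
          fps_nth (K \<sigma> (drop m \<gamma>) \<eta>) (d - nat D))"
        unfolding S[symmetric] unfolding N_def
        by (intro sum_LR_K)
          (simp_all only: len(4) len_\<alpha> S S_def symmetric_jt jt_in flip: N_def)
      then show ?thesis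
        using True by simp
    next
      case False
      then obtain k where "k < m" "\<alpha> w ! k < \<nu> ! k"
        using len(3) len_\<alpha> by (force simp: contains_def list_all2_conv_all_nth)
      \<comment> \<open>A failure of containment at \<open>k\<close> means
        \<open>Lj k < Mj k\<close>, so the whole determinant vanishes.\<close>
      then have "S = 0"
        unfolding S_def using \<alpha>_dec \<nu>_dec
        by (intro jt_eq_0[of m Lj Mj k]) (auto simp: Lj_def Mj_def intro!: diff_mono)
      with False show ?thesis
        by simp
    qed
    finally show "(\<Sum>v | v permutes {..<N}. sign v * (\<Sum>u | u permutes {..<m}. sign u *
        lookup (fps_nth (B (m # \<eta>)) d)
        (map_key (w \<circ> (shift_perm m v \<circ> u)) (shifted n \<mu>) - shifted n \<gamma>))) =
        (if contains (\<alpha> w) \<nu> \<and> sum_list (\<alpha> w) - sum_list \<nu> \<le> int d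
      then \<Sum>\<sigma> | is_partition N \<sigma> \<and> LR N \<sigma> (\<alpha> w) \<nu> (\<beta> w) \<noteq> 0. LR N \<sigma> (\<alpha> w) \<nu> (\<beta> w) *
        fps_nth (K \<sigma> (drop m \<gamma>) \<eta>) (d - nat (sum_list (\<alpha> w) - sum_list \<nu>))
      else 0)"
      unfolding D_def .
  qed
  finally show ?thesis
    unfolding N_def n_def \<nu>_def .
qed

theorem mainTheorem6:
  fixes \<eta> :: "nat list" and \<gamma> \<mu> :: "int list" and n :: nat and R :: "int list list"
  assumes eta_pos: "\<forall>k\<in>set \<eta>. 0 < k" and eta_sum: "sum_list \<eta> = n"
    and gamma: "length \<gamma> = n"
    and R: "R = blocks \<eta> \<gamma>"
    and R_partitions: "\<forall>i<length \<eta>. is_partition (\<eta> ! i) (R ! i)"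
    and mu: "is_partition n \<mu>" "sum_list \<mu> = (\<Sum>i<length \<eta>. sum_list (R ! i))"
  shows "(length \<eta> = 1 \<longrightarrow> K \<mu> \<gamma> \<eta> = (if \<mu> = R ! 0 then 1 else 0)) \<and>
    (length \<eta> > 1 \<longrightarrow>
      (let m = \<eta> ! 0;
           \<alpha> = (\<lambda>w. take m (dot_inv w \<mu>));
           \<beta> = (\<lambda>w. drop m (dot_inv w \<mu>))
       in K \<mu> \<gamma> \<eta> =
         (\<Sum>w\<in>min_coset_reps n m.
            if (\<forall>a\<in>set (\<alpha> w). 0 \<le> a) \<and> contains (\<alpha> w) (R ! 0)
            then of_int (sign w) * fps_X ^ nat (sum_list (\<alpha> w) - sum_list (R ! 0)) *
              (\<Sum>\<sigma> | is_partition (n - m) \<sigma> \<and> LR (n - m) \<sigma> (\<alpha> w) (R ! 0) (\<beta> w) \<noteq> 0.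
                 of_int (LR (n - m) \<sigma> (\<alpha> w) (R ! 0) (\<beta> w)) * K \<sigma> (drop m \<gamma>) (tl \<eta>))
            else 0)))"
proof (intro conjI impI)
  assume "length \<eta> = 1"
  then obtain k where k: "\<eta> = [k]"
    by (auto simp: length_Suc_conv)
  then have [simp]: "n = k" "R ! 0 = \<gamma>" "length \<gamma> = k" "length \<mu> = k"
    using eta_sum gamma R mu(1) by (auto simp: is_partition_def dominant_def)
  have dom: "dominant k \<mu>" "dominant k \<gamma>"
    using mu(1) R_partitions k by (simp_all add: is_partition_def)
  \<comment> \<open>The only cut of a single block is at its end, with no position behind
    it.\<close>
  have "Roots [k] = {}"
    by (auto simp: Roots_def)
  then have B1: "B [k] = 1"
    by (simp add: B_def)
  show "K \<mu> \<gamma> \<eta> = (if \<mu> = R ! 0 then 1 else 0)"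
  proof (rule fps_ext)
    fix d
    have "fps_nth (K \<mu> \<gamma> \<eta>) d = (if d = 0 then (if shifted k \<gamma> = shifted k \<mu> then 1 else 0) else 0)"
      using K_nth[of "[k]" \<mu> \<gamma> d] dom lookup_J_single_decreasing[OF decreasing_shifted decreasing_shifted, of k \<gamma> \<mu>]
      by (simp add: k B1)
    moreover have "shifted k \<gamma> = shifted k \<mu> \<longleftrightarrow> \<mu> = \<gamma>"
      using shifted_inj[of \<gamma> k \<mu>] by auto
    ultimately show "fps_nth (K \<mu> \<gamma> \<eta>) d = fps_nth (if \<mu> = R ! 0 then 1 else 0) d"
      by simp
  qed
next
  assume "length \<eta> > 1"
  then obtain m \<eta>' where \<eta>: "\<eta> = m # \<eta>'"
    by (cases \<eta>) auto
  define \<nu> where "\<nu> = take m \<gamma>"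
  have \<nu>: "R ! 0 = \<nu>" "is_partition m \<nu>"
    using R R_partitions by (auto simp: \<eta> \<nu>_def)
  have n: "n = m + sum_list \<eta>'"
    using eta_sum by (simp add: \<eta>)
  have N: "sum_list \<eta>' = n - m"
    by (simp add: n)
  define \<alpha> where "\<alpha> = (\<lambda>w. take m (dot_inv w \<mu>))"
  define \<beta> where "\<beta> = (\<lambda>w. drop m (dot_inv w \<mu>))"
  have nonneg: "(\<forall>a\<in>set (\<alpha> w). 0 \<le> a) \<and> contains (\<alpha> w) \<nu> \<longleftrightarrow> contains (\<alpha> w) \<nu>" for w
    using \<nu>(2) unfolding is_partition_def contains_def list_all2_conv_all_nth
    by (metis in_set_conv_nth order_trans nth_mem)
  have "K \<mu> \<gamma> \<eta> = (\<Sum>w\<in>min_coset_reps n m.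
      if contains (\<alpha> w) \<nu>
      then of_int (sign w) * fps_X ^ nat (sum_list (\<alpha> w) - sum_list \<nu>) *
        (\<Sum>\<sigma> | is_partition (n - m) \<sigma> \<and> LR (n - m) \<sigma> (\<alpha> w) \<nu> (\<beta> w) \<noteq> 0.
           of_int (LR (n - m) \<sigma> (\<alpha> w) \<nu> (\<beta> w)) * K \<sigma> (drop m \<gamma>) \<eta>')
      else 0)"
  proof (rule fps_ext)
    fix d
    have const: "fps_nth (of_int c * f) e = c * fps_nth f e" for c :: int and f :: "int fps" and e
      by (simp flip: fps_of_int)
    have "fps_nth (K \<mu> \<gamma> \<eta>) d = (\<Sum>w\<in>min_coset_reps n m. sign w *
      (if contains (\<alpha> w) \<nu> \<and> sum_list (\<alpha> w) - sum_list \<nu> \<le> int d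
       then \<Sum>\<sigma> | is_partition (n - m) \<sigma> \<and> LR (n - m) \<sigma> (\<alpha> w) \<nu> (\<beta> w) \<noteq> 0.
         LR (n - m) \<sigma> (\<alpha> w) \<nu> (\<beta> w) *
         fps_nth (K \<sigma> (drop m \<gamma>) \<eta>') (d - nat (sum_list (\<alpha> w) - sum_list \<nu>))
       else 0))"
      using K_Cons_nth[of \<gamma> m \<eta>' \<mu> d] gamma mu(1) \<nu>(2)
      by (simp only: \<eta> \<alpha>_def \<beta>_def \<nu>_def N n[symmetric, unfolded N])
    also have "\<dots> = fps_nth (\<Sum>w\<in>min_coset_reps n m. if contains (\<alpha> w) \<nu>
      then of_int (sign w) * fps_X ^ nat (sum_list (\<alpha> w) - sum_list \<nu>) *
        (\<Sum>\<sigma> | is_partition (n - m) \<sigma> \<and> LR (n - m) \<sigma> (\<alpha> w) \<nu> (\<beta> w) \<noteq> 0.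
           of_int (LR (n - m) \<sigma> (\<alpha> w) \<nu> (\<beta> w)) * K \<sigma> (drop m \<gamma>) \<eta>')
      else 0) d"
      unfolding fps_sum_nth
      by (intro sum.cong refl)
        \<comment> \<open>Multiplying by \<open>fps_X ^ e\<close> shifts coefficients by
          \<open>e\<close> and gives 0 below degree \<open>e\<close>, which matches the guard in the
          coefficient formula.\<close>
        (auto simp: mult.assoc const fps_X_power_mult_nth fps_sum_nth nat_less_iff zless_nat_eq_int_zless not_le not_less)
    finally show "fps_nth (K \<mu> \<gamma> \<eta>) d = \<dots>" .
  qed
  then show "let m = \<eta> ! 0;
           \<alpha> = (\<lambda>w. take m (dot_inv w \<mu>));
           \<beta> = (\<lambda>w. drop m (dot_inv w \<mu>))
       in K \<mu> \<gamma> \<eta> =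
         (\<Sum>w\<in>min_coset_reps n m.
            if (\<forall>a\<in>set (\<alpha> w). 0 \<le> a) \<and> contains (\<alpha> w) (R ! 0)
            then of_int (sign w) * fps_X ^ nat (sum_list (\<alpha> w) - sum_list (R ! 0)) *
              (\<Sum>\<sigma> | is_partition (n - m) \<sigma> \<and> LR (n - m) \<sigma> (\<alpha> w) (R ! 0) (\<beta> w) \<noteq> 0.
                 of_int (LR (n - m) \<sigma> (\<alpha> w) (R ! 0) (\<beta> w)) * K \<sigma> (drop m \<gamma>) (tl \<eta>))
            else 0)"
    using nonneg unfolding \<alpha>_def \<beta>_def by (simp add: Let_def \<eta> \<nu>(1) cong: if_cong)
qed

end
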